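(* Let $k$ be a field and let $P$ be the face poset (with empty face as $\hat0$ and a top element $\hat1$ adjoined) of a Gorenstein* simplicial complex of dimension $n-1$, so $P$ is graded of rank $n+1$. Then there exists a standard $\mathbb{Z}^n$-graded $k$-algebra $A=\bigoplus_{v\in\mathbb{Z}^n}A_v$ such that $\Psi_{P,v}=\dim_k A_v$ for every $v\in\mathbb{Z}^n$.
   Context: A simplicial complex of dimension $n-1$ is Gorenstein* if it is a homology $(n-1)$-sphere: for every face $F$ (including the empty face) the link of $F$ has the reduced homology of a sphere of dimension $n-2-\dim F$. Flag numbers and the $\mathbf{c}\mathbf{d}$-index: for a graded poset $P$ of rank $n+1$ with $\hat0,\hat1$ and rank function $\rho$, the type of a chain $\hat0<x_1<\dots<x_m<\hat1$ is $S=\{\rho(x_1),\dots,\rho(x_m)\}\subseteq\{1,\dots,n\}$, and $f_S$ is the number of chains of type $S$. Set $\Psi_P(t_1,\dots,t_n)=\sum_S f_S\prod_{i\notin S}(t_i-1)$. A degree-$n$ monomial in noncommuting variables $\mathbf{c}$ (degree 1), $\mathbf{d}$ (degree 2) is identified with a polynomial in $t_1,\dots,t_n$ by replacing, left to right, each $\mathbf{c}$ in position $i$ by $(t_i+1)$ and each $\mathbf{d}$ in positions $i,i+1$ by $(t_i+t_{i+1})$. For Eulerian $P$ (such as $P$ in the claim) $\Psi_P$ is uniquely a homogeneous degree-$n$ polynomial in $\mathbf{c},\mathbf{d}$ (the $\mathbf{c}\mathbf{d}$-index). The multidegree of a $\mathbf{c}\mathbf{d}$-monomial is the $0/1$ vector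 in $\mathbb{Z}^n$ obtained by replacing $\mathbf{c}$ by $0$ and $\mathbf{d}$ by $1,0$. $\Psi_{P,v}$ is the coefficient of the monomial of multidegree $v$, and $0$ if $v$ is not such a multidegree. A $\mathbb{Z}^n$-graded $k$-algebra $A$ (associative, commutative, with $1$) is standard if $A_0=k$ and $A$ is generated by elements of degrees $e_1,\dots,e_n$, the standard basis vectors of $\mathbb{Z}^n$. *)

theory Defs
  imports
    "HOL-Library.Poly_Mapping"
    "HOL-Algebra.Generated_Rings"
    "Jordan_Normal_Form.Missing_VectorSpace"
begin

section \<open>Simplicial complexes and the Gorenstein* property\<close>

definition simplicial_complex :: "'a set set \<Rightarrow> bool" where
  "simplicial_complex \<Delta> \<longleftrightarrow>
     finite \<Delta> \<and> {} \<in> \<Delta> \<and> (\<forall>F\<in>\<Delta>. finite F \<and> (\<forall>G. G \<subseteq> F \<longrightarrow> G \<in> \<Delta>))"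

definition face_dim :: "'a set \<Rightarrow> int" where
  "face_dim F = int (card F) - 1"

definition complex_dim :: "'a set set \<Rightarrow> int" where
  "complex_dim \<Delta> = Max (face_dim ` \<Delta>)"

definition link :: "'a set set \<Rightarrow> 'a set \<Rightarrow> 'a set set" where
  "link \<Delta> F = {G \<in> \<Delta>. F \<inter> G = {} \<and> F \<union> G \<in> \<Delta>}"

text \<open>
  The augmented simplicial chain complex with coefficients in \<open>'r\<close>. A chain is a function on
  faces, each face being oriented by the linear order of the vertices; the empty face spans
  degree \<open>-1\<close>, so that the homology is reduced and the complex \<open>{{}}\<close> is the sphere of dimension
  \<open>-1\<close>.
\<close>

definition chain_group :: "'a set set \<Rightarrow> int \<Rightarrow> ('a set \<Rightarrow> 'r::zero) set" where
  "chain_group \<Delta> i = {c. \<forall>F. c F \<noteq> 0 \<longrightarrow> F \<in> \<Delta> \<and> face_dim F = i}"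

text \<open>
  The coefficient of \<open>G\<close> in the boundary of \<open>c\<close> collects the faces \<open>insert v G\<close>; the exponent of
  the sign is the position of \<open>v\<close> in the ordered face \<open>insert v G\<close>.
\<close>

definition boundary :: "'a::linorder set set \<Rightarrow> ('a set \<Rightarrow> 'r::comm_ring_1) \<Rightarrow> 'a set \<Rightarrow> 'r" where
  "boundary \<Delta> c = (\<lambda>G. \<Sum>v\<in>\<Union>\<Delta> - G. (- 1) ^ card {w \<in> G. w < v} * c (insert v G))"

definition cycles :: "'a::linorder set set \<Rightarrow> int \<Rightarrow> ('a set \<Rightarrow> 'r::comm_ring_1) set" where
  "cycles \<Delta> i = {c \<in> chain_group \<Delta> i. boundary \<Delta> c = (\<lambda>_. 0)}"

definition boundaries :: "'a::linorder set set \<Rightarrow> int \<Rightarrow> ('a set \<Rightarrow> 'r::comm_ring_1) set" where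
  "boundaries \<Delta> i = boundary \<Delta> ` chain_group \<Delta> (i + 1)"

text \<open>
  The quotient of cycles by boundaries is zero outside degree \<open>d\<close>, and in degree \<open>d\<close> it is free
  of rank one: \<open>z\<close> is a cycle whose class is a basis.
\<close>

definition has_homology_of_sphere ::
  "'r::idom itself \<Rightarrow> 'a::linorder set set \<Rightarrow> int \<Rightarrow> bool" where
  "has_homology_of_sphere _ \<Delta> d \<longleftrightarrow>
     (\<forall>i. i \<noteq> d \<longrightarrow> (cycles \<Delta> i :: ('a set \<Rightarrow> 'r) set) = boundaries \<Delta> i) \<and>
     (\<exists>z \<in> cycles \<Delta> d. \<forall>c \<in> cycles \<Delta> d.
        \<exists>!r::'r. (\<lambda>F. c F - r * z F) \<in> boundaries \<Delta> d)"

text \<open>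
  The coefficient ring is an arbitrary integral domain, which includes the integers and all
  fields. If \<open>\<Delta>\<close> has dimension \<open>n - 1\<close>, the sphere below has dimension \<open>n - 2 - face_dim F\<close>.
\<close>

definition gorenstein_star :: "'r::idom itself \<Rightarrow> 'a::linorder set set \<Rightarrow> bool" where
  "gorenstein_star R \<Delta> \<longleftrightarrow>
     (\<forall>F\<in>\<Delta>. has_homology_of_sphere R (link \<Delta> F) (complex_dim \<Delta> - 1 - face_dim F))"


section \<open>Posets and flag numbers\<close>

text \<open>
  A poset is given by its reflexive order relation, with underlying set the field of the relation.
  In the face poset, \<open>Some {}\<close> is the bottom and the adjoined top element is \<open>None\<close>.
\<close>

definition face_poset :: "'a set set \<Rightarrow> 'a set option rel" where
  "face_poset \<Delta> =
     {(Some F, Some G) | F G. F \<in> \<Delta> \<and> G \<in> \<Delta> \<and> F \<subseteq> G} \<union> {(x, None) | x. x \<in> insert None (Some ` \<Delta>)}"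

text \<open>The rank of \<open>x\<close> is the largest size of a chain strictly below \<open>x\<close>.\<close>

definition poset_rank :: "'p rel \<Rightarrow> 'p \<Rightarrow> nat" where
  "poset_rank r x = Max (card ` {C \<in> Chains r. C \<subseteq> underS r x})"

text \<open>
  Only types \<open>S \<subseteq> {1..n}\<close> are used below for a poset of rank \<open>n + 1\<close>; chains of such a type avoid
  the bottom (of rank \<open>0\<close>) and the top (of rank \<open>n + 1\<close>).
\<close>

definition flag_number :: "'p rel \<Rightarrow> nat set \<Rightarrow> nat" where
  "flag_number r S = card {C \<in> Chains r. poset_rank r ` C = S}"

text \<open>
  Integer polynomials in variables indexed by natural numbers; the keys are the exponent vectors.
\<close>

type_synonym int_mpoly = "(nat \<Rightarrow>\<^sub>0 nat) \<Rightarrow>\<^sub>0 int"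

definition var :: "nat \<Rightarrow> int_mpoly" where
  "var i = Poly_Mapping.single (Poly_Mapping.single i 1) 1"

definition flag_poly :: "nat \<Rightarrow> 'p rel \<Rightarrow> int_mpoly" where
  "flag_poly n r = (\<Sum>S\<in>Pow {1..n}. of_nat (flag_number r S) * (\<Prod>i\<in>{1..n} - S. (var i - 1)))"


section \<open>The cd-index\<close>

datatype cd_letter = C_letter | D_letter

type_synonym cd_monomial = "cd_letter list"

text \<open>Integer polynomials in the noncommuting variables \<open>c\<close> and \<open>d\<close>.\<close>

type_synonym cd_poly = "cd_monomial \<Rightarrow>\<^sub>0 int"

fun cd_degree :: "cd_monomial \<Rightarrow> nat" where
  "cd_degree [] = 0"
| "cd_degree (C_letter # w) = 1 + cd_degree w"
| "cd_degree (D_letter # w) = 2 + cd_degree w"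

text \<open>In the next two functions, \<open>i\<close> is the position of the first letter.\<close>

fun cd_monomial_eval :: "nat \<Rightarrow> cd_monomial \<Rightarrow> int_mpoly" where
  "cd_monomial_eval i [] = 1"
| "cd_monomial_eval i (C_letter # w) = (var i + 1) * cd_monomial_eval (i + 1) w"
| "cd_monomial_eval i (D_letter # w) = (var i + var (i + 1)) * cd_monomial_eval (i + 2) w"

fun multidegree_from :: "nat \<Rightarrow> cd_monomial \<Rightarrow> (nat \<Rightarrow>\<^sub>0 int)" where
  "multidegree_from i [] = 0"
| "multidegree_from i (C_letter # w) = multidegree_from (i + 1) w"
| "multidegree_from i (D_letter # w) = Poly_Mapping.single i 1 + multidegree_from (i + 2) w"

definition multidegree :: "cd_monomial \<Rightarrow> (nat \<Rightarrow>\<^sub>0 int)" where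
  "multidegree w = multidegree_from 1 w"

definition cd_monomials :: "nat \<Rightarrow> cd_monomial set" where
  "cd_monomials n = {w. cd_degree w = n}"

definition cd_eval :: "cd_poly \<Rightarrow> int_mpoly" where
  "cd_eval \<Phi> = (\<Sum>w\<in>Poly_Mapping.keys \<Phi>. of_int (Poly_Mapping.lookup \<Phi> w) * cd_monomial_eval 1 w)"

text \<open>For a poset of rank \<open>n + 1\<close>; meaningful when the polynomial exists, as for Eulerian posets.\<close>

definition cd_index :: "nat \<Rightarrow> 'p rel \<Rightarrow> cd_poly" where
  "cd_index n r = (THE \<Phi>. Poly_Mapping.keys \<Phi> \<subseteq> cd_monomials n \<and> cd_eval \<Phi> = flag_poly n r)"

text \<open>A monomial of degree \<open>n\<close> is determined by its multidegree.\<close>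

definition cd_coeff :: "nat \<Rightarrow> 'p rel \<Rightarrow> (nat \<Rightarrow>\<^sub>0 int) \<Rightarrow> int" where
  "cd_coeff n r v =
     (if v \<in> multidegree ` cd_monomials n
      then Poly_Mapping.lookup (cd_index n r) (inv_into (cd_monomials n) multidegree v)
      else 0)"


section \<open>Standard multigraded algebras\<close>

text \<open>The lattice \<open>\<int>\<^sup>n\<close>, with coordinates indexed by \<open>1, \<dots>, n\<close>.\<close>

definition Zn :: "nat \<Rightarrow> (nat \<Rightarrow>\<^sub>0 int) set" where
  "Zn n = {v. Poly_Mapping.keys v \<subseteq> {1..n}}"

text \<open>
  Algebras over \<open>K\<close> in the sense of \<^locale>\<open>algebra\<close> are associative and commutative with \<open>1\<close>.
  The family \<open>\<A>\<close> is only relevant on \<open>Zn n\<close>.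
\<close>

locale standard_Zn_graded_algebra =
  algebra K A + K?: field K
  for K (structure) and A (structure) +
  fixes n :: nat and \<A> :: "(nat \<Rightarrow>\<^sub>0 int) \<Rightarrow> 'c set"
  assumes component_subspace: "v \<in> Zn n \<Longrightarrow> VectorSpace.subspace K (\<A> v) A"
    and decomposition: "a \<in> carrier A \<Longrightarrow>
      \<exists>!x. x \<in> (\<Pi>\<^sub>E v\<in>Zn n. \<A> v) \<and> finite {v \<in> Zn n. x v \<noteq> \<zero>\<^bsub>A\<^esub>} \<and>
           a = (\<Oplus>\<^bsub>A\<^esub>v\<in>{v \<in> Zn n. x v \<noteq> \<zero>\<^bsub>A\<^esub>}. x v)"
    and mult_graded: "\<lbrakk>u \<in> Zn n; v \<in> Zn n; a \<in> \<A> u; b \<in> \<A> v\<rbrakk> \<Longrightarrow> a \<otimes>\<^bsub>A\<^esub> b \<in> \<A> (u + v)"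
    and degree_zero: "bij_betw (\<lambda>s. s \<odot>\<^bsub>A\<^esub> \<one>\<^bsub>A\<^esub>) (carrier K) (\<A> 0)"
    and generated: "generate_ring A
      ((\<lambda>s. s \<odot>\<^bsub>A\<^esub> \<one>\<^bsub>A\<^esub>) ` carrier K \<union> (\<Union>i\<in>{1..n}. \<A> (Poly_Mapping.single i 1))) = carrier A"

end

theory Submission
  imports Defs
    "HOL-Library.Multiset"
    "HOL-Library.Function_Algebras"
    "HOL-Computational_Algebra.Polynomial_Factorial"
    "HOL-Computational_Algebra.Polynomial_FPS"
begin

text \<open>The flag numbers of a simplicial complex are linear in its h-vector \<open>h\<close>, so
  the cd-index depends on \<open>h\<close> alone. For a Gorenstein* complex it turns out to count,
  by colours, the faces of a vertex-coloured simplicial complex \<Gamma>. The algebra is then the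
  face ring of \<Gamma> modulo the squares of the variables: it has the faces of \<Gamma> as a basis
  and is generated by the vertices.

  Topology enters through three facts: h_0 = 1, h_i >= 0 and h_i = h_(n-i)
  (\<open>h_poly_coeff_0\<close>, \<open>gorenstein_star_h_poly\<close>). Symmetry comes from the
  Euler characteristics of the links. Nonnegativity is the Cohen-Macaulay property, proved dually
  over an infinite extension of the coefficients. Functions on monomials supported on faces form a
  complex, exact below the top because the links are homology spheres; its top cokernel has in
  degree i the dimension of the face ring. Generic linear forms act on the cokernel, each mapping
  the common kernel of the preceding ones onto itself (\<open>solvable_cokernel\<close>). So the
  common kernel of n of them has Hilbert series (1 - x)^n times that of the face ring, which is
  h(x), and the h_i are dimensions (\<open>hilbert_function\<close>, \<open>h_poly_nonneg\<close>).

  Let s be the sequence of partial sums of h, and F_m(h) the polynomial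
  \<open>h_flag_poly m h\<close>. Sorting chains by their face of largest possible size gives
  F_(m+1)(h) = F_m(s) (t_(m+1) - 1) + s_(m+1) F_m(1, ..., 1), and F_n(h) is the flag polynomial of a
  complex with h-vector h (\<open>chain_poly_eq\<close>, \<open>flag_poly_face_poset\<close>).

  The cd-polynomial is built by Phi_(m+2)(h) = Phi_(m+1)(s) c + sum over 1 <= l <= m+1 of h_l
  Phi_m(T_l) d, where the rows T_l (\<open>transition\<close>) are symmetric and begin with 1. By
  induction Phi_n(h) = F_n(h) - F_(n-1)(D) whenever h_0 = 1, where D_i is the sum over j <= i of
  h_(n-j) - h_j (\<open>lattice_cd_sum_eq\<close>). For symmetric h the correction vanishes. All
  coefficients in the recursion are nonnegative, so it can be read as the construction of \<Gamma>
  (\<open>lattice_faces\<close>): a vertex of the last colour marks a final d, and T_l describes its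
  link. Linear independence of the cd-monomials (\<open>cd_monomials_independent\<close>) identifies
  the coefficients of the cd-index with the face numbers of \<Gamma>
  (\<open>cd_coeff_lattice\<close>).\<close>

section \<open>Linear forms acting on the dual of a polynomial ring\<close>

text \<open>A multiset of vertices is a monomial and a function on multisets is a linear functional
  on polynomials. \<open>contract V w\<close> is the transpose of multiplication by the linear form
  with coefficients \<open>w\<close>. Functions satisfying \<open>supported_on G\<close> form the
  dual of the polynomial ring in the variables of \<open>G\<close>.\<close>

definition contract :: "'a set \<Rightarrow> ('a \<Rightarrow> 'f) \<Rightarrow> ('a multiset \<Rightarrow> 'f) \<Rightarrow> 'a multiset \<Rightarrow> 'f::field" where
  "contract V w x = (\<lambda>a. \<Sum>v\<in>V. w v * x (add_mset v a))"

definition supported_on :: "'a set \<Rightarrow> ('a multiset \<Rightarrow> 'f::zero) \<Rightarrow> bool" where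
  "supported_on G x \<longleftrightarrow> (\<forall>a. x a \<noteq> 0 \<longrightarrow> set_mset a \<subseteq> G)"

lemma supported_onD: "supported_on G x \<Longrightarrow> \<not> set_mset a \<subseteq> G \<Longrightarrow> x a = 0"
  by (auto simp: supported_on_def)

lemma contract_commute:
  "contract V w (contract V w' x) = contract V w' (contract V w x)"
proof
  fix a
  have "contract V w (contract V w' x) a = (\<Sum>v\<in>V. \<Sum>u\<in>V. w v * (w' u * x (add_mset u (add_mset v a))))"
    by (simp add: contract_def sum_distrib_left)
  also have "\<dots> = (\<Sum>u\<in>V. \<Sum>v\<in>V. w v * (w' u * x (add_mset u (add_mset v a))))"
    by (rule sum.swap)
  also have "\<dots> = contract V w' (contract V w x) a"
    by (simp add: contract_def sum_distrib_left mult.left_commute add_mset_commute)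
  finally show "contract V w (contract V w' x) a = contract V w' (contract V w x) a" .
qed

lemma contract_zero [simp]: "contract V w (\<lambda>_. 0) = (\<lambda>_. 0)"
  by (simp add: contract_def)

lemma contract_extend:
  fixes x0 y :: "'a multiset \<Rightarrow> 'f::field"
  assumes fin: "finite G" and v0: "v0 \<in> G" "w v0 \<noteq> 0"
    and y: "supported_on G y" and x0: "supported_on (G - {v0}) x0"
  shows "\<exists>x. supported_on G x \<and> contract G w x = y \<and> (\<forall>a. v0 \<notin># a \<longrightarrow> x a = x0 a)"
proof -
  \<comment> \<open>\<open>g k b\<close> is the intended value of \<open>x\<close> at
    \<open>k\<close> copies of \<open>v0\<close> together with a multiset \<open>b\<close> not
    containing \<open>v0\<close>.\<close>
  define g where "g = rec_nat x0 (\<lambda>k gk b. (y (replicate_mset k v0 + b) -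
      (\<Sum>v\<in>G - {v0}. w v * gk (add_mset v b))) / w v0)"
  have g0: "g 0 = x0" by (simp add: g_def)
  have gS: "g (Suc k) b = (y (replicate_mset k v0 + b) -
      (\<Sum>v\<in>G - {v0}. w v * g k (add_mset v b))) / w v0" for k b
    by (simp add: g_def)
  define x where "x = (\<lambda>a. g (count a v0) (filter_mset (\<lambda>u. u \<noteq> v0) a))"
  have gz: "g k b = 0" if "\<not> set_mset b \<subseteq> G" for k b
    using that
  proof (induction k arbitrary: b)
    case 0
    then show ?case using x0 by (auto simp: g0 supported_on_def)
  next
    case (Suc k)
    have "y (replicate_mset k v0 + b) = 0"
      using Suc.prems by (intro supported_onD[OF y]) auto
    moreover have "(\<Sum>v\<in>G - {v0}. w v * g k (add_mset v b)) = 0"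
      using Suc by (intro sum.neutral) auto
    ultimately show ?case by (simp add: gS)
  qed
  have "supported_on G x"
    unfolding supported_on_def
  proof (intro allI impI)
    fix a assume "x a \<noteq> 0"
    then have "set_mset (filter_mset (\<lambda>u. u \<noteq> v0) a) \<subseteq> G"
      unfolding x_def using gz by blast
    then show "set_mset a \<subseteq> G" using v0(1) by auto
  qed
  moreover have "contract G w x = y"
  proof
    fix a
    define b where "b = filter_mset (\<lambda>u. u \<noteq> v0) a"
    define k where "k = count a v0"
    have a: "replicate_mset k v0 + b = a"
      by (auto simp: multiset_eq_iff k_def b_def)
    have "contract G w x a = w v0 * x (add_mset v0 a) + (\<Sum>v\<in>G - {v0}. w v * x (add_mset v a))"
      using fin v0 by (simp add: contract_def sum.remove)
    also have "(\<Sum>v\<in>G - {v0}. w v * x (add_mset v a)) = (\<Sum>v\<in>G - {v0}. w v * g k (add_mset v b))"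
      by (intro sum.cong) (auto simp: x_def k_def b_def)
    also have "x (add_mset v0 a) = g (Suc k) b"
      by (simp add: x_def k_def b_def)
    finally show "contract G w x a = y a"
      using v0(2) a by (simp add: gS)
  qed
  moreover have "x a = x0 a" if "v0 \<notin># a" for a
  proof -
    have "filter_mset (\<lambda>u. u \<noteq> v0) a = a"
      using that by (auto simp: multiset_eq_iff not_in_iff)
    moreover have "count a v0 = 0" using that by (simp add: not_in_iff)
    ultimately show ?thesis by (simp add: x_def g0)
  qed
  ultimately show ?thesis by blast
qed

lemma contract_unique:
  fixes x :: "'a multiset \<Rightarrow> 'f::field"
  assumes fin: "finite G" and v0: "v0 \<in> G" "w v0 \<noteq> 0"
    and eq: "contract G w x = contract G w y" and xy: "\<And>a. v0 \<notin># a \<Longrightarrow> x a = y a"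
  shows "x = y"
proof -
  have "x a = y a" if "count a v0 = k" for k a
    using that
  proof (induction k arbitrary: a)
    case 0
    then show ?case using xy by (simp add: count_eq_zero_iff)
  next
    case (Suc k)
    then obtain b where a: "a = add_mset v0 b"
      by (metis insert_DiffM count_greater_zero_iff zero_less_Suc)
    have "(\<Sum>v\<in>G. w v * x (add_mset v b)) = (\<Sum>v\<in>G. w v * y (add_mset v b))"
      using eq by (simp add: contract_def fun_eq_iff)
    moreover have "(\<Sum>v\<in>G - {v0}. w v * x (add_mset v b)) = (\<Sum>v\<in>G - {v0}. w v * y (add_mset v b))"
      using Suc a by (intro sum.cong) auto
    ultimately show ?case using fin v0 a by (simp add: sum.remove)
  qed
  then show ?thesis by auto
qed

text \<open>The dual form of a regularity statement: the linear forms with coefficients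
  \<open>c v * t v ^ s\<close>, for \<open>s \<le> m < card G\<close>, are a regular sequence, their
  coefficient matrix being of Vandermonde type. One vertex \<open>v0\<close> is eliminated at a
  time: form number s+1 minus \<open>t v0\<close> times form number s lacks \<open>v0\<close> and
  has coefficients \<open>c v * (t v - t v0) * t v ^ s\<close>, again of the same shape. The
  arbitrary nonzero factor \<open>c\<close> is there to make this induction close.\<close>

lemma contract_solvable:
  fixes t :: "'a \<Rightarrow> 'f::field"
  assumes "finite G" "inj_on t G" "\<forall>v\<in>G. c v \<noteq> 0" "m < card G" "supported_on G y"
    and "\<forall>s<m. contract G (\<lambda>v. c v * t v ^ s) y = (\<lambda>_. 0)"
  shows "\<exists>x. supported_on G x \<and> (\<forall>s<m. contract G (\<lambda>v. c v * t v ^ s) x = (\<lambda>_. 0)) \<and>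
     contract G (\<lambda>v. c v * t v ^ m) x = y"
  using assms
proof (induction m arbitrary: G c y)
  case 0
  then obtain v0 where v0: "v0 \<in> G" by (metis card_gt_0_iff all_not_in_conv)
  have "supported_on (G - {v0}) (\<lambda>_. 0::'f)" by (simp add: supported_on_def)
  from contract_extend[OF 0(1) v0 _ 0(5) this, of "\<lambda>v. c v * t v ^ 0"] 0 v0
  show ?case by auto
next
  case (Suc m)
  let ?w = "\<lambda>s v. c v * t v ^ s"
  obtain v0 where v0: "v0 \<in> G" using Suc.prems by (metis card_gt_0_iff all_not_in_conv not_less0 neq0_conv)
  define G' where "G' = G - {v0}"
  define c' where "c' = (\<lambda>v. c v * (t v - t v0))"
  \<comment> \<open>Restriction to multisets without \<open>v0\<close>. By
    \<open>contract_unique\<close> it loses no information on functions killed by form number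
    0.\<close>
  define r where "r = (\<lambda>(z::'a multiset \<Rightarrow> 'f) a. if v0 \<in># a then 0 else z a)"
  have r_supp: "supported_on G' (r z)" if "supported_on G z" for z
    using that by (auto simp: supported_on_def r_def G'_def)
  have key: "contract G' (\<lambda>v. c' v * t v ^ s) (r z) a = 
      contract G (?w (Suc s)) z a - t v0 * contract G (?w s) z a" if "v0 \<notin># a" for z s a
  proof -
    have "contract G (?w (Suc s)) z a - t v0 * contract G (?w s) z a = (\<Sum>v\<in>G. c' v * t v ^ s * z (add_mset v a))"
      unfolding contract_def sum_distrib_left sum_subtractf[symmetric]
      by (intro sum.cong) (auto simp: c'_def algebra_simps)
    also have "\<dots> = (\<Sum>v\<in>G'. c' v * t v ^ s * z (add_mset v a))"
      unfolding G'_def using Suc.prems(1) v0 by (subst sum.remove[of _ v0]) (auto simp: c'_def)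
    also have "\<dots> = contract G' (\<lambda>v. c' v * t v ^ s) (r z) a"
      unfolding contract_def using that by (intro sum.cong) (auto simp: r_def G'_def)
    finally show ?thesis by simp
  qed
  have fin': "finite G'" using Suc.prems(1) by (simp add: G'_def)
  have "\<exists>x. supported_on G' x \<and> (\<forall>s<m. contract G' (\<lambda>v. c' v * t v ^ s) x = (\<lambda>_. 0)) \<and>
     contract G' (\<lambda>v. c' v * t v ^ m) x = r y"
  proof (rule Suc.IH)
    show "finite G'" by fact
    show "inj_on t G'" using Suc.prems(2) by (auto simp: G'_def inj_on_def)
    show "\<forall>v\<in>G'. c' v \<noteq> 0"
      using Suc.prems(2,3) v0 by (auto simp: G'_def c'_def inj_on_def)
    show "m < card G'" using Suc.prems(1,4) v0 by (simp add: G'_def)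
    show "supported_on G' (r y)" using Suc.prems(5) by (rule r_supp)
    show "\<forall>s<m. contract G' (\<lambda>v. c' v * t v ^ s) (r y) = (\<lambda>_. 0)"
    proof (intro allI impI ext)
      fix s a assume s: "s < m"
      show "contract G' (\<lambda>v. c' v * t v ^ s) (r y) a = 0"
      proof (cases "v0 \<in># a")
        case True
        then show ?thesis by (simp add: contract_def r_def)
      next
        case False
        have "contract G (?w (Suc s)) y = (\<lambda>_. 0)" "contract G (?w s) y = (\<lambda>_. 0)"
          using Suc.prems(6) s by auto
        then show ?thesis using key[OF False, of s y] by simp
      qed
    qed
  qed
  then obtain x' where x': "supported_on G' x'" 
    "\<And>s. s < m \<Longrightarrow> contract G' (\<lambda>v. c' v * t v ^ s) x' = (\<lambda>_. 0)"
    "contract G' (\<lambda>v. c' v * t v ^ m) x' = r y" by blast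
  have w0: "?w 0 v0 \<noteq> 0" using Suc.prems(3) v0 by simp
  have "supported_on G (\<lambda>_. 0::'f)" by (simp add: supported_on_def)
  \<comment> \<open>The solution on \<open>G - {v0}\<close> is extended to \<open>G\<close> by
    demanding that form number 0 kills it.\<close>
  from contract_extend[where w="?w 0", OF Suc.prems(1) v0 w0 this x'(1)[unfolded G'_def]]
  obtain x where x: "supported_on G x" "contract G (?w 0) x = (\<lambda>_. 0)" "\<And>a. v0 \<notin># a \<Longrightarrow> x a = x' a"
    by blast
  have rx: "r x = x'"
  proof
    fix a show "r x a = x' a"
      using x(3)[of a] supported_onD[OF x'(1), of a] by (auto simp: r_def G'_def)
  qed
  \<comment> \<open>The contraction of \<open>x\<close> is itself killed by form number 0, because
    contractions commute; so it is enough to check it on multisets without \<open>v0\<close>, where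
    \<open>key\<close> reduces it to \<open>x'\<close>.\<close>
  have z: "contract G (?w s) x = (\<lambda>_. 0)" if "s \<le> m" for s
    using that
  proof (induction s)
    case 0
    then show ?case using x(2) by simp
  next
    case (Suc s)
    show ?case
    proof (rule contract_unique[where w="?w 0", OF \<open>finite G\<close> v0 w0])
      show "contract G (?w 0) (contract G (?w (Suc s)) x) = contract G (?w 0) (\<lambda>_. 0)"
        by (subst contract_commute) (simp only: x(2) contract_zero)
      fix a assume "v0 \<notin># a"
      from key[OF this, of s x] Suc rx x'(2)[of s] show "contract G (?w (Suc s)) x a = 0" by simp
    qed
  qed
  have "contract G (?w (Suc m)) x = y"
  proof (rule contract_unique[where w="?w 0", OF \<open>finite G\<close> v0 w0])
    have "contract G (?w 0) y = (\<lambda>_. 0)" using Suc.prems(6) by blast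
    then show "contract G (?w 0) (contract G (?w (Suc m)) x) = contract G (?w 0) y"
      by (subst contract_commute) (simp only: x(2) contract_zero)
    fix a assume a: "v0 \<notin># a"
    from key[OF this, of m x] z[of m] rx x'(3) a show "contract G (?w (Suc m)) x a = y a"
      by (simp add: r_def)
  qed
  then show ?case using x(1) z by (auto simp: less_Suc_eq_le)
qed

section \<open>Commuting operators on a complex that is exact below the top\<close>

text \<open>The setting for deducing the Cohen-Macaulay property from the simplices of a complex. In
  place q the first q operators are successively onto on the common kernel of the earlier ones.
  Exactness is assumed in the places 1, ..., n-1 only; the goal is that the cokernel in place n
  inherits the property for the first n operators.\<close>

locale regular_operators =
  fixes n :: nat and X :: "nat \<Rightarrow> 'v::ab_group_add set" and d :: "'v \<Rightarrow> 'v" and th :: "nat \<Rightarrow> 'v \<Rightarrow> 'v"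
  assumes d_diff: "d (x - y) = d x - d y"
    and th_diff: "th s (x - y) = th s x - th s y"
    and X_diff: "x \<in> X q \<Longrightarrow> y \<in> X q \<Longrightarrow> x - y \<in> X q"
    and zero_X: "0 \<in> X q"
    and d_X: "x \<in> X q \<Longrightarrow> d x \<in> X (Suc q)"
    and th_X: "x \<in> X q \<Longrightarrow> th s x \<in> X q"
    and d_d: "x \<in> X q \<Longrightarrow> d (d x) = 0"
    and th_th: "th s (th r x) = th r (th s x)"
    and d_th: "x \<in> X q \<Longrightarrow> d (th s x) = th s (d x)"
    and exact: "Suc q < n \<Longrightarrow> x \<in> X (Suc q) \<Longrightarrow> d x = 0 \<Longrightarrow> x \<in> d ` X q"
    and solvable: "x \<in> X q \<Longrightarrow> m < q \<Longrightarrow> (\<And>s. s < m \<Longrightarrow> th s x = 0) \<Longrightarrow>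
      \<exists>y\<in>X q. (\<forall>s<m. th s y = 0) \<and> th m y = x"
begin

lemma th_zero [simp]: "th s 0 = 0"
  using th_diff[of s 0 0] by simp

lemma d_zero [simp]: "d 0 = 0"
  using d_diff[of 0 0] by simp

text \<open>Induction on \<open>m\<close>. If \<open>y\<close> lifts \<open>x\<close> and is killed
  by the first m operators, then \<open>th m y\<close> is a cycle, hence the image of some
  \<open>w\<close> which by induction is also killed by them. Solvability one place lower gives
  \<open>w'\<close> in their kernel with \<open>th m w' = w\<close>, and \<open>y - d w'\<close> is
  a lift killed by one operator more.\<close>

lemma exact_kernel:
  assumes "x \<in> d ` X p" "m < p" "p < n" "\<And>s. s < m \<Longrightarrow> th s x = 0"
  shows "\<exists>y\<in>X p. (\<forall>s<m. th s y = 0) \<and> d y = x"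
  using assms
proof (induction m arbitrary: p x)
  case 0
  then show ?case by blast
next
  case (Suc m)
  obtain y where y: "y \<in> X p" "\<And>s. s < m \<Longrightarrow> th s y = 0" "d y = x"
    using Suc.IH[of x p] Suc.prems by force
  obtain r where r: "p = Suc r" using Suc.prems(2) by (cases p) auto
  have "d (th m y) = 0" using Suc.prems(4)[of m] d_th[OF y(1), of m] y(3) by simp
  then have "th m y \<in> d ` X r"
    using exact[of r "th m y"] th_X[OF y(1), of m] r Suc.prems(3) by simp
  moreover have "th s (th m y) = 0" if "s < m" for s
    using y(2)[OF that] by (subst th_th) simp
  ultimately obtain w where w: "w \<in> X r" "\<And>s. s < m \<Longrightarrow> th s w = 0" "d w = th m y"
    using Suc.IH[of "th m y" r] Suc.prems r by force
  obtain w' where w': "w' \<in> X r" "\<And>s. s < m \<Longrightarrow> th s w' = 0" "th m w' = w"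
    using solvable[OF w(1) _ w(2)] Suc.prems(2) r by force
  have "y - d w' \<in> X p" using X_diff[OF y(1)] d_X[OF w'(1)] r by simp
  moreover have "d (y - d w') = x" using y(3) d_d[OF w'(1)] by (simp add: d_diff)
  moreover have "th s (y - d w') = 0" if "s < Suc m" for s
  proof -
    have "th s (y - d w') = th s y - d (th s w')" by (simp add: th_diff d_th[OF w'(1)])
    then show ?thesis using that y(2) w'(2,3) w(3) by (cases "s = m") auto
  qed
  ultimately show ?case by blast
qed

text \<open>A class in the cokernel that is killed by the first m operators has a representative
  killed by them exactly. The error of a representative under operator m is a boundary to which
  \<open>exact_kernel\<close> applies; solving for it corrects the representative without disturbing
  the earlier operators.\<close>

lemma lift_to_kernel:
  assumes "x \<in> X (Suc p)" "n = Suc p" "m \<le> p" "\<And>s. s < m \<Longrightarrow> th s x \<in> d ` X p"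
  shows "\<exists>w\<in>X p. \<forall>s<m. th s (x - d w) = 0"
  using assms(3,4)
proof (induction m)
  case 0
  then show ?case using zero_X by blast
next
  case (Suc m)
  obtain w where w: "w \<in> X p" "\<And>s. s < m \<Longrightarrow> th s (x - d w) = 0"
    using Suc.IH Suc.prems by force
  obtain u where u: "u \<in> X p" "th m x = d u" using Suc.prems(2)[of m] by blast
  have "th m (x - d w) = d (u - th m w)"
    by (simp add: th_diff d_diff u(2) d_th[OF w(1)])
  then have "th m (x - d w) \<in> d ` X p"
    using X_diff[OF u(1) th_X[OF w(1)]] by blast
  moreover have "th s (th m (x - d w)) = 0" if "s < m" for s
    using w(2)[OF that] by (subst th_th) simp
  ultimately obtain y where y: "y \<in> X p" "\<And>s. s < m \<Longrightarrow> th s y = 0" "d y = th m (x - d w)"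
    using exact_kernel[of "th m (x - d w)" p m] Suc.prems(1) assms(2) by force
  obtain y' where y': "y' \<in> X p" "\<And>s. s < m \<Longrightarrow> th s y' = 0" "th m y' = y"
    using solvable[OF y(1), of m] y(2) Suc.prems(1) by force
  \<comment> \<open>This is \<open>w + y'\<close>, written with subtraction because the operators
    and spaces are only assumed compatible with differences.\<close>
  define w2 where "w2 = w - (0 - y')"
  have "w2 \<in> X p" unfolding w2_def using X_diff zero_X w(1) y'(1) by blast
  moreover have "th s (x - d w2) = 0" if "s < Suc m" for s
  proof -
    have "x - d w2 = (x - d w) - d y'" by (simp only: w2_def d_diff d_zero) simp
    then have "th s (x - d w2) = th s (x - d w) - d (th s y')"
      by (simp only: th_diff d_th[OF y'(1)])
    then show ?thesis using that y'(2,3) w(2) y(3) by (cases "s = m") auto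
  qed
  ultimately show ?case by blast
qed

text \<open>The kernel of the first \<open>m\<close> operators on the cokernel of \<open>d\<close> is mapped onto itself by the next one.\<close>

lemma solvable_cokernel:
  assumes "x \<in> X (Suc p)" "n = Suc p" "m \<le> p" "\<And>s. s < m \<Longrightarrow> th s x \<in> d ` X p"
  shows "\<exists>y\<in>X (Suc p). (\<forall>s<m. th s y = 0) \<and> x - th m y \<in> d ` X p"
proof -
  obtain w where w: "w \<in> X p" "\<forall>s<m. th s (x - d w) = 0"
    using lift_to_kernel[OF assms] by blast
  have "x - d w \<in> X (Suc p)" using X_diff assms(1) d_X w(1) by blast
  from solvable[OF this, of m] obtain y where
    "y \<in> X (Suc p)" "\<forall>s<m. th s y = 0" "th m y = x - d w" using w(2) assms(3) by force
  then show ?thesis using w(1) by force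
qed

end

section \<open>Rank and nullity, and spaces of functions with finite support sets\<close>

context vector_space
begin

lemma span_Int_span_independent:
  assumes "independent B" "C \<subseteq> B" "x \<in> span (B - C)" "x \<in> span C"
  shows "x = 0"
proof -
  have "representation B x = representation (B - C) x" "representation B x = representation C x"
    using assms by (auto intro: representation_extend)
  then have "representation B x b = 0" for b
    using representation_ne_zero[of C x b] representation_ne_zero[of "B - C" x b] by auto
  then have "{b. representation B x b \<noteq> 0} = {}" by auto
  moreover have "x \<in> span B" using assms span_mono by blast
  ultimately show ?thesis using sum_nonzero_representation_eq[OF assms(1)] by force
qed

end

text \<open>Stated for a subspace of a finitely spanned space, since the ambient function spaces may
  be infinite-dimensional. A basis of the kernel is extended to a basis of \<open>S\<close>; the
  added vectors map injectively to a basis of the image.\<close>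

lemma (in vector_space_pair) rank_nullity:
  assumes f: "Vector_Spaces.linear s1 s2 f" and S: "vs1.subspace S" "S \<subseteq> vs1.span A" "finite A"
  shows "vs1.dim S = vs2.dim (f ` S) + vs1.dim {x \<in> S. f x = 0}"
proof -
  define K where "K = {x \<in> S. f x = 0}"
  obtain C where C: "C \<subseteq> K" "vs1.independent C" "K \<subseteq> vs1.span C" "card C = vs1.dim K"
    using vs1.basis_exists by blast
  have "C \<subseteq> S" using C K_def by auto
  from vs1.maximal_independent_subset_extend[OF this C(2)]
  obtain B where B: "C \<subseteq> B" "B \<subseteq> S" "vs1.independent B" "S \<subseteq> vs1.span B" .
  have finB: "finite B"
    using vs1.independent_span_bound[OF S(3) B(3)] B(2) S(2) by auto
  have indep: "vs1.independent (B - C)" using B(3) vs1.independent_mono by blast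
  have inj: "inj_on f (vs1.span (B - C))"
  proof (subst linear_inj_on_iff_eq_0[OF f])
    show "vs1.subspace (vs1.span (B - C))" by (rule vs1.subspace_span)
    show "\<forall>x\<in>vs1.span (B - C). f x = 0 \<longrightarrow> x = 0"
    proof (intro ballI impI)
      fix x assume x: "x \<in> vs1.span (B - C)" "f x = 0"
      have "vs1.span (B - C) \<subseteq> S" using B(2) S(1) by (intro vs1.span_minimal) auto
      then have "x \<in> vs1.span C" using x C(3) K_def by auto
      then show "x = 0" using vs1.span_Int_span_independent[OF B(3,1) x(1)] by simp
    qed
  qed
  have "vs2.independent (f ` (B - C))"
    using linear_independent_injective_image[OF f indep inj] .
  moreover have "f ` S \<subseteq> vs2.span (f ` (B - C))"
  proof -
    have "f ` S \<subseteq> f ` vs1.span B" using B(4) by auto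
    also have "\<dots> = vs2.span (f ` B)" using linear_span_image[OF f] by simp
    also have "\<dots> \<subseteq> vs2.span (f ` (B - C))"
    proof (intro vs2.span_minimal vs2.subspace_span subsetI)
      fix y assume "y \<in> f ` B"
      then obtain b where b: "b \<in> B" "y = f b" by blast
      show "y \<in> vs2.span (f ` (B - C))"
      proof (cases "b \<in> C")
        case True
        then have "y = 0" using C(1) K_def b by auto
        then show ?thesis using vs2.span_zero by simp
      next
        case False
        then show ?thesis using b by (intro vs2.span_base) auto
      qed
    qed
    finally show ?thesis .
  qed
  moreover have "f ` (B - C) \<subseteq> f ` S" using B(2) by auto
  ultimately have "vs2.dim (f ` S) = card (f ` (B - C))"
    using vs2.basis_card_eq_dim by metis
  also have "\<dots> = card (B - C)"
    using inj vs1.span_superset[of "B - C"] by (intro card_image) (meson inj_on_subset)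
  finally have "vs2.dim (f ` S) = card B - card C"
    using B(1) finB by (simp add: card_Diff_subset finite_subset)
  moreover have "vs1.dim S = card B" using vs1.basis_card_eq_dim[OF B(2,4,3)] by simp
  moreover have "card C \<le> card B" using B(1) finB by (rule card_mono[rotated])
  ultimately show ?thesis using C(4) K_def by simp
qed

definition fscale :: "'f::field \<Rightarrow> ('x \<Rightarrow> 'f) \<Rightarrow> 'x \<Rightarrow> 'f" where
  "fscale r x = (\<lambda>i. r * x i)"

global_interpretation fs: vector_space "fscale :: 'f::field \<Rightarrow> ('x \<Rightarrow> 'f) \<Rightarrow> 'x \<Rightarrow> 'f"
  by unfold_locales (auto simp: fscale_def fun_eq_iff algebra_simps)

global_interpretation fs2: vector_space_pair "fscale :: 'f::field \<Rightarrow> ('x \<Rightarrow> 'f) \<Rightarrow> 'x \<Rightarrow> 'f"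
   "fscale :: 'f::field \<Rightarrow> ('y \<Rightarrow> 'f) \<Rightarrow> 'y \<Rightarrow> 'f"
  by unfold_locales

lemma sum_fun_apply: "(\<Sum>i\<in>P. f i) x = (\<Sum>i\<in>P. f i x)"
  by (induction P rule: infinite_finite_induct) auto

definition functions_on :: "'x set \<Rightarrow> ('x \<Rightarrow> 'f::zero) set" where
  "functions_on P = {x. \<forall>i. x i \<noteq> 0 \<longrightarrow> i \<in> P}"

definition point :: "'x \<Rightarrow> 'x \<Rightarrow> 'f::zero_neq_one" where
  "point i = (\<lambda>j. if j = i then 1 else 0)"

lemma subspace_functions_on: "fs.subspace (functions_on P)"
  by (auto simp: fs.subspace_def functions_on_def fscale_def) (metis add.right_neutral)

lemma function_sum_points:
  fixes x :: "'x \<Rightarrow> 'f::field"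
  assumes "finite P" "x \<in> functions_on P"
  shows "x = (\<Sum>i\<in>P. fscale (x i) (point i))"
proof
  fix j
  have "(\<Sum>i\<in>P. fscale (x i) (point i)) j = (\<Sum>i\<in>P. if i = j then x i else 0)"
    unfolding sum_fun_apply by (intro sum.cong) (auto simp: fscale_def point_def)
  also have "\<dots> = x j" using assms by (auto simp: functions_on_def)
  finally show "x j = (\<Sum>i\<in>P. fscale (x i) (point i)) j" by simp
qed

lemma functions_on_span:
  assumes "finite P"
  shows "(functions_on P :: ('x \<Rightarrow> 'f::field) set) \<subseteq> fs.span (point ` P)"
proof
  fix x :: "'x \<Rightarrow> 'f" assume "x \<in> functions_on P"
  then show "x \<in> fs.span (point ` P)"
    using function_sum_points[OF assms, of x]
    by (metis (no_types, lifting) fs.span_sum fs.span_scale fs.span_base imageI)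
qed

lemma dim_functions_on:
  assumes "finite P"
  shows "fs.dim (functions_on P :: ('x \<Rightarrow> 'f::field) set) = card P"
proof -
  let ?B = "point ` P :: ('x \<Rightarrow> 'f) set"
  have inj: "inj_on (point :: 'x \<Rightarrow> 'x \<Rightarrow> 'f) P"
    by (auto simp: inj_on_def point_def fun_eq_iff split: if_splits)
  have "fs.independent ?B"
  proof (subst fs.dependent_finite)
    show "finite ?B" using assms by simp
    show "\<not> (\<exists>u. (\<exists>v\<in>?B. u v \<noteq> 0) \<and> (\<Sum>v\<in>?B. fscale (u v) v) = 0)"
    proof
      assume "\<exists>u. (\<exists>v\<in>?B. u v \<noteq> 0) \<and> (\<Sum>v\<in>?B. fscale (u v) v) = 0"
      then obtain u and i where u: "i \<in> P" "u (point i) \<noteq> 0" "(\<Sum>v\<in>?B. fscale (u v) v) = 0" by blast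
      have "(\<Sum>v\<in>?B. fscale (u v) v) i = (\<Sum>j\<in>P. if j = i then u (point i) else 0)"
        unfolding sum.reindex[OF inj] sum_fun_apply
        by (intro sum.cong) (auto simp: fscale_def point_def)
      then show False using u assms by simp
    qed
  qed
  moreover have "?B \<subseteq> functions_on P" by (auto simp: functions_on_def point_def split: if_splits)
  ultimately have "fs.dim (functions_on P :: ('x \<Rightarrow> 'f) set) = card ?B"
    using functions_on_span[OF assms] fs.basis_card_eq_dim by metis
  then show ?thesis using card_image[OF inj] by simp
qed

lemma rank_nullity_functions:
  fixes f :: "('x \<Rightarrow> 'f::field) \<Rightarrow> 'y \<Rightarrow> 'f"
  assumes "Vector_Spaces.linear fscale fscale f" "fs.subspace S" "S \<subseteq> functions_on P" "finite P"
  shows "fs.dim S = fs.dim (f ` S) + fs.dim {x \<in> S. f x = 0}"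
  using assms functions_on_span[of P]
  by (intro fs2.rank_nullity[of f S "point ` P"]) auto

lemma linear_fscaleI:
  fixes f :: "('x \<Rightarrow> 'f::field) \<Rightarrow> 'y \<Rightarrow> 'f"
  assumes "\<And>x y. f (\<lambda>i. x i + y i) = (\<lambda>j. f x j + f y j)"
    "\<And>r x. f (\<lambda>i. r * x i) = (\<lambda>j. r * f x j)"
  shows "Vector_Spaces.linear fscale fscale f"
  using assms by unfold_locales (auto simp: fscale_def plus_fun_def)

section \<open>Homology spheres under extension of the coefficient ring\<close>

lemma boundary_sum:
  "boundary L (\<lambda>F. \<Sum>k\<in>A. f k F) = (\<lambda>G. \<Sum>k\<in>A. boundary L (f k) G)"
  unfolding boundary_def sum_distrib_left by (rule ext, rule sum.swap)

lemma boundary_scale: "boundary L (\<lambda>F. r * c F) = (\<lambda>G. r * boundary L c G)"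
  unfolding boundary_def sum_distrib_left by (simp add: mult.left_commute)

lemma boundary_diff: "boundary L (\<lambda>F. c F - e F) = (\<lambda>G. boundary L c G - boundary L e G)"
  unfolding boundary_def by (simp add: sum_subtractf right_diff_distrib)

lemma boundary_zero: "boundary L (\<lambda>F. 0) = (\<lambda>G. 0)"
  by (simp add: boundary_def)

text \<open>The boundary uses only signs, so it commutes with every additive map of coefficients.
  The cases needed are scaling, taking a polynomial coefficient, forming a monomial, and the
  embedding into the fraction field.\<close>

lemma boundary_hom:
  fixes h :: "'r::comm_ring_1 \<Rightarrow> 's::comm_ring_1"
  assumes "\<And>x y. h (x + y) = h x + h y"
  shows "boundary L (\<lambda>F. h (c F)) = (\<lambda>G. h (boundary L c G))"
proof
  fix G
  have h0: "h 0 = 0" using assms[of 0 0] by simp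
  have hm: "h (- x) = - h x" for x using assms[of x "- x"] h0 by (simp add: eq_neg_iff_add_eq_0 add.commute)
  have hp: "h ((- 1) ^ k * x) = (- 1) ^ k * h x" for k x
    by (cases "even k") (simp_all add: hm)
  have hs: "h (\<Sum>v\<in>A. g v) = (\<Sum>v\<in>A. h (g v))" for A and g :: "'a \<Rightarrow> 'r"
    by (induction A rule: infinite_finite_induct) (simp_all add: h0 assms)
  show "boundary L (\<lambda>F. h (c F)) G = h (boundary L c G)"
    by (simp add: boundary_def hs hp)
qed

lemma chain_group_hom: "h 0 = 0 \<Longrightarrow> c \<in> chain_group L i \<Longrightarrow> (\<lambda>F. h (c F)) \<in> chain_group L i"
  unfolding chain_group_def by (simp, metis)

lemma boundaries_hom:
  fixes h :: "'r::comm_ring_1 \<Rightarrow> 's::comm_ring_1"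
  assumes "\<And>x y. h (x + y) = h x + h y" "c \<in> boundaries L i"
  shows "(\<lambda>F. h (c F)) \<in> boundaries L i"
proof -
  obtain e where e: "e \<in> chain_group L (i + 1)" "c = boundary L e"
    using assms(2) by (auto simp: boundaries_def)
  have "h 0 = 0" using assms(1)[of 0 0] by simp
  then show ?thesis
    using boundary_hom[of h L e] assms(1) chain_group_hom[of h e L "i + 1"] e
    unfolding boundaries_def by (intro image_eqI[of _ _ "\<lambda>F. h (e F)"]) auto
qed

lemma cycles_hom:
  fixes h :: "'r::comm_ring_1 \<Rightarrow> 's::comm_ring_1"
  assumes "\<And>x y. h (x + y) = h x + h y" "c \<in> cycles L i"
  shows "(\<lambda>F. h (c F)) \<in> cycles L i"
proof -
  have "h 0 = 0" using assms(1)[of 0 0] by simp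
  then show ?thesis using boundary_hom[of h L c] assms chain_group_hom[of h c L i]
    by (auto simp: cycles_def)
qed

lemma boundaries_scale: "c \<in> boundaries L i \<Longrightarrow> (\<lambda>F. r * c F) \<in> boundaries L i"
  by (rule boundaries_hom) (simp_all add: distrib_left)

lemma cycles_scale: "c \<in> cycles L i \<Longrightarrow> (\<lambda>F. r * c F) \<in> cycles L i"
  by (rule cycles_hom) (simp_all add: distrib_left)

lemma chain_group_diff:
  fixes c :: "'a set \<Rightarrow> 'r::group_add"
  shows "c \<in> chain_group L i \<Longrightarrow> e \<in> chain_group L i \<Longrightarrow> (\<lambda>F. c F - e F) \<in> chain_group L i"
  by (simp add: chain_group_def) (metis diff_self)

lemma boundaries_diff:
  assumes "c \<in> boundaries L i" "e \<in> boundaries L i"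
  shows "(\<lambda>F. c F - e F) \<in> boundaries L i"
proof -
  obtain c' e' where "c' \<in> chain_group L (i + 1)" "c = boundary L c'" 
    "e' \<in> chain_group L (i + 1)" "e = boundary L e'"
    using assms by (auto simp: boundaries_def)
  then show ?thesis using boundary_diff[of L c' e'] chain_group_diff[of c' L "i + 1" e']
    unfolding boundaries_def by (intro image_eqI[of _ _ "\<lambda>F. c' F - e' F"]) auto
qed

lemma zero_boundaries: "(\<lambda>_. 0) \<in> boundaries L i"
  unfolding boundaries_def
  by (rule image_eqI[of _ _ "\<lambda>_. 0"]) (simp_all add: boundary_zero chain_group_def)

lemma boundaries_sum:
  "finite A \<Longrightarrow> (\<And>k. k \<in> A \<Longrightarrow> f k \<in> boundaries L i) \<Longrightarrow> (\<lambda>F. \<Sum>k\<in>A. f k F) \<in> boundaries L i"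
proof (induction A rule: finite_induct)
  case empty
  then show ?case by (simp add: zero_boundaries)
next
  case (insert k A)
  have "(\<lambda>F. - 1 * (\<Sum>k\<in>A. f k F)) \<in> boundaries L i"
    using insert by (intro boundaries_scale) auto
  then have "(\<lambda>F. f k F - - 1 * (\<Sum>k\<in>A. f k F)) \<in> boundaries L i"
    using insert.prems by (intro boundaries_diff) auto
  then show ?case using insert by simp
qed

lemma has_homology_of_sphereD:
  assumes "has_homology_of_sphere TYPE('r::idom) L d"
  shows "i \<noteq> d \<Longrightarrow> (cycles L i :: ('a::linorder set \<Rightarrow> 'r) set) = boundaries L i"
    and "\<exists>z \<in> cycles L d. \<forall>c \<in> cycles L d. \<exists>!r::'r. (\<lambda>F. c F - r * z F) \<in> boundaries L d"
  using assms unfolding has_homology_of_sphere_def by blast+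

text \<open>The polynomial ring is free over the coefficients on the powers of the variable, so
  cycles, boundaries and multiples of the generator can all be examined one coefficient at a
  time.\<close>

lemma has_homology_of_sphere_poly:
  assumes "has_homology_of_sphere TYPE('r::idom) L d" "finite L"
  shows "has_homology_of_sphere TYPE('r poly) L d"
proof -
  note ex = has_homology_of_sphereD(1)[OF assms(1)]
  obtain z :: "'a set \<Rightarrow> 'r" where z: "z \<in> cycles L d"
    "\<And>c. c \<in> cycles L d \<Longrightarrow> \<exists>!r::'r. (\<lambda>F. c F - r * z F) \<in> boundaries L d"
    using has_homology_of_sphereD(2)[OF assms(1)] by (elim bexE) (erule that, erule bspec)
  have decomp: "\<exists>N. c = (\<lambda>F. \<Sum>k\<le>N. monom (coeff (c F) k) k)"
    if "c \<in> chain_group L i" for c :: "'a set \<Rightarrow> 'r poly" and i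
  proof -
    \<comment> \<open>The complex is finite, so the degrees of the values of a chain are
      bounded.\<close>
    define N where "N = Max (insert 0 ((degree \<circ> c) ` L))"
    have "degree (c F) \<le> N" for F
    proof (cases "F \<in> L")
      case True
      then show ?thesis using assms(2) by (auto simp: N_def intro!: Max_ge)
    next
      case False
      then have "c F = 0" using that by (auto simp: chain_group_def)
      then show ?thesis by simp
    qed
    then have "c = (\<lambda>F. \<Sum>k\<le>N. monom (coeff (c F) k) k)"
      by (intro ext) (simp add: poly_as_sum_of_monoms')
    then show ?thesis by blast
  qed
  have coeff_b: "(\<lambda>F. coeff (c F) k) \<in> boundaries L i" if "c \<in> boundaries L i" for c :: "'a set \<Rightarrow> 'r poly" and k i
    using that by (rule boundaries_hom[rotated]) simp
  have coeff_c: "(\<lambda>F. coeff (c F) k) \<in> cycles L i" if "c \<in> cycles L i" for c :: "'a set \<Rightarrow> 'r poly" and k i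
    using that by (rule cycles_hom[rotated]) simp
  have monom_b: "(\<lambda>F. monom (c F) k) \<in> boundaries L i" if "c \<in> boundaries L i" for c :: "'a set \<Rightarrow> 'r" and k i
    using that by (rule boundaries_hom[rotated]) (simp add: add_monom)
  have bb: "(boundaries L i :: ('a set \<Rightarrow> 'r poly) set) \<subseteq> cycles L i" if "i \<noteq> d" for i
  proof
    fix c :: "'a set \<Rightarrow> 'r poly" assume c: "c \<in> boundaries L i"
    have "(\<lambda>F. coeff (c F) k) \<in> cycles L i" for k using coeff_b[OF c, of k] ex[OF that] by simp
    then have *: "boundary L (\<lambda>F. coeff (c F) k) = (\<lambda>_. 0)"
      and **: "(\<lambda>F. coeff (c F) k) \<in> chain_group L i" for k
      by (auto simp: cycles_def)
    have "coeff (boundary L c G) k = 0" for G k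
      using *[of k] boundary_hom[of "\<lambda>p. coeff p k" L c] by (simp add: fun_eq_iff)
    moreover have "c \<in> chain_group L i"
      unfolding chain_group_def
    proof (intro CollectI allI impI)
      fix F assume "c F \<noteq> 0"
      then obtain k where "coeff (c F) k \<noteq> 0" by (auto simp: poly_eq_iff)
      then show "F \<in> L \<and> face_dim F = i" using **[of k] by (auto simp: chain_group_def)
    qed
    moreover from calculation(1) have "boundary L c = (\<lambda>_. 0)"
      by (intro ext poly_eqI) simp
    ultimately show "c \<in> cycles L i" by (simp add: cycles_def)
  qed
  have "cycles L i = (boundaries L i :: ('a set \<Rightarrow> 'r poly) set)" if "i \<noteq> d" for i
  proof
    show "cycles L i \<subseteq> (boundaries L i :: ('a set \<Rightarrow> 'r poly) set)"
    proof
      fix c :: "'a set \<Rightarrow> 'r poly" assume c: "c \<in> cycles L i"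
      then obtain N where N: "c = (\<lambda>F. \<Sum>k\<le>N. monom (coeff (c F) k) k)"
        using decomp by (auto simp: cycles_def)
      have "(\<lambda>F. \<Sum>k\<le>N. monom (coeff (c F) k) k) \<in> boundaries L i"
        using coeff_c[OF c] ex[OF that] by (intro boundaries_sum monom_b) auto
      then show "c \<in> boundaries L i" by (subst N)
    qed
  qed (rule bb[OF that])
  moreover have "\<exists>z' \<in> cycles L d. \<forall>c \<in> cycles L d. \<exists>!r::'r poly. (\<lambda>F. c F - r * z' F) \<in> boundaries L d"
  proof (intro bexI ballI)
    let ?z = "\<lambda>F. [:z F:]"
    show "?z \<in> cycles L d" using z(1) by (rule cycles_hom[rotated]) simp
    fix c :: "'a set \<Rightarrow> 'r poly" assume c: "c \<in> cycles L d"
    then obtain N where N: "c = (\<lambda>F. \<Sum>k\<le>N. monom (coeff (c F) k) k)"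
      using decomp by (auto simp: cycles_def)
    have "\<exists>r. (\<lambda>F. coeff (c F) k - r * z F) \<in> boundaries L d" for k
      using z(2)[OF coeff_c[OF c]] by blast
    then obtain r where r: "\<And>k. (\<lambda>F. coeff (c F) k - r k * z F) \<in> boundaries L d" by metis
    define R where "R = (\<Sum>k\<le>N. monom (r k) k)"
    have "(\<lambda>F. c F - R * ?z F) = (\<lambda>F. \<Sum>k\<le>N. monom (coeff (c F) k - r k * z F) k)"
    proof
      fix F
      have "monom (r k) k * [:z F:] = monom (r k * z F) k" for k
        by (simp add: smult_monom mult.commute)
      then have "R * [:z F:] = (\<Sum>k\<le>N. monom (r k * z F) k)"
        unfolding R_def sum_distrib_right by (rule sum.cong[OF refl])
      moreover have "c F = (\<Sum>k\<le>N. monom (coeff (c F) k) k)" using N by metis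
      ultimately show "c F - R * [:z F:] = (\<Sum>k\<le>N. monom (coeff (c F) k - r k * z F) k)"
        by (simp only: diff_monom[symmetric] sum_subtractf)
    qed
    moreover have "\<dots> \<in> boundaries L d" using r by (intro boundaries_sum monom_b) auto
    ultimately have ex: "(\<lambda>F. c F - R * ?z F) \<in> boundaries L d" by simp
    moreover have "R' = R''" if "(\<lambda>F. c F - R' * ?z F) \<in> boundaries L d" "(\<lambda>F. c F - R'' * ?z F) \<in> boundaries L d" for R' R''
    proof (rule poly_eqI)
      fix k
      have "(\<lambda>F. coeff (c F) k - coeff R' k * z F) \<in> boundaries L d"
        "(\<lambda>F. coeff (c F) k - coeff R'' k * z F) \<in> boundaries L d"
        using coeff_b[OF that(1), of k] coeff_b[OF that(2), of k] by (simp_all add: mult.commute)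
      then show "coeff R' k = coeff R'' k" using z(2)[OF coeff_c[OF c, of k]] by blast
    qed
    ultimately show "\<exists>!r. (\<lambda>F. c F - r * ?z F) \<in> boundaries L d" by blast
  qed
  ultimately show ?thesis unfolding has_homology_of_sphere_def by (intro conjI allI impI)
qed

lemma common_denominator:
  fixes c :: "'x \<Rightarrow> 'r::idom fract"
  assumes "finite A"
  shows "\<exists>D e. D \<noteq> 0 \<and> (\<forall>x\<in>A. to_fract D * c x = to_fract (e x)) \<and> (\<forall>x. x \<notin> A \<longrightarrow> e x = 0)"
  using assms
proof (induction A rule: finite_induct)
  case empty
  show ?case by (rule exI[of _ 1], rule exI[of _ "\<lambda>_. 0"]) simp
next
  case (insert a A)
  then obtain D e where D: "D \<noteq> 0" "\<And>x. x \<in> A \<Longrightarrow> to_fract D * c x = to_fract (e x)"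
    "\<And>x. x \<notin> A \<Longrightarrow> e x = 0" by blast
  obtain p q where pq: "c a = Fraction_Field.Fract p q" "q \<noteq> 0" by (cases "c a") auto
  have q: "to_fract q * c a = to_fract p"
    using pq by (simp add: to_fract_def eq_fract)
  have "to_fract (D * q) * c a = to_fract (D * p)" by (simp add: q mult.assoc)
  moreover have "to_fract (D * q) * c x = to_fract (q * e x)" if "x \<in> A" for x
    using D(2)[OF that] by (simp add: ac_simps)
  ultimately show ?case using D pq insert(2)
    by (intro exI[of _ "D * q"] exI[of _ "\<lambda>x. if x = a then D * p else q * e x"]) auto
qed

text \<open>A chain on a finite complex becomes a chain over the original domain after
  multiplication by one nonzero common denominator, and cycles and boundaries can be cleared in the
  same way. Every assertion is transported back by dividing.\<close>

lemma has_homology_of_sphere_fract: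
  assumes "has_homology_of_sphere TYPE('r::idom) L d" "finite L"
  shows "has_homology_of_sphere TYPE('r fract) L d"
proof -
  note ex = has_homology_of_sphereD(1)[OF assms(1)]
  obtain z :: "'a set \<Rightarrow> 'r" where z: "z \<in> cycles L d"
    "\<And>c. c \<in> cycles L d \<Longrightarrow> \<exists>!r::'r. (\<lambda>F. c F - r * z F) \<in> boundaries L d"
    using has_homology_of_sphereD(2)[OF assms(1)] by (elim bexE) (erule that, erule bspec)
  have emb: "boundary L (\<lambda>F. to_fract (e F)) = (\<lambda>G. to_fract (boundary L e G))" for e :: "'a set \<Rightarrow> 'r"
    by (rule boundary_hom) simp
  have clear: "\<exists>D e. D \<noteq> 0 \<and> e \<in> chain_group L i \<and> (\<forall>F. to_fract D * c F = to_fract (e F))"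
    if "c \<in> chain_group L i" for c :: "'a set \<Rightarrow> 'r fract" and i
  proof -
    obtain D e where D: "D \<noteq> 0" "\<And>x. x \<in> L \<Longrightarrow> to_fract D * c x = to_fract (e x)"
      "\<And>x. x \<notin> L \<Longrightarrow> e x = 0" using common_denominator[OF assms(2), of c] by blast
    have all: "to_fract D * c F = to_fract (e F)" for F
      using D that by (cases "F \<in> L") (auto simp: chain_group_def)
    have "e \<in> chain_group L i"
      unfolding chain_group_def
    proof (intro CollectI allI impI)
      fix F assume "e F \<noteq> 0"
      then have "c F \<noteq> 0" using all[of F] by force
      then show "F \<in> L \<and> face_dim F = i" using that by (auto simp: chain_group_def)
    qed
    then show ?thesis using D(1) all by blast
  qed
  have cyc: "\<exists>D e. D \<noteq> 0 \<and> e \<in> cycles L i \<and> (\<forall>F. to_fract D * c F = to_fract (e F))"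
    if "c \<in> cycles L i" for c :: "'a set \<Rightarrow> 'r fract" and i
  proof -
    have c: "c \<in> chain_group L i" using that by (simp add: cycles_def)
    obtain D e where D: "D \<noteq> 0" "e \<in> chain_group L i" "\<And>F. to_fract D * c F = to_fract (e F)"
      using clear[OF c] by blast
    have "(\<lambda>G. to_fract (boundary L e G)) = boundary L (\<lambda>F. to_fract D * c F)"
      using emb[of e] D(3) by simp
    also have "\<dots> = (\<lambda>_. 0)" using that unfolding boundary_scale by (simp add: cycles_def)
    finally have "boundary L e = (\<lambda>_. 0)" by (simp add: fun_eq_iff)
    then show ?thesis using D by (auto simp: cycles_def)
  qed
  have emb_b: "(\<lambda>F. to_fract (e F)) \<in> boundaries L i" if "e \<in> boundaries L i" for e :: "'a set \<Rightarrow> 'r" and i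
    using that by (rule boundaries_hom[rotated]) simp
  have emb_c: "(\<lambda>F. to_fract (e F)) \<in> cycles L i" if "e \<in> cycles L i" for e :: "'a set \<Rightarrow> 'r" and i
    using that by (rule cycles_hom[rotated]) simp
  have bnd: "\<exists>D e. D \<noteq> 0 \<and> e \<in> boundaries L i \<and> (\<forall>F. to_fract D * c F = to_fract (e F))"
    if "c \<in> boundaries L i" for c :: "'a set \<Rightarrow> 'r fract" and i
  proof -
    from that obtain f where f: "f \<in> chain_group L (i + 1)" "c = boundary L f" by (auto simp: boundaries_def)
    obtain D e where D: "D \<noteq> 0" "e \<in> chain_group L (i + 1)" "\<And>F. to_fract D * f F = to_fract (e F)"
      using clear[OF f(1)] by blast
    have "(\<lambda>G. to_fract (boundary L e G)) = boundary L (\<lambda>F. to_fract D * f F)"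
      using emb[of e] D(3) by simp
    also have "\<dots> = (\<lambda>F. to_fract D * c F)" using f(2) by (simp add: boundary_scale)
    finally have "to_fract D * c F = to_fract (boundary L e F)" for F by (simp add: fun_eq_iff)
    moreover have "boundary L e \<in> boundaries L i" using D(2) by (auto simp: boundaries_def)
    ultimately show ?thesis using D(1) by blast
  qed
  have recover: "c = (\<lambda>F. inverse (to_fract D) * to_fract (e F))"
    if "D \<noteq> 0" "\<forall>F. to_fract D * c F = to_fract (e F)" for c :: "'a set \<Rightarrow> 'r fract" and D e
  proof
    fix F
    have "inverse (to_fract D) * to_fract (e F) = inverse (to_fract D) * (to_fract D * c F)"
      using that(2) by simp
    also have "\<dots> = c F" using that(1) by (simp flip: mult.assoc)
    finally show "c F = inverse (to_fract D) * to_fract (e F)" by simp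
  qed
  have "cycles L i = (boundaries L i :: ('a set \<Rightarrow> 'r fract) set)" if i: "i \<noteq> d" for i
  proof (intro equalityI subsetI)
    fix c :: "'a set \<Rightarrow> 'r fract"
    assume "c \<in> cycles L i"
    then obtain D e where D: "D \<noteq> 0" "e \<in> cycles L i" "\<forall>F. to_fract D * c F = to_fract (e F)"
      using cyc by blast
    have "(\<lambda>F. inverse (to_fract D) * to_fract (e F)) \<in> boundaries L i"
      using D(2) ex[OF i] by (intro boundaries_scale emb_b) blast
    then show "c \<in> boundaries L i" by (subst recover[OF D(1,3)])
  next
    fix c :: "'a set \<Rightarrow> 'r fract"
    assume "c \<in> boundaries L i"
    then obtain D e where D: "D \<noteq> 0" "e \<in> boundaries L i" "\<forall>F. to_fract D * c F = to_fract (e F)"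
      using bnd by blast
    have "(\<lambda>F. inverse (to_fract D) * to_fract (e F)) \<in> cycles L i"
      using D(2) ex[OF i] by (intro cycles_scale emb_c) blast
    then show "c \<in> cycles L i" by (subst recover[OF D(1,3)])
  qed
  moreover have "\<exists>z' \<in> cycles L d. \<forall>c \<in> cycles L d. \<exists>!r::'r fract. (\<lambda>F. c F - r * z' F) \<in> boundaries L d"
  proof (intro bexI ballI)
    let ?z = "\<lambda>F. to_fract (z F)"
    show "?z \<in> cycles L d" using z(1) by (rule emb_c)
    fix c :: "'a set \<Rightarrow> 'r fract" assume c: "c \<in> cycles L d"
    obtain D e where D: "D \<noteq> 0" "e \<in> cycles L d" "\<forall>F. to_fract D * c F = to_fract (e F)"
      using cyc[OF c] by blast
    obtain r where "(\<lambda>F. e F - r * z F) \<in> boundaries L d" using z(2)[OF D(2)] by blast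
    then have "(\<lambda>F. inverse (to_fract D) * to_fract (e F - r * z F)) \<in> boundaries L d"
      by (intro boundaries_scale emb_b)
    also have "(\<lambda>F. inverse (to_fract D) * to_fract (e F - r * z F)) = 
       (\<lambda>F. c F - (inverse (to_fract D) * to_fract r) * ?z F)"
      by (subst recover[OF D(1,3)]) (simp add: algebra_simps)
    finally have "\<exists>R. (\<lambda>F. c F - R * ?z F) \<in> boundaries L d" by blast
    moreover have "R' = R''" if R: "(\<lambda>F. c F - R' * ?z F) \<in> boundaries L d" "(\<lambda>F. c F - R'' * ?z F) \<in> boundaries L d" for R' R''
    proof -
      \<comment> \<open>Uniqueness: if the two multiples differ by p/q, then p times the generator
        bounds over the fraction field, so \<open>D' * p\<close> times it bounds over the domain,
        and uniqueness there gives \<open>D' * p = 0\<close>.\<close>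
      obtain p q where pq: "R'' - R' = Fraction_Field.Fract p q" "q \<noteq> 0" by (cases "R'' - R'") auto
      have q: "to_fract q * (R'' - R') = to_fract p"
        using pq by (simp add: to_fract_def eq_fract)
      have "(\<lambda>F. to_fract q * ((c F - R' * ?z F) - (c F - R'' * ?z F))) \<in> boundaries L d"
        by (rule boundaries_scale[OF boundaries_diff[OF R]])
      also have "(\<lambda>F. to_fract q * ((c F - R' * ?z F) - (c F - R'' * ?z F))) = (\<lambda>F. to_fract (p * z F))"
        by (simp add: q[symmetric] algebra_simps)
      finally have "(\<lambda>F. to_fract (p * z F)) \<in> boundaries L d" .
      then obtain D' e' where D': "D' \<noteq> 0" "e' \<in> boundaries L d" 
        "\<And>F. to_fract D' * to_fract (p * z F) = to_fract (e' F)"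
        using bnd by blast
      have "e' = (\<lambda>F. D' * p * z F)"
        using D'(3) by (auto simp: fun_eq_iff mult.assoc simp flip: to_fract_mult)
      then have b1: "(\<lambda>F. D' * p * z F - 0 * z F) \<in> boundaries L d" using D'(2) by simp
      have b2: "(\<lambda>F. D' * p * z F - (D' * p) * z F) \<in> boundaries L d" using zero_boundaries by simp
      have "(\<lambda>F. D' * p * z F) \<in> cycles L d" using z(1) by (intro cycles_scale)
      then have "D' * p = 0" using z(2) b1 b2 by blast
      then have "p = 0" using D'(1) by simp
      then have "to_fract q * (R'' - R') = 0" using q by simp
      then show ?thesis using pq(2) by simp
    qed
    ultimately show "\<exists>!r. (\<lambda>F. c F - r * ?z F) \<in> boundaries L d" by blast
  qed
  ultimately show ?thesis unfolding has_homology_of_sphere_def by (intro conjI allI impI)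
qed

section \<open>Cochains, and the comparison of links with open stars\<close>

definition vertex_sign :: "'a::linorder \<Rightarrow> 'a set \<Rightarrow> 'r::comm_ring_1" where
  "vertex_sign v A = (- 1) ^ card {w \<in> A. w < v}"

lemma vertex_sign_Un:
  assumes "finite A" "finite B" "A \<inter> B = {}"
  shows "vertex_sign v (A \<union> B) = vertex_sign v A * vertex_sign v B"
proof -
  have "{w \<in> A \<union> B. w < v} = {w \<in> A. w < v} \<union> {w \<in> B. w < v}" by auto
  then have "card {w \<in> A \<union> B. w < v} = card {w \<in> A. w < v} + card {w \<in> B. w < v}"
    using assms by (simp add: card_Un_disjoint disjoint_iff)
  then show ?thesis by (simp add: vertex_sign_def power_add)
qed

lemma vertex_sign_square: "vertex_sign v A * vertex_sign v A = 1"
  by (simp add: vertex_sign_def flip: power_mult_distrib)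

definition coboundary :: "('a::linorder set \<Rightarrow> 'r::comm_ring_1) \<Rightarrow> 'a set \<Rightarrow> 'r" where
  "coboundary \<phi> G = (\<Sum>v\<in>G. vertex_sign v (G - {v}) * \<phi> (G - {v}))"

definition down_closed :: "'a set set \<Rightarrow> bool" where
  "down_closed L \<longleftrightarrow> finite L \<and> (\<forall>F\<in>L. finite F \<and> (\<forall>G. G \<subseteq> F \<longrightarrow> G \<in> L))"

lemma down_closedD:
  assumes "down_closed L"
  shows "finite L" "F \<in> L \<Longrightarrow> finite F" "F \<in> L \<Longrightarrow> G \<subseteq> F \<Longrightarrow> G \<in> L" "finite (\<Union>L)"
  using assms by (auto simp: down_closed_def)

text \<open>Both sides are the same sum over incident pairs of a face and one of its
  vertices.\<close>

lemma boundary_coboundary_adjoint: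
  fixes e :: "'a::linorder set \<Rightarrow> 'r::comm_ring_1"
  assumes L: "down_closed L" and e: "\<And>F. e F \<noteq> 0 \<Longrightarrow> F \<in> L"
  shows "(\<Sum>H\<in>L. \<phi> H * boundary L e H) = (\<Sum>K\<in>L. coboundary \<phi> K * e K)"
proof -
  note fin = down_closedD(1,2,4)[OF L]
  let ?P = "SIGMA H:L. \<Union>L - H" and ?Q = "SIGMA K:L. K"
  let ?f = "\<lambda>(H, v). \<phi> H * (vertex_sign v H * e (insert v H))"
  have "(\<Sum>H\<in>L. \<phi> H * boundary L e H) = (\<Sum>H\<in>L. \<Sum>v\<in>\<Union>L - H. \<phi> H * (vertex_sign v H * e (insert v H)))"
    by (simp add: boundary_def vertex_sign_def sum_distrib_left)
  also have "\<dots> = sum ?f ?P" using fin by (subst sum.Sigma) auto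
  also have "\<dots> = sum ?f {(H, v). (H, v) \<in> ?P \<and> insert v H \<in> L}"
    using fin by (intro sum.mono_neutral_right) (auto intro!: e)
  also have "\<dots> = (\<Sum>(K, v)\<in>?Q. vertex_sign v (K - {v}) * \<phi> (K - {v}) * e K)"
    by (rule sum.reindex_bij_witness[of _ "\<lambda>(K, v). (K - {v}, v)" "\<lambda>(H, v). (insert v H, v)"])
      (auto simp: insert_absorb intro: down_closedD(3)[OF L])
  also have "\<dots> = (\<Sum>K\<in>L. coboundary \<phi> K * e K)"
    using fin by (subst sum.Sigma[symmetric]) (auto simp: coboundary_def sum_distrib_right)
  finally show ?thesis .
qed

lemma boundary_point:
  fixes H :: "'a::linorder set"
  assumes L: "down_closed L" and H: "H \<in> L"
  shows "(boundary L (point H) :: 'a set \<Rightarrow> 'f::field) =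
    (\<Sum>v\<in>H. fscale (vertex_sign v (H - {v})) (point (H - {v})))"
proof
  fix G
  note fin = down_closedD(4)[OF L] down_closedD(2)[OF L H]
  have "boundary L (point H) G = (\<Sum>v\<in>\<Union>L - G. if insert v G = H then vertex_sign v G else 0 :: 'f)"
    unfolding boundary_def point_def vertex_sign_def by (intro sum.cong) auto
  also have "\<dots> = (\<Sum>v\<in>{v \<in> \<Union>L - G. insert v G = H}. vertex_sign v G)"
    using fin by (subst sum.inter_filter) auto
  also have "{v \<in> \<Union>L - G. insert v G = H} = {v \<in> H. G = H - {v}}"
    using H by auto
  also have "(\<Sum>v\<in>{v \<in> H. G = H - {v}}. vertex_sign v G :: 'f) =
      (\<Sum>v\<in>H. if G = H - {v} then vertex_sign v G else 0)"
    using fin by (subst sum.inter_filter) auto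
  also have "\<dots> = (\<Sum>v\<in>H. fscale (vertex_sign v (H - {v})) (point (H - {v}))) G"
    unfolding sum_fun_apply by (intro sum.cong) (auto simp: fscale_def point_def)
  finally show "boundary L (point H) G =
    (\<Sum>v\<in>H. fscale (vertex_sign v (H - {v}) :: 'f) (point (H - {v}))) G" .
qed

lemma linear_boundary:
  "Vector_Spaces.linear fscale fscale (boundary L :: ('a::linorder set \<Rightarrow> 'f::field) \<Rightarrow> _)"
proof (rule linear_fscaleI)
  fix x y :: "'a set \<Rightarrow> 'f" and r
  show "boundary L (\<lambda>i. x i + y i) = (\<lambda>j. boundary L x j + boundary L y j)"
    by (simp add: boundary_def sum.distrib distrib_left)
  show "boundary L (\<lambda>i. r * x i) = (\<lambda>j. r * boundary L x j)"
    by (rule boundary_scale)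
qed

lemma subspace_chain_group: "fs.subspace (chain_group L i :: ('a set \<Rightarrow> 'f::field) set)"
proof -
  have "(chain_group L i :: ('a set \<Rightarrow> 'f) set) = functions_on {F \<in> L. face_dim F = i}"
    by (auto simp: chain_group_def functions_on_def)
  then show ?thesis using subspace_functions_on by simp
qed

text \<open>Over a field the boundary has a linear right inverse \<open>g\<close> on its image. For
  every chain c of degree i the difference of c and g applied to its boundary is a cycle, on which
  \<phi> vanishes; so \<phi> factors through the boundary, and the factor is a cochain
  \<psi>.\<close>

lemma cochain_is_coboundary:
  fixes \<phi> :: "'a::linorder set \<Rightarrow> 'f::field"
  assumes L: "down_closed L" and \<phi>: "\<And>c. c \<in> cycles L i \<Longrightarrow> (\<Sum>G\<in>L. \<phi> G * c G) = 0"
  shows "\<exists>\<psi>. \<forall>H\<in>L. face_dim H = i \<longrightarrow> \<phi> H = coboundary \<psi> H"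
proof -
  obtain g where g: "range g \<subseteq> (chain_group L i :: ('a set \<Rightarrow> 'f) set)"
    "Vector_Spaces.linear fscale fscale g" "\<And>v. v \<in> boundary L ` chain_group L i \<Longrightarrow> boundary L (g v) = v"
    using fs2.linear_exists_right_inverse_on[OF linear_boundary subspace_chain_group, of L i L] by blast
  define \<Phi> where "\<Phi> = (\<lambda>c. \<Sum>G\<in>L. \<phi> G * c G)"
  define \<psi> where "\<psi> = (\<lambda>G. \<Phi> (g (point G)))"
  have "\<phi> H = coboundary \<psi> H" if H: "H \<in> L" "face_dim H = i" for H
  proof -
    have pH: "point H \<in> (chain_group L i :: ('a set \<Rightarrow> 'f) set)"
      using H by (auto simp: chain_group_def point_def)
    define u where "u = point H - g (boundary L (point H))"
    have "u \<in> chain_group L i"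
      unfolding u_def using pH g(1) by (intro fs.subspace_diff[OF subspace_chain_group]) auto
    moreover have "boundary L u = 0"
      unfolding u_def fs2.linear_diff[OF linear_boundary] using g(3) pH by simp
    ultimately have "u \<in> cycles L i" by (simp add: cycles_def zero_fun_def)
    then have "\<Phi> u = 0" using \<phi> by (simp add: \<Phi>_def)
    moreover have "\<Phi> u = \<Phi> (point H) - \<Phi> (g (boundary L (point H)))"
      by (simp add: u_def \<Phi>_def sum_subtractf right_diff_distrib)
    moreover have "\<Phi> (point H) = \<phi> H"
      using H(1) down_closedD(1)[OF L] unfolding \<Phi>_def point_def by (simp add: if_distrib cong: if_cong)
    moreover have "\<Phi> (g (boundary L (point H))) = coboundary \<psi> H"
    proof -
      have "g (boundary L (point H)) = (\<Sum>v\<in>H. fscale (vertex_sign v (H - {v})) (g (point (H - {v}))))"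
        unfolding boundary_point[OF L H(1)] by (simp add: fs2.linear_sum[OF g(2)] fs2.linear_scale[OF g(2)])
      then have "\<Phi> (g (boundary L (point H))) =
          (\<Sum>G\<in>L. \<Sum>v\<in>H. \<phi> G * (vertex_sign v (H - {v}) * g (point (H - {v})) G))"
        by (simp add: \<Phi>_def sum_fun_apply fscale_def sum_distrib_left)
      also have "\<dots> = (\<Sum>v\<in>H. \<Sum>G\<in>L. \<phi> G * (vertex_sign v (H - {v}) * g (point (H - {v})) G))"
        by (rule sum.swap)
      also have "\<dots> = coboundary \<psi> H"
        by (simp add: coboundary_def \<psi>_def \<Phi>_def sum_distrib_left mult.left_commute)
      finally show ?thesis .
    qed
    ultimately show ?thesis by simp
  qed
  then show ?thesis by blast
qed

definition relative_coboundary :: "'a::linorder set \<Rightarrow> ('a set \<Rightarrow> 'r::comm_ring_1) \<Rightarrow> 'a set \<Rightarrow> 'r" where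
  "relative_coboundary \<sigma> x G = (\<Sum>v\<in>G - \<sigma>. vertex_sign v (G - {v}) * x (G - {v}))"

text \<open>The signs by which the cochain complex of a link differs from that of the open star.\<close>

definition link_sign :: "'a::linorder set \<Rightarrow> 'a set \<Rightarrow> 'r::comm_ring_1" where
  "link_sign \<sigma> H = (\<Prod>u\<in>H. vertex_sign u \<sigma>)"

lemma link_sign_square: "link_sign \<sigma> H * link_sign \<sigma> H = 1"
  unfolding link_sign_def by (simp add: vertex_sign_square flip: prod.distrib)

text \<open>The position of a vertex in \<sigma> \<union> H combines its position relative to
  \<sigma> and to H. The first contribution depends on the vertex alone, so multiplying it up over H
  gives a twist turning one coboundary into the other.\<close>

lemma coboundary_link_sign:
  fixes x :: "'a::linorder set \<Rightarrow> 'r::comm_ring_1"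
  assumes "finite \<sigma>" "finite H" "\<sigma> \<inter> H = {}"
  shows "coboundary (\<lambda>K. link_sign \<sigma> K * x (\<sigma> \<union> K)) H = link_sign \<sigma> H * relative_coboundary \<sigma> x (\<sigma> \<union> H)"
proof -
  have "coboundary (\<lambda>K. link_sign \<sigma> K * x (\<sigma> \<union> K)) H =
      (\<Sum>v\<in>H. vertex_sign v (H - {v}) * (link_sign \<sigma> (H - {v}) * x (\<sigma> \<union> (H - {v}))))"
    by (simp add: coboundary_def)
  also have "\<dots> = (\<Sum>v\<in>H. link_sign \<sigma> H * (vertex_sign v (\<sigma> \<union> H - {v}) * x (\<sigma> \<union> H - {v})))"
  proof (intro sum.cong refl)
    fix v assume v: "v \<in> H"
    have e1: "\<sigma> \<union> H - {v} = \<sigma> \<union> (H - {v})" using v assms(3) by auto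
    have e2: "(vertex_sign v (\<sigma> \<union> (H - {v})) :: 'r) = vertex_sign v \<sigma> * vertex_sign v (H - {v})"
      using assms by (intro vertex_sign_Un) auto
    have e3: "(link_sign \<sigma> H :: 'r) = vertex_sign v \<sigma> * link_sign \<sigma> (H - {v})"
      unfolding link_sign_def using assms(2) v by (rule prod.remove)
    have alg: "s * (l * y) = t * l * (t * s * y)" if "t * t = 1" for s l t y :: 'r
    proof -
      have "t * l * (t * s * y) = (t * t) * (s * (l * y))" by (simp only: ac_simps)
      then show ?thesis using that by simp
    qed
    show "vertex_sign v (H - {v}) * (link_sign \<sigma> (H - {v}) * x (\<sigma> \<union> (H - {v}))) =
        link_sign \<sigma> H * (vertex_sign v (\<sigma> \<union> H - {v}) * x (\<sigma> \<union> H - {v}))"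
      unfolding e1 e2 e3 by (rule alg, rule vertex_sign_square)
  qed
  also have "\<dots> = link_sign \<sigma> H * relative_coboundary \<sigma> x (\<sigma> \<union> H)"
  proof -
    have "\<sigma> \<union> H - \<sigma> = H" using assms(3) by auto
    then show ?thesis by (simp add: relative_coboundary_def sum_distrib_left)
  qed
  finally show ?thesis .
qed

lemma down_closed_link: "down_closed \<Delta> \<Longrightarrow> down_closed (link \<Delta> \<sigma>)"
  unfolding down_closed_def link_def
proof (intro conjI ballI allI impI; (elim conjE CollectE)?)
  assume "finite \<Delta>" then show "finite {G \<in> \<Delta>. \<sigma> \<inter> G = {} \<and> \<sigma> \<union> G \<in> \<Delta>}" by simp
next
  fix F G assume *: "\<forall>F\<in>\<Delta>. finite F \<and> (\<forall>G. G \<subseteq> F \<longrightarrow> G \<in> \<Delta>)" "F \<in> \<Delta>" "G \<subseteq> F" "\<sigma> \<inter> F = {}" "\<sigma> \<union> F \<in> \<Delta>"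
  moreover have "\<sigma> \<union> G \<subseteq> \<sigma> \<union> F" using *(3) by auto
  ultimately show "G \<in> {G \<in> \<Delta>. \<sigma> \<inter> G = {} \<and> \<sigma> \<union> G \<in> \<Delta>}" by blast
qed auto

section \<open>Cohomology of the stars in a complex whose links are homology spheres\<close>

text \<open>The Gorenstein* condition over a field, with dimensions replaced by cardinalities. The
  field \<open>'f\<close> carries the homology; it is independent of the ground field of the algebra
  to be constructed.\<close>

locale sphere_like_complex =
  fixes \<Delta> :: "'a::linorder set set" and n :: nat and R :: "'f::field itself"
  assumes complex: "down_closed \<Delta>"
    and card_le: "F \<in> \<Delta> \<Longrightarrow> card F \<le> n"
    and link_homology: "\<sigma> \<in> \<Delta> \<Longrightarrow> has_homology_of_sphere TYPE('f) (link \<Delta> \<sigma>) (int n - 1 - int (card \<sigma>))"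
begin

lemma mem_link: "\<sigma> \<in> \<Delta> \<Longrightarrow> H \<in> link \<Delta> \<sigma> \<longleftrightarrow> \<sigma> \<inter> H = {} \<and> \<sigma> \<union> H \<in> \<Delta>"
  using down_closedD(3)[OF complex] by (auto simp: link_def)

lemma card_star: "\<sigma> \<in> \<Delta> \<Longrightarrow> H \<in> link \<Delta> \<sigma> \<Longrightarrow> card (\<sigma> \<union> H) = card \<sigma> + card H"
  using down_closedD(2)[OF complex] by (intro card_Un_disjoint) (auto simp: link_def)

text \<open>This is \<open>cochain_is_coboundary\<close> for the link of \<sigma>, carried over to
  the faces containing \<sigma> by the map from H to \<sigma> \<union> H and the sign twist.\<close>

lemma cochain_on_star_is_coboundary:
  fixes x :: "'a set \<Rightarrow> 'f"
  assumes \<sigma>: "\<sigma> \<in> \<Delta>" 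
    and \<phi>: "\<And>c. c \<in> cycles (link \<Delta> \<sigma>) (int p - int (card \<sigma>)) \<Longrightarrow>
       (\<Sum>H\<in>link \<Delta> \<sigma>. link_sign \<sigma> H * x (\<sigma> \<union> H) * c H) = 0"
  shows "\<exists>y. (\<forall>G. y G \<noteq> 0 \<longrightarrow> G \<in> \<Delta> \<and> \<sigma> \<subseteq> G \<and> card G = p) \<and>
     (\<forall>G\<in>\<Delta>. \<sigma> \<subseteq> G \<longrightarrow> card G = Suc p \<longrightarrow> x G = relative_coboundary \<sigma> y G)"
proof -
  note fin = down_closedD(2)[OF complex]
  obtain \<psi> where \<psi>: "\<And>H. H \<in> link \<Delta> \<sigma> \<Longrightarrow> face_dim H = int p - int (card \<sigma>) \<Longrightarrow>
      link_sign \<sigma> H * x (\<sigma> \<union> H) = coboundary \<psi> H"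
    using cochain_is_coboundary[OF down_closed_link[OF complex], where \<phi>="\<lambda>H. link_sign \<sigma> H * x (\<sigma> \<union> H)", OF \<phi>]
    by blast
  define y where "y = (\<lambda>G. if G \<in> \<Delta> \<and> \<sigma> \<subseteq> G \<and> card G = p then link_sign \<sigma> (G - \<sigma>) * \<psi> (G - \<sigma>) else 0)"
  have "x G = relative_coboundary \<sigma> y G" if G: "G \<in> \<Delta>" "\<sigma> \<subseteq> G" "card G = Suc p" for G
  proof -
    define H where "H = G - \<sigma>"
    have GH: "G = \<sigma> \<union> H" "\<sigma> \<inter> H = {}" using G(2) H_def by auto
    then have H: "H \<in> link \<Delta> \<sigma>" using mem_link[OF \<sigma>] G(1) by simp
    have cH: "card H + card \<sigma> = Suc p" using card_star[OF \<sigma> H] GH(1) G(3) by simp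
    have fH: "finite H" "finite \<sigma>" using fin G(1) \<sigma> H_def by auto
    have "link_sign \<sigma> H * relative_coboundary \<sigma> y G = coboundary (\<lambda>K. link_sign \<sigma> K * y (\<sigma> \<union> K)) H"
      using coboundary_link_sign[OF fH(2,1) GH(2), of y] GH(1) by simp
    also have "\<dots> = coboundary \<psi> H"
      unfolding coboundary_def
    proof (intro sum.cong refl)
      fix v assume v: "v \<in> H"
      have "\<sigma> \<union> (H - {v}) \<in> \<Delta>" using GH(1) by (intro down_closedD(3)[OF complex G(1)]) auto
      moreover have "card (\<sigma> \<union> (H - {v})) = p"
      proof -
        have "\<sigma> \<union> (H - {v}) = G - {v}" "v \<in> G" using v GH by auto
        then show ?thesis using G(3) by simp
      qed
      moreover have "\<sigma> \<union> (H - {v}) - \<sigma> = H - {v}" using GH(2) by auto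
      ultimately show "vertex_sign v (H - {v}) * (link_sign \<sigma> (H - {v}) * y (\<sigma> \<union> (H - {v}))) =
          vertex_sign v (H - {v}) * \<psi> (H - {v})"
        by (simp add: y_def mult.assoc[symmetric] link_sign_square)
    qed
    also have "\<dots> = link_sign \<sigma> H * x G"
      using \<psi>[OF H] cH GH(1) by (simp add: face_dim_def)
    finally have "link_sign \<sigma> H * link_sign \<sigma> H * relative_coboundary \<sigma> y G =
        link_sign \<sigma> H * link_sign \<sigma> H * x G" by (simp add: mult.assoc)
    then show ?thesis by (simp add: link_sign_square)
  qed
  then show ?thesis by (intro exI[of _ y]) (auto simp: y_def split: if_splits)
qed

lemma pairing_coboundary:
  fixes y :: "'a set \<Rightarrow> 'f"
  assumes \<sigma>: "\<sigma> \<in> \<Delta>" and e: "e \<in> chain_group (link \<Delta> \<sigma>) i"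
  shows "(\<Sum>H\<in>link \<Delta> \<sigma>. link_sign \<sigma> H * y (\<sigma> \<union> H) * boundary (link \<Delta> \<sigma>) e H) =
    (\<Sum>H\<in>link \<Delta> \<sigma>. link_sign \<sigma> H * relative_coboundary \<sigma> y (\<sigma> \<union> H) * e H)"
proof -
  note fin = down_closedD(2)[OF complex]
  have "(\<Sum>H\<in>link \<Delta> \<sigma>. link_sign \<sigma> H * y (\<sigma> \<union> H) * boundary (link \<Delta> \<sigma>) e H) =
    (\<Sum>H\<in>link \<Delta> \<sigma>. coboundary (\<lambda>K. link_sign \<sigma> K * y (\<sigma> \<union> K)) H * e H)"
    using e by (intro boundary_coboundary_adjoint down_closed_link complex) (auto simp: chain_group_def)
  also have "\<dots> = (\<Sum>H\<in>link \<Delta> \<sigma>. link_sign \<sigma> H * relative_coboundary \<sigma> y (\<sigma> \<union> H) * e H)"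
    using fin \<sigma> by (intro sum.cong refl arg_cong2[of _ _ _ _ "(*)"] coboundary_link_sign) (auto simp: link_def)
  finally show ?thesis .
qed

text \<open>Below the top degree every cycle of the link is a boundary, and by adjointness a cocycle
  pairs to zero with boundaries. So it vanishes on cycles and is a coboundary.\<close>

lemma star_exact:
  fixes x :: "'a set \<Rightarrow> 'f"
  assumes \<sigma>: "\<sigma> \<in> \<Delta>" and p: "Suc p < n"
    and x: "\<And>G. G \<in> \<Delta> \<Longrightarrow> \<sigma> \<subseteq> G \<Longrightarrow> card G = Suc (Suc p) \<Longrightarrow> relative_coboundary \<sigma> x G = 0"
  shows "\<exists>y. (\<forall>G. y G \<noteq> 0 \<longrightarrow> G \<in> \<Delta> \<and> \<sigma> \<subseteq> G \<and> card G = p) \<and>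
     (\<forall>G\<in>\<Delta>. \<sigma> \<subseteq> G \<longrightarrow> card G = Suc p \<longrightarrow> x G = relative_coboundary \<sigma> y G)"
proof (rule cochain_on_star_is_coboundary[OF \<sigma>])
  fix c :: "'a set \<Rightarrow> 'f"
  assume c: "c \<in> cycles (link \<Delta> \<sigma>) (int p - int (card \<sigma>))"
  have "int p - int (card \<sigma>) \<noteq> int n - 1 - int (card \<sigma>)" using p by simp
  from has_homology_of_sphereD(1)[OF link_homology[OF \<sigma>] this] c
  obtain e where e: "e \<in> chain_group (link \<Delta> \<sigma>) (int p - int (card \<sigma>) + 1)" "c = boundary (link \<Delta> \<sigma>) e"
    by (auto simp: boundaries_def)
  have "link_sign \<sigma> H * relative_coboundary \<sigma> x (\<sigma> \<union> H) * e H = 0" if "H \<in> link \<Delta> \<sigma>" for H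
  proof (cases "e H = 0")
    case False
    then have "face_dim H = int p - int (card \<sigma>) + 1" using e(1) by (auto simp: chain_group_def)
    then have "card (\<sigma> \<union> H) = Suc (Suc p)" using card_star[OF \<sigma> that] by (simp add: face_dim_def)
    then show ?thesis using x[of "\<sigma> \<union> H"] that by (simp add: mem_link[OF \<sigma>])
  qed simp
  then show "(\<Sum>H\<in>link \<Delta> \<sigma>. link_sign \<sigma> H * x (\<sigma> \<union> H) * c H) = 0"
    unfolding e(2) pairing_coboundary[OF \<sigma> e(1)] by (intro sum.neutral) auto
qed

text \<open>The link has no faces above the dimension of the sphere, so there are no nonzero
  boundaries in that degree: homology of rank one means that the cycles themselves form a
  line.\<close>

lemma fundamental_cycle:
  assumes \<sigma>: "\<sigma> \<in> \<Delta>"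
  shows "\<exists>z \<in> (cycles (link \<Delta> \<sigma>) (int n - 1 - int (card \<sigma>)) :: ('a set \<Rightarrow> 'f) set).
     (\<exists>H. z H \<noteq> 0) \<and>
     (\<forall>c\<in>cycles (link \<Delta> \<sigma>) (int n - 1 - int (card \<sigma>)). \<exists>r. c = (\<lambda>F. r * z F))"
proof -
  let ?L = "link \<Delta> \<sigma>" and ?d = "int n - 1 - int (card \<sigma>)"
  have "c F = 0" if "c \<in> chain_group ?L (?d + 1)" for c :: "'a set \<Rightarrow> 'f" and F
  proof (rule ccontr)
    assume "c F \<noteq> 0"
    then have F: "F \<in> ?L" "face_dim F = ?d + 1" using that by (auto simp: chain_group_def)
    have "card (\<sigma> \<union> F) = n + 1" using card_star[OF \<sigma> F(1)] F(2) by (simp add: face_dim_def)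
    moreover have "\<sigma> \<union> F \<in> \<Delta>" using F(1) by (simp add: link_def)
    ultimately show False using card_le[of "\<sigma> \<union> F"] by simp
  qed
  note zero = this
  have bd: "c = (\<lambda>_. 0)" if c: "c \<in> boundaries ?L ?d" for c :: "'a set \<Rightarrow> 'f"
  proof -
    obtain e where e: "e \<in> chain_group ?L (?d + 1)" "c = boundary ?L e"
      using c unfolding boundaries_def by blast
    then have "e = (\<lambda>_. 0)" using zero[OF e(1)] by auto
    then show ?thesis using e(2) boundary_zero by simp
  qed
  obtain z where z: "z \<in> (cycles ?L ?d :: ('a set \<Rightarrow> 'f) set)"
    "\<And>c. c \<in> cycles ?L ?d \<Longrightarrow> \<exists>!r::'f. (\<lambda>F. c F - r * z F) \<in> boundaries ?L ?d"
    using has_homology_of_sphereD(2)[OF link_homology[OF \<sigma>]] by (elim bexE) (erule that, erule bspec)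
  have "\<exists>r. c = (\<lambda>F. r * z F)" if c: "c \<in> cycles ?L ?d" for c
  proof -
    obtain r where "(\<lambda>F. c F - r * z F) \<in> boundaries ?L ?d" using z(2)[OF c] by blast
    from bd[OF this] have "c = (\<lambda>F. r * z F)" by (simp add: fun_eq_iff)
    then show ?thesis by blast
  qed
  moreover have "\<exists>H. z H \<noteq> 0"
  proof (rule ccontr)
    assume "\<not> (\<exists>H. z H \<noteq> 0)"
    then have z0: "z = (\<lambda>_. 0)" by auto
    have "(\<lambda>F. z F - 0 * z F) \<in> boundaries ?L ?d" "(\<lambda>F. z F - 1 * z F) \<in> boundaries ?L ?d"
      unfolding z0 using zero_boundaries by simp_all
    then show False using z(2)[OF z(1)] zero_neq_one by blast
  qed
  ultimately show ?thesis using z(1) by blast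
qed

text \<open>The top cohomology of the star of \<sigma> is one-dimensional, and pairing with the
  transported fundamental cycle \<open>z\<close> of the link detects it.\<close>

lemma star_top:
  assumes \<sigma>: "\<sigma> \<in> \<Delta>" and n: "n = Suc p"
  shows "\<exists>z :: 'a set \<Rightarrow> 'f. (\<forall>G. z G \<noteq> 0 \<longrightarrow> G \<in> \<Delta> \<and> \<sigma> \<subseteq> G \<and> card G = n) \<and> (\<exists>G. z G \<noteq> 0) \<and>
     (\<forall>x. (\<Sum>G\<in>\<Delta>. z G * x G) = 0 \<longleftrightarrow>
       (\<exists>y. (\<forall>G. y G \<noteq> 0 \<longrightarrow> G \<in> \<Delta> \<and> \<sigma> \<subseteq> G \<and> card G = p) \<and>
         (\<forall>G\<in>\<Delta>. \<sigma> \<subseteq> G \<longrightarrow> card G = Suc p \<longrightarrow> x G = relative_coboundary \<sigma> y G)))"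
proof -
  let ?L = "link \<Delta> \<sigma>" and ?d = "int n - 1 - int (card \<sigma>)"
  note fin = down_closedD(1)[OF complex]
  obtain zl :: "'a set \<Rightarrow> 'f" where zl: "zl \<in> cycles ?L ?d" "\<exists>H. zl H \<noteq> 0" 
    "\<And>c. c \<in> cycles ?L ?d \<Longrightarrow> \<exists>r. c = (\<lambda>F. r * zl F)"
    using fundamental_cycle[OF \<sigma>] by blast
  have zl_supp: "H \<in> ?L \<and> card (\<sigma> \<union> H) = n" if "zl H \<noteq> 0" for H
  proof -
    have "H \<in> ?L" "face_dim H = ?d" using zl(1) that by (auto simp: cycles_def chain_group_def)
    then show ?thesis using card_star[OF \<sigma>, of H] by (simp add: face_dim_def)
  qed
  define z where "z = (\<lambda>G. if G \<in> \<Delta> \<and> \<sigma> \<subseteq> G then link_sign \<sigma> (G - \<sigma>) * zl (G - \<sigma>) else 0)"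
  have zsum: "(\<Sum>G\<in>\<Delta>. z G * x G) = (\<Sum>H\<in>?L. link_sign \<sigma> H * x (\<sigma> \<union> H) * zl H)" for x
  proof -
    have "(\<Sum>G\<in>\<Delta>. z G * x G) = (\<Sum>G\<in>{G\<in>\<Delta>. \<sigma> \<subseteq> G}. link_sign \<sigma> (G - \<sigma>) * zl (G - \<sigma>) * x G)"
      using fin by (intro sum.mono_neutral_cong_right) (auto simp: z_def)
    also have "\<dots> = (\<Sum>H\<in>?L. link_sign \<sigma> H * x (\<sigma> \<union> H) * zl H)"
      by (rule sum.reindex_bij_witness[of _ "\<lambda>H. \<sigma> \<union> H" "\<lambda>G. G - \<sigma>"])
        (auto simp: mem_link[OF \<sigma>] Un_absorb1 Un_absorb2 Diff_triv Un_Diff Int_commute ac_simps)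
    finally show ?thesis .
  qed
  have "G \<in> \<Delta> \<and> \<sigma> \<subseteq> G \<and> card G = n" if "z G \<noteq> 0" for G
  proof -
    have G: "G \<in> \<Delta>" "\<sigma> \<subseteq> G" "zl (G - \<sigma>) \<noteq> 0" using that by (auto simp: z_def split: if_splits)
    then show ?thesis using zl_supp[OF G(3)] by (simp add: Un_absorb1)
  qed
  moreover have "\<exists>G. z G \<noteq> 0"
  proof -
    obtain H where H: "zl H \<noteq> 0" using zl(2) by blast
    then have "H \<in> ?L" using zl_supp by blast
    then have "\<sigma> \<union> H \<in> \<Delta>" "\<sigma> \<union> H - \<sigma> = H" by (auto simp: link_def)
    then have "z (\<sigma> \<union> H) = link_sign \<sigma> H * zl H" by (simp add: z_def)
    moreover have "link_sign \<sigma> H \<noteq> (0::'f)" using link_sign_square[of \<sigma> H, where 'a='f] by force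
    ultimately have "z (\<sigma> \<union> H) \<noteq> 0" using H by simp
    then show ?thesis by blast
  qed
  moreover have "(\<Sum>G\<in>\<Delta>. z G * x G) = 0 \<longleftrightarrow>
       (\<exists>y. (\<forall>G. y G \<noteq> 0 \<longrightarrow> G \<in> \<Delta> \<and> \<sigma> \<subseteq> G \<and> card G = p) \<and>
         (\<forall>G\<in>\<Delta>. \<sigma> \<subseteq> G \<longrightarrow> card G = Suc p \<longrightarrow> x G = relative_coboundary \<sigma> y G))" for x
  proof
    assume 0: "(\<Sum>G\<in>\<Delta>. z G * x G) = 0"
    show "\<exists>y. (\<forall>G. y G \<noteq> 0 \<longrightarrow> G \<in> \<Delta> \<and> \<sigma> \<subseteq> G \<and> card G = p) \<and>
         (\<forall>G\<in>\<Delta>. \<sigma> \<subseteq> G \<longrightarrow> card G = Suc p \<longrightarrow> x G = relative_coboundary \<sigma> y G)"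
    proof (rule cochain_on_star_is_coboundary[OF \<sigma>])
      fix c :: "'a set \<Rightarrow> 'f" assume "c \<in> cycles ?L (int p - int (card \<sigma>))"
      then have "c \<in> cycles ?L ?d" using n by simp
      then obtain r where r: "c = (\<lambda>F. r * zl F)" using zl(3) by blast
      have "(\<Sum>H\<in>?L. link_sign \<sigma> H * x (\<sigma> \<union> H) * c H) = r * (\<Sum>G\<in>\<Delta>. z G * x G)"
        unfolding zsum r sum_distrib_left by (intro sum.cong refl) (simp only: mult.assoc mult.left_commute)
      then show "(\<Sum>H\<in>?L. link_sign \<sigma> H * x (\<sigma> \<union> H) * c H) = 0" using 0 by simp
    qed
  next
    assume "\<exists>y. (\<forall>G. y G \<noteq> 0 \<longrightarrow> G \<in> \<Delta> \<and> \<sigma> \<subseteq> G \<and> card G = p) \<and>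
         (\<forall>G\<in>\<Delta>. \<sigma> \<subseteq> G \<longrightarrow> card G = Suc p \<longrightarrow> x G = relative_coboundary \<sigma> y G)"
    then obtain y where "\<forall>G\<in>\<Delta>. \<sigma> \<subseteq> G \<longrightarrow> card G = Suc p \<longrightarrow> x G = relative_coboundary \<sigma> y G"
      by (elim exE conjE)
    note y = this[rule_format]
    have "(\<Sum>G\<in>\<Delta>. z G * x G) = (\<Sum>H\<in>?L. link_sign \<sigma> H * relative_coboundary \<sigma> y (\<sigma> \<union> H) * zl H)"
      unfolding zsum
    proof (intro sum.cong refl)
      fix H assume H: "H \<in> ?L"
      show "link_sign \<sigma> H * x (\<sigma> \<union> H) * zl H = link_sign \<sigma> H * relative_coboundary \<sigma> y (\<sigma> \<union> H) * zl H"
        using y[of "\<sigma> \<union> H"] zl_supp[of H] mem_link[OF \<sigma>, of H] n by (cases "zl H = 0") auto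
    qed
    also have "\<dots> = (\<Sum>H\<in>?L. link_sign \<sigma> H * y (\<sigma> \<union> H) * boundary ?L zl H)"
      using zl(1) by (subst pairing_coboundary[OF \<sigma>, of _ ?d]) (auto simp: cycles_def)
    also have "\<dots> = 0" using zl(1) by (simp add: cycles_def)
    finally show "(\<Sum>G\<in>\<Delta>. z G * x G) = 0" .
  qed
  ultimately show ?thesis by (intro exI[of _ z]) blast
qed

end

section \<open>The complex of face functions and its parameters\<close>

lemma vertex_sign_swap:
  assumes "finite A" "u \<notin> A" "v \<notin> A" "u \<noteq> v"
  shows "vertex_sign v (insert u A) * vertex_sign u A + vertex_sign u (insert v A) * vertex_sign v A = (0::'r::comm_ring_1)"
proof -
  have 1: "vertex_sign v (insert u A) = vertex_sign v A * (vertex_sign v {u} :: 'r)"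
    using vertex_sign_Un[of A "{u}" v] assms by simp
  have 2: "vertex_sign u (insert v A) = vertex_sign u A * (vertex_sign u {v} :: 'r)"
    using vertex_sign_Un[of A "{v}" u] assms by simp
  have single: "vertex_sign x {y} = (if y < x then - 1 else 1 :: 'r)" for x y :: 'a
  proof -
    have "{w \<in> {y}. w < x} = (if y < x then {y} else {})" by auto
    then show ?thesis by (simp add: vertex_sign_def)
  qed
  show ?thesis unfolding 1 2 single using assms(4) by (auto simp: mult.commute)
qed

lemma relative_coboundary_square:
  assumes "finite G"
  shows "relative_coboundary \<sigma> (relative_coboundary \<sigma> x) G = 0"
proof -
  define W where "W = G - \<sigma>"
  have W: "finite W" using assms by (simp add: W_def)
  define F where "F = (\<lambda>v u. vertex_sign v (G - {v}) * (vertex_sign u (G - {v} - {u}) * x (G - {v} - {u})))"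
  have "relative_coboundary \<sigma> (relative_coboundary \<sigma> x) G = (\<Sum>v\<in>W. \<Sum>u\<in>W - {v}. F v u)"
    unfolding relative_coboundary_def F_def W_def sum_distrib_left
    by (intro sum.cong) auto
  also have "\<dots> = (\<Sum>(v, u)\<in>(SIGMA v:W. W - {v}). F v u)"
    using W by (subst sum.Sigma) auto
  also have "(SIGMA v:W. W - {v}) = {(v, u) \<in> W \<times> W. u < v} \<union> {(v, u) \<in> W \<times> W. v < u}" by auto
  also have "(\<Sum>(v, u)\<in>{(v, u) \<in> W \<times> W. u < v} \<union> {(v, u) \<in> W \<times> W. v < u}. F v u) =
      (\<Sum>(v, u)\<in>{(v, u) \<in> W \<times> W. u < v}. F v u) + (\<Sum>(v, u)\<in>{(v, u) \<in> W \<times> W. v < u}. F v u)"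
    using W by (intro sum.union_disjoint finite_subset[OF _ finite_cartesian_product[OF W W]]) auto
  also have "(\<Sum>(v, u)\<in>{(v, u) \<in> W \<times> W. v < u}. F v u) = (\<Sum>(v, u)\<in>{(v, u) \<in> W \<times> W. u < v}. F u v)"
    by (rule sum.reindex_bij_witness[of _ prod.swap prod.swap]) auto
  also have "(\<Sum>(v, u)\<in>{(v, u) \<in> W \<times> W. u < v}. F v u) + (\<Sum>(v, u)\<in>{(v, u) \<in> W \<times> W. u < v}. F u v) = 0"
    unfolding sum.distrib[symmetric]
  proof (intro sum.neutral ballI, clarify)
    fix v u assume uv: "v \<in> W" "u \<in> W" "u < v"
    define A where "A = G - {u, v}"
    have e: "G - {v} = insert u A" "G - {u} = insert v A" "G - {v} - {u} = A" "G - {u} - {v} = A"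
      using uv by (auto simp: A_def W_def)
    have "F v u + F u v = (vertex_sign v (insert u A) * vertex_sign u A + vertex_sign u (insert v A) * vertex_sign v A) * x A"
      unfolding F_def e(3,4) unfolding e by (simp add: distrib_right mult.assoc)
    also have "\<dots> = 0" using uv assms by (subst vertex_sign_swap) (auto simp: A_def)
    finally show "F v u + F u v = 0" .
  qed
  finally show ?thesis .
qed

lemma contract_supported:
  assumes "supported_on G x" "G \<subseteq> V" "finite V"
  shows "contract V w x = contract G w x"
proof
  fix a
  have "x (add_mset v a) = 0" if "v \<in> V - G" for v
    using that by (intro supported_onD[OF assms(1)]) simp
  then show "contract V w x a = contract G w x a"
    unfolding contract_def using assms(2,3) by (intro sum.mono_neutral_right) simp_all
qed

text \<open>Distinct scalars on the vertices give the linear forms with coefficients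
  \<open>t v ^ s\<close>. By Vandermonde the first q of them are linearly independent on every face
  with q vertices, which is what genericity has to mean here.\<close>

locale sphere_like_complex_parameters = sphere_like_complex \<Delta> n R
  for \<Delta> :: "'a::linorder set set" and n :: nat and R :: "'f::field itself" +
  fixes t :: "'a \<Rightarrow> 'f"
  assumes t: "inj_on t (\<Union>\<Delta>)"
begin

text \<open>The product, over faces G with q vertices, of the duals of the polynomial rings in the
  variables of G. \<open>differential\<close> is dual to the maps setting one variable to zero. It
  fixes the multiset, and for a fixed multiset with support \<sigma> the complex is the cochain
  complex of the faces containing \<sigma>, hence that of a link up to shift and signs.\<close>

definition face_functions :: "nat \<Rightarrow> ('a set \<times> 'a multiset \<Rightarrow> 'f) set" where
  "face_functions q = functions_on {(G, a). G \<in> \<Delta> \<and> card G = q \<and> set_mset a \<subseteq> G}"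

definition parameter :: "nat \<Rightarrow> ('a set \<times> 'a multiset \<Rightarrow> 'f) \<Rightarrow> 'a set \<times> 'a multiset \<Rightarrow> 'f" where
  "parameter s x = (\<lambda>(G, a). contract (\<Union>\<Delta>) (\<lambda>v. t v ^ s) (\<lambda>b. x (G, b)) a)"

definition differential :: "('a set \<times> 'a multiset \<Rightarrow> 'f) \<Rightarrow> 'a set \<times> 'a multiset \<Rightarrow> 'f" where
  "differential x = (\<lambda>(G, a). if G \<in> \<Delta> \<and> set_mset a \<subseteq> G
     then relative_coboundary (set_mset a) (\<lambda>H. x (H, a)) G else 0)"

lemma face_functionsD:
  assumes "x \<in> face_functions q" "x (G, a) \<noteq> 0"
  shows "G \<in> \<Delta>" "card G = q" "set_mset a \<subseteq> G"
proof -
  have "(G, a) \<in> {(G, a). G \<in> \<Delta> \<and> card G = q \<and> set_mset a \<subseteq> G}"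
    using assms unfolding face_functions_def functions_on_def by blast
  then show "G \<in> \<Delta>" "card G = q" "set_mset a \<subseteq> G" by simp_all
qed

lemma face_functionsI:
  assumes "\<And>G a. x (G, a) \<noteq> 0 \<Longrightarrow> G \<in> \<Delta> \<and> card G = q \<and> set_mset a \<subseteq> G"
  shows "x \<in> face_functions q"
  unfolding face_functions_def functions_on_def
proof (rule CollectI, intro allI impI)
  fix i assume "x i \<noteq> 0"
  then show "i \<in> {(G, a). G \<in> \<Delta> \<and> card G = q \<and> set_mset a \<subseteq> G}"
    using assms by (cases i) simp
qed

lemma face_functions_supported: "x \<in> face_functions q \<Longrightarrow> supported_on G (\<lambda>b. x (G, b))"
  unfolding supported_on_def by (blast dest: face_functionsD(3))

lemma parameter_nonzeroD:
  assumes "parameter s x (G, a) \<noteq> 0"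
  shows "\<exists>v. x (G, add_mset v a) \<noteq> 0"
proof (rule ccontr)
  assume "\<nexists>v. x (G, add_mset v a) \<noteq> 0"
  then have "parameter s x (G, a) = 0" by (simp add: parameter_def contract_def)
  then show False using assms by simp
qed

lemma parameter_face_functions: "x \<in> face_functions q \<Longrightarrow> parameter s x \<in> face_functions q"
  by (rule face_functionsI) (metis parameter_nonzeroD face_functionsD set_mset_add_mset_insert insert_subset)

lemma differential_nonzeroD:
  assumes "differential x (G, a) \<noteq> 0"
  shows "G \<in> \<Delta>" "set_mset a \<subseteq> G" "\<exists>v\<in>G. x (G - {v}, a) \<noteq> 0"
proof -
  show G: "G \<in> \<Delta>" "set_mset a \<subseteq> G" using assms by (auto simp: differential_def split: if_splits)
  show "\<exists>v\<in>G. x (G - {v}, a) \<noteq> 0"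
  proof (rule ccontr)
    assume "\<not> (\<exists>v\<in>G. x (G - {v}, a) \<noteq> 0)"
    then have "differential x (G, a) = 0" by (simp add: differential_def relative_coboundary_def)
    then show False using assms by simp
  qed
qed

text \<open>Contracting by a vertex u enlarges the multiset, so u drops out of the range of the
  coboundary sum. The lost term is zero, as functions on G - {u} vanish on multisets containing
  u.\<close>

lemma differential_parameter:
  assumes x: "x \<in> face_functions q"
  shows "differential (parameter s x) = parameter s (differential x)"
proof (rule ext, clarify)
  fix G a
  show "differential (parameter s x) (G, a) = parameter s (differential x) (G, a)"
  proof (cases "G \<in> \<Delta> \<and> set_mset a \<subseteq> G")
    case False
    have "parameter s (differential x) (G, a) = 0"
    proof (rule ccontr)
      assume "parameter s (differential x) (G, a) \<noteq> 0"
      then obtain v where "differential x (G, add_mset v a) \<noteq> 0" using parameter_nonzeroD by blast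
      then have "G \<in> \<Delta>" "set_mset (add_mset v a) \<subseteq> G" using differential_nonzeroD by blast+
      then show False using False by simp
    qed
    moreover have "differential (parameter s x) (G, a) = 0"
      using False differential_nonzeroD by blast
    ultimately show ?thesis by simp
  next
    case True
    have "differential (parameter s x) (G, a) =
      (\<Sum>v\<in>G - set_mset a. \<Sum>u\<in>\<Union>\<Delta>. t u ^ s * (vertex_sign v (G - {v}) * x (G - {v}, add_mset u a)))"
      using True by (simp add: differential_def relative_coboundary_def parameter_def contract_def
         sum_distrib_left mult.left_commute)
    also have "\<dots> = (\<Sum>u\<in>\<Union>\<Delta>. \<Sum>v\<in>G - set_mset a. t u ^ s * (vertex_sign v (G - {v}) * x (G - {v}, add_mset u a)))"
      by (rule sum.swap)
    also have "\<dots> = (\<Sum>u\<in>\<Union>\<Delta>. t u ^ s * differential x (G, add_mset u a))"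
    proof (intro sum.cong refl)
      fix u
      have vanish: "x (G - {v}, add_mset u a) = 0" if "u \<in> G \<longrightarrow> u = v" for v
      proof (rule ccontr)
        assume "x (G - {v}, add_mset u a) \<noteq> 0"
        then have "set_mset (add_mset u a) \<subseteq> G - {v}" by (rule face_functionsD(3)[OF x])
        then show False using that by simp
      qed
      show "(\<Sum>v\<in>G - set_mset a. t u ^ s * (vertex_sign v (G - {v}) * x (G - {v}, add_mset u a))) =
        t u ^ s * differential x (G, add_mset u a)"
      proof (cases "u \<in> G")
        case u: True
        have "x (G - {v}, add_mset u a) = 0" if "v \<in> G - set_mset a - (G - set_mset (add_mset u a))" for v
        proof (rule vanish)
          show "u \<in> G \<longrightarrow> u = v" using that by auto
        qed
        then have "(\<Sum>v\<in>G - set_mset a. t u ^ s * (vertex_sign v (G - {v}) * x (G - {v}, add_mset u a))) =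
          (\<Sum>v\<in>G - set_mset (add_mset u a). t u ^ s * (vertex_sign v (G - {v}) * x (G - {v}, add_mset u a)))"
          using True down_closedD(2)[OF complex] by (intro sum.mono_neutral_right ballI) (blast, auto)
        also have "\<dots> = t u ^ s * differential x (G, add_mset u a)"
          using u True by (simp add: differential_def relative_coboundary_def sum_distrib_left)
        finally show ?thesis .
      next
        case False
        then have "(\<Sum>v\<in>G - set_mset a. t u ^ s * (vertex_sign v (G - {v}) * x (G - {v}, add_mset u a))) = 0"
          using vanish by simp
        then show ?thesis using False by (simp add: differential_def)
      qed
    qed
    also have "\<dots> = parameter s (differential x) (G, a)" by (simp add: parameter_def contract_def)
    finally show ?thesis .
  qed
qed

text \<open>The differential never changes the multiset, so preimages chosen separately for each
  multiset can be put together.\<close>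

lemma differential_imageI:
  assumes x: "x \<in> face_functions (Suc q)"
    and ex: "\<And>a. set_mset a \<in> \<Delta> \<Longrightarrow> \<exists>y. (\<forall>G. y G \<noteq> 0 \<longrightarrow> G \<in> \<Delta> \<and> set_mset a \<subseteq> G \<and> card G = q) \<and>
     (\<forall>G\<in>\<Delta>. set_mset a \<subseteq> G \<longrightarrow> card G = Suc q \<longrightarrow> x (G, a) = relative_coboundary (set_mset a) y G)"
  shows "x \<in> differential ` face_functions q"
proof -
  have "\<forall>a. \<exists>y. set_mset a \<in> \<Delta> \<longrightarrow> (\<forall>G. y G \<noteq> 0 \<longrightarrow> G \<in> \<Delta> \<and> set_mset a \<subseteq> G \<and> card G = q) \<and>
   (\<forall>G\<in>\<Delta>. set_mset a \<subseteq> G \<longrightarrow> card G = Suc q \<longrightarrow> x (G, a) = relative_coboundary (set_mset a) y G)"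
    by (simp only: ex_simps) (intro allI impI ex)
  from choice[OF this] obtain y where yy: "\<forall>a. set_mset a \<in> \<Delta> \<longrightarrow> (\<forall>G. y a G \<noteq> 0 \<longrightarrow> G \<in> \<Delta> \<and> set_mset a \<subseteq> G \<and> card G = q) \<and>
   (\<forall>G\<in>\<Delta>. set_mset a \<subseteq> G \<longrightarrow> card G = Suc q \<longrightarrow> x (G, a) = relative_coboundary (set_mset a) (y a) G)" ..
  have y: "\<And>a G. set_mset a \<in> \<Delta> \<Longrightarrow> y a G \<noteq> 0 \<Longrightarrow> G \<in> \<Delta> \<and> set_mset a \<subseteq> G \<and> card G = q"
    "\<And>a G. set_mset a \<in> \<Delta> \<Longrightarrow> G\<in>\<Delta> \<Longrightarrow> set_mset a \<subseteq> G \<Longrightarrow> card G = Suc q \<Longrightarrow> 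
      x (G, a) = relative_coboundary (set_mset a) (y a) G"
    using yy[rule_format] by blast+
  define y' where "y' = (\<lambda>(G, a). if set_mset a \<in> \<Delta> then y a G else 0)"
  have "y' \<in> face_functions q"
    using y(1) by (intro face_functionsI) (auto simp: y'_def split: if_splits)
  moreover have "x = differential y'"
  proof (rule ext, clarify)
    fix G a
    show "x (G, a) = differential y' (G, a)"
    proof (cases "G \<in> \<Delta> \<and> set_mset a \<subseteq> G")
      case True
      then have a: "set_mset a \<in> \<Delta>" using down_closedD(3)[OF complex] by blast
      have d: "differential y' (G, a) = relative_coboundary (set_mset a) (y a) G"
        using True a by (simp add: differential_def y'_def)
      show ?thesis
      proof (cases "card G = Suc q")
        case True
        then show ?thesis using d y(2)[OF a] \<open>G \<in> \<Delta> \<and> set_mset a \<subseteq> G\<close> by simp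
      next
        case False
        have "y a (G - {v}) = 0" if "v \<in> G" for v
        proof (rule ccontr)
          assume "y a (G - {v}) \<noteq> 0"
          then have "card (G - {v}) = q" using y(1)[OF a] by blast
          moreover have "finite G" using True down_closedD(2)[OF complex] by blast
          ultimately show False using that False card.remove by metis
        qed
        then have "relative_coboundary (set_mset a) (y a) G = 0"
          by (auto simp: relative_coboundary_def intro!: sum.neutral)
        moreover have "x (G, a) = 0" using x False face_functionsD(2) by blast
        ultimately show ?thesis using d by simp
      qed
    next
      case False
      then have "x (G, a) = 0" using face_functionsD[OF x] by blast
      moreover have "differential y' (G, a) = 0" using False differential_nonzeroD by blast
      ultimately show ?thesis by simp
    qed
  qed
  ultimately show ?thesis by blast
qed

text \<open>Exactness is \<open>star_exact\<close> for the support of each multiset. Solvability is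
  \<open>contract_solvable\<close> for each face separately, with all factors \<open>c\<close> equal
  to 1.\<close>

sublocale regular_operators n face_functions differential parameter
proof
  fix x y :: "'a set \<times> 'a multiset \<Rightarrow> 'f" and s r q
  show "differential (x - y) = differential x - differential y"
  proof (rule ext, clarify)
    fix G a
    show "differential (x - y) (G, a) = (differential x - differential y) (G, a)"
      by (simp add: differential_def relative_coboundary_def sum_subtractf right_diff_distrib)
  qed
  show "parameter s (x - y) = parameter s x - parameter s y"
  proof (rule ext, clarify)
    fix G a
    show "parameter s (x - y) (G, a) = (parameter s x - parameter s y) (G, a)"
      by (simp add: parameter_def contract_def sum_subtractf right_diff_distrib)
  qed
  show "0 \<in> face_functions q" by (rule face_functionsI) simp
  show "x - y \<in> face_functions q" if "x \<in> face_functions q" "y \<in> face_functions q"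
    using that fs.subspace_diff[OF subspace_functions_on] unfolding face_functions_def by blast
  show "parameter s x \<in> face_functions q" if "x \<in> face_functions q"
    using that by (rule parameter_face_functions)
  show "parameter s (parameter r x) = parameter r (parameter s x)"
  proof (rule ext, clarify)
    fix G a
    show "parameter s (parameter r x) (G, a) = parameter r (parameter s x) (G, a)"
      using fun_cong[OF contract_commute[of "\<Union>\<Delta>" "\<lambda>v. t v ^ s" "\<lambda>v. t v ^ r" "\<lambda>b. x (G, b)"], of a]
      by (simp add: parameter_def)
  qed
  show "differential (parameter s x) = parameter s (differential x)" if "x \<in> face_functions q"
    using that by (rule differential_parameter)
  show "differential x \<in> face_functions (Suc q)" if x: "x \<in> face_functions q"
  proof (rule face_functionsI)
    fix G a assume "differential x (G, a) \<noteq> 0"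
    from differential_nonzeroD[OF this] obtain v where v: "G \<in> \<Delta>" "set_mset a \<subseteq> G" "v \<in> G" "x (G - {v}, a) \<noteq> 0" by blast
    have "card (G - {v}) = q" using face_functionsD[OF x v(4)] by simp
    moreover have "card G = Suc (card (G - {v}))"
      using down_closedD(2)[OF complex v(1)] v(3) by (rule card.remove)
    ultimately have "card G = Suc q" by (simp only:)
    then show "G \<in> \<Delta> \<and> card G = Suc q \<and> set_mset a \<subseteq> G" using v by blast
  qed
  show "differential (differential x) = 0" if x: "x \<in> face_functions q"
  proof (rule ext, clarify)
    fix G a
    show "differential (differential x) (G, a) = 0 (G, a)"
    proof (cases "G \<in> \<Delta> \<and> set_mset a \<subseteq> G")
      case True
      have "differential (differential x) (G, a) =
          relative_coboundary (set_mset a) (relative_coboundary (set_mset a) (\<lambda>H. x (H, a))) G"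
      proof -
        have "differential x (G - {v}, a) = relative_coboundary (set_mset a) (\<lambda>H. x (H, a)) (G - {v})"
          if "v \<in> G - set_mset a" for v
        proof -
          have "G - {v} \<in> \<Delta>" by (rule down_closedD(3)[OF complex, of G]) (use True in auto)
          moreover have "set_mset a \<subseteq> G - {v}" using True that by auto
          ultimately show ?thesis by (simp add: differential_def)
        qed
        then have "relative_coboundary (set_mset a) (\<lambda>H. differential x (H, a)) G =
            relative_coboundary (set_mset a) (relative_coboundary (set_mset a) (\<lambda>H. x (H, a))) G"
          unfolding relative_coboundary_def[of "set_mset a" _ G] by (intro sum.cong refl arg_cong2[of _ _ _ _ "(*)"])
        moreover have "differential (differential x) (G, a) = relative_coboundary (set_mset a) (\<lambda>H. differential x (H, a)) G"
          using True unfolding differential_def[of "differential x"] by simp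
        ultimately show ?thesis by simp
      qed
      also have "\<dots> = 0" using True down_closedD(2)[OF complex] by (intro relative_coboundary_square) auto
      finally show ?thesis by simp
    next
      case False
      then have "differential (differential x) (G, a) = 0" using differential_nonzeroD by blast
      then show ?thesis by simp
    qed
  qed
  show "x \<in> differential ` face_functions q"
    if "Suc q < n" and x: "x \<in> face_functions (Suc q)" and dx: "differential x = 0"
  proof -
    have "\<exists>y. (\<forall>G. y G \<noteq> 0 \<longrightarrow> G \<in> \<Delta> \<and> set_mset a \<subseteq> G \<and> card G = q) \<and>
     (\<forall>G\<in>\<Delta>. set_mset a \<subseteq> G \<longrightarrow> card G = Suc q \<longrightarrow> x (G, a) = relative_coboundary (set_mset a) y G)"
      if "set_mset a \<in> \<Delta>" for a
    proof (rule star_exact[OF that \<open>Suc q < n\<close>])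
      fix G assume "G \<in> \<Delta>" "set_mset a \<subseteq> G"
      then show "relative_coboundary (set_mset a) (\<lambda>G. x (G, a)) G = 0"
        using fun_cong[OF dx, of "(G, a)"] by (simp add: differential_def)
    qed
    then show ?thesis using x by (intro differential_imageI)
  qed
  show "\<exists>y\<in>face_functions q. (\<forall>s<m. parameter s y = 0) \<and> parameter m y = x"
    if x: "x \<in> face_functions q" and m: "m < q" and px: "\<And>s. s < m \<Longrightarrow> parameter s x = 0" for m
  proof -
    have sub: "G \<subseteq> \<Union>\<Delta>" if "G \<in> \<Delta>" for G using that by auto
    note finV = down_closedD(4)[OF complex]
    have "\<exists>y. supported_on G y \<and> (\<forall>s<m. contract G (\<lambda>v. 1 * t v ^ s) y = (\<lambda>_. 0)) \<and>
       contract G (\<lambda>v. 1 * t v ^ m) y = (\<lambda>b. x (G, b))" if G: "G \<in> \<Delta>" "card G = q" for G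
    proof (rule contract_solvable)
      show "finite G" using down_closedD(2)[OF complex] G by blast
      show "inj_on t G" using t sub[OF G(1)] by (rule inj_on_subset)
      show "m < card G" using m G by simp
      show sx: "supported_on G (\<lambda>b. x (G, b))" using x by (rule face_functions_supported)
      show "\<forall>s<m. contract G (\<lambda>v. 1 * t v ^ s) (\<lambda>b. x (G, b)) = (\<lambda>_. 0)"
      proof (intro allI impI ext)
        fix s b assume "s < m"
        from fun_cong[OF px[OF this], of "(G, b)"]
        show "contract G (\<lambda>v. 1 * t v ^ s) (\<lambda>b. x (G, b)) b = 0"
          by (simp add: parameter_def contract_supported[OF sx sub[OF G(1)] finV])
      qed
    qed simp
    then have "\<forall>G. \<exists>y. G \<in> \<Delta> \<longrightarrow> card G = q \<longrightarrow> supported_on G y \<and> (\<forall>s<m. contract G (\<lambda>v. 1 * t v ^ s) y = (\<lambda>_. 0)) \<and>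
       contract G (\<lambda>v. 1 * t v ^ m) y = (\<lambda>b. x (G, b))" by blast
    from choice[OF this] obtain y where yy: "\<forall>G. G \<in> \<Delta> \<longrightarrow> card G = q \<longrightarrow> supported_on G (y G) \<and> (\<forall>s<m. contract G (\<lambda>v. 1 * t v ^ s) (y G) = (\<lambda>_. 0)) \<and>
       contract G (\<lambda>v. 1 * t v ^ m) (y G) = (\<lambda>b. x (G, b))" ..
    have y: "\<And>G. G \<in> \<Delta> \<Longrightarrow> card G = q \<Longrightarrow> supported_on G (y G)"
      "\<And>G s. G \<in> \<Delta> \<Longrightarrow> card G = q \<Longrightarrow> s < m \<Longrightarrow> contract G (\<lambda>v. 1 * t v ^ s) (y G) = (\<lambda>_. 0)"
      "\<And>G. G \<in> \<Delta> \<Longrightarrow> card G = q \<Longrightarrow> contract G (\<lambda>v. 1 * t v ^ m) (y G) = (\<lambda>b. x (G, b))"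
      using yy[rule_format] by blast+
    define y' where "y' = (\<lambda>(G, a). if G \<in> \<Delta> \<and> card G = q then y G a else 0)"
    have "y' \<in> face_functions q"
      using y(1) by (intro face_functionsI) (auto simp: y'_def supported_on_def split: if_splits)
    moreover have py: "parameter s y' (G, a) = (if G \<in> \<Delta> \<and> card G = q then contract G (\<lambda>v. 1 * t v ^ s) (y G) a else 0)" for s G a
    proof (cases "G \<in> \<Delta> \<and> card G = q")
      case True
      then show ?thesis
        using contract_supported[OF y(1) sub finV, of G "\<lambda>v. t v ^ s"] by (simp add: parameter_def y'_def)
    qed (auto simp: parameter_def y'_def contract_def)
    have "parameter s y' = 0" if "s < m" for s
      using y(2)[OF _ _ that] py[of s] by (auto simp: fun_eq_iff)
    moreover have "parameter m y' = x"
    proof (rule ext, clarify)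
      fix G a
      show "parameter m y' (G, a) = x (G, a)"
        using y(3)[of G] py[of m G a] face_functionsD(1,2)[OF x, of G a] by auto
    qed
    ultimately show ?thesis using \<open>y' \<in> face_functions q\<close> by blast
  qed
qed

end

section \<open>Hilbert functions of the common kernels on the top cokernel\<close>

context sphere_like_complex_parameters
begin

definition degree_part :: "nat \<Rightarrow> ('b \<times> 'a multiset \<Rightarrow> 'f) \<Rightarrow> 'b \<times> 'a multiset \<Rightarrow> 'f" where
  "degree_part i x = (\<lambda>(G, a). if size a = i then x (G, a) else 0)"

definition top_monomials :: "nat \<Rightarrow> ('a set \<times> 'a multiset) set" where
  "top_monomials i = {(G, a). G \<in> \<Delta> \<and> card G = n \<and> set_mset a \<subseteq> G \<and> size a = i}"

definition face_monomials :: "nat \<Rightarrow> 'a multiset set" where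
  "face_monomials i = {a. set_mset a \<in> \<Delta> \<and> size a = i}"

lemma finite_face_monomials: "finite (face_monomials i)"
proof (rule finite_subset)
  show "face_monomials i \<subseteq> multisets_of_size (\<Union>\<Delta>) i"
    by (auto simp: face_monomials_def multisets_of_size_def)
  show "finite (multisets_of_size (\<Union>\<Delta>) i)"
    using down_closedD(4)[OF complex] by (rule finite_multisets_of_size)
qed

lemma finite_top_monomials: "finite (top_monomials i)"
proof (rule finite_subset)
  show "top_monomials i \<subseteq> \<Delta> \<times> face_monomials i"
    using down_closedD(3)[OF complex] by (auto simp: top_monomials_def face_monomials_def)
  show "finite (\<Delta> \<times> face_monomials i)"
    using down_closedD(1)[OF complex] finite_face_monomials by simp
qed

lemma degree_part_functions: "x \<in> face_functions n \<Longrightarrow> degree_part i x \<in> functions_on (top_monomials i)"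
  unfolding functions_on_def
proof (rule CollectI, intro allI impI)
  fix j assume x: "x \<in> face_functions n" and j: "degree_part i x j \<noteq> 0"
  obtain G a where [simp]: "j = (G, a)" by (cases j)
  have "x (G, a) \<noteq> 0" "size a = i" using j by (auto simp: degree_part_def split: if_splits)
  then show "j \<in> top_monomials i" using face_functionsD[OF x, of G a] by (simp add: top_monomials_def)
qed

lemma degree_part_id: "x \<in> functions_on (top_monomials i) \<Longrightarrow> degree_part i x = x"
  unfolding degree_part_def functions_on_def top_monomials_def by (rule ext) (clarsimp, metis)

lemma functions_on_top_monomials: "functions_on (top_monomials i) \<subseteq> face_functions n"
  unfolding face_functions_def top_monomials_def functions_on_def by blast

lemma parameter_degree_part:
  "parameter s (degree_part (Suc i) x) = degree_part i (parameter s x)"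
  by (rule ext, clarify) (simp add: parameter_def degree_part_def contract_def)

lemma parameter_degree_zero: "parameter s (degree_part 0 x) = 0"
  by (rule ext, clarify) (simp add: parameter_def degree_part_def contract_def)

lemma linear_parameter: "Vector_Spaces.linear fscale fscale (parameter s)"
proof (rule linear_fscaleI)
  fix x y :: "'a set \<times> 'a multiset \<Rightarrow> 'f" and r
  show "parameter s (\<lambda>i. x i + y i) = (\<lambda>j. parameter s x j + parameter s y j)"
    by (rule ext, clarify) (simp add: parameter_def contract_def sum.distrib distrib_left)
  show "parameter s (\<lambda>i. r * x i) = (\<lambda>j. r * parameter s x j)"
    by (rule ext, clarify) (simp add: parameter_def contract_def sum_distrib_left mult.left_commute)
qed

text \<open>The map \<pi> realises the cokernel of the last differential: for each monomial whose
  support is a face, the value is the pairing with the fundamental cycle of the star of that face.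
  Hence the cokernel has in degree i one coordinate per face monomial of degree i, as does the face
  ring.\<close>

lemma top_functional:
  assumes n: "n = Suc p"
  shows "\<exists>\<pi> :: ('a set \<times> 'a multiset \<Rightarrow> 'f) \<Rightarrow> 'a multiset \<Rightarrow> 'f. Vector_Spaces.linear fscale fscale \<pi> \<and>
    (\<forall>x\<in>face_functions n. \<pi> x = 0 \<longleftrightarrow> x \<in> differential ` face_functions p) \<and>
    (\<forall>i. \<pi> ` functions_on (top_monomials i) = functions_on (face_monomials i)) \<and>
    (\<forall>x i. \<pi> (degree_part i x) = (\<lambda>a. if size a = i then \<pi> x a else 0))"
proof -
  have "\<forall>\<sigma>. \<exists>z :: 'a set \<Rightarrow> 'f. \<sigma> \<in> \<Delta> \<longrightarrow> (\<forall>G. z G \<noteq> 0 \<longrightarrow> G \<in> \<Delta> \<and> \<sigma> \<subseteq> G \<and> card G = n) \<and> (\<exists>G. z G \<noteq> 0) \<and>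
     (\<forall>x. (\<Sum>G\<in>\<Delta>. z G * x G) = 0 \<longleftrightarrow>
       (\<exists>y. (\<forall>G. y G \<noteq> 0 \<longrightarrow> G \<in> \<Delta> \<and> \<sigma> \<subseteq> G \<and> card G = p) \<and>
         (\<forall>G\<in>\<Delta>. \<sigma> \<subseteq> G \<longrightarrow> card G = Suc p \<longrightarrow> x G = relative_coboundary \<sigma> y G)))"
    using star_top[OF _ n] by (subst ex_simps(6)) (intro allI impI)
  from choice[OF this] obtain z :: "'a set \<Rightarrow> 'a set \<Rightarrow> 'f" where "\<forall>\<sigma>. \<sigma> \<in> \<Delta> \<longrightarrow> (\<forall>G. z \<sigma> G \<noteq> 0 \<longrightarrow> G \<in> \<Delta> \<and> \<sigma> \<subseteq> G \<and> card G = n) \<and> (\<exists>G. z \<sigma> G \<noteq> 0) \<and>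
     (\<forall>x. (\<Sum>G\<in>\<Delta>. z \<sigma> G * x G) = 0 \<longleftrightarrow>
       (\<exists>y. (\<forall>G. y G \<noteq> 0 \<longrightarrow> G \<in> \<Delta> \<and> \<sigma> \<subseteq> G \<and> card G = p) \<and>
         (\<forall>G\<in>\<Delta>. \<sigma> \<subseteq> G \<longrightarrow> card G = Suc p \<longrightarrow> x G = relative_coboundary \<sigma> y G)))" ..
  note zz = this[rule_format]
  have z1: "\<And>\<sigma> G. \<sigma> \<in> \<Delta> \<Longrightarrow> z \<sigma> G \<noteq> 0 \<Longrightarrow> G \<in> \<Delta> \<and> \<sigma> \<subseteq> G \<and> card G = n"
    using zz[THEN conjunct1] by blast
  have z2: "\<And>\<sigma>. \<sigma> \<in> \<Delta> \<Longrightarrow> \<exists>G. z \<sigma> G \<noteq> 0"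
    using zz by blast
  have z3: "\<And>\<sigma> x. \<sigma> \<in> \<Delta> \<Longrightarrow> (\<Sum>G\<in>\<Delta>. z \<sigma> G * x G) = 0 \<longleftrightarrow>
       (\<exists>y. (\<forall>G. y G \<noteq> 0 \<longrightarrow> G \<in> \<Delta> \<and> \<sigma> \<subseteq> G \<and> card G = p) \<and>
         (\<forall>G\<in>\<Delta>. \<sigma> \<subseteq> G \<longrightarrow> card G = Suc p \<longrightarrow> x G = relative_coboundary \<sigma> y G))"
    using zz[THEN conjunct2, THEN conjunct2] by blast
  define \<pi> where "\<pi> = (\<lambda>x a. if set_mset a \<in> \<Delta> then \<Sum>G\<in>\<Delta>. z (set_mset a) G * x (G, a) else 0)"
  have lin: "Vector_Spaces.linear fscale fscale \<pi>"
    by (rule linear_fscaleI)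
      (simp_all add: \<pi>_def fun_eq_iff distrib_left sum.distrib sum_distrib_left mult.left_commute)
  have deg: "\<pi> (degree_part i x) = (\<lambda>a. if size a = i then \<pi> x a else 0)" for x i
    by (rule ext) (simp add: \<pi>_def degree_part_def)
  have ker: "\<pi> x = 0 \<longleftrightarrow> x \<in> differential ` face_functions p" if x: "x \<in> face_functions n" for x
  proof
    assume 0: "\<pi> x = 0"
    show "x \<in> differential ` face_functions p"
    proof (rule differential_imageI)
      show "x \<in> face_functions (Suc p)" using x n by simp
      fix a :: "'a multiset" assume a: "set_mset a \<in> \<Delta>"
      have "(\<Sum>G\<in>\<Delta>. z (set_mset a) G * x (G, a)) = 0"
        using fun_cong[OF 0, of a] a by (simp add: \<pi>_def)
      then show "\<exists>y. (\<forall>G. y G \<noteq> 0 \<longrightarrow> G \<in> \<Delta> \<and> set_mset a \<subseteq> G \<and> card G = p) \<and>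
          (\<forall>G\<in>\<Delta>. set_mset a \<subseteq> G \<longrightarrow> card G = Suc p \<longrightarrow> x (G, a) = relative_coboundary (set_mset a) y G)"
        by (rule z3[OF a, THEN iffD1])
    qed
  next
    assume "x \<in> differential ` face_functions p"
    then obtain y where y: "y \<in> face_functions p" "x = differential y" by blast
    show "\<pi> x = 0"
    proof
      fix a
      have "(\<Sum>G\<in>\<Delta>. z (set_mset a) G * x (G, a)) = 0" if a: "set_mset a \<in> \<Delta>"
      proof (rule z3[OF a, THEN iffD2], intro exI conjI allI impI ballI)
        fix G assume "y (G, a) \<noteq> 0"
        then show "G \<in> \<Delta>" "set_mset a \<subseteq> G" "card G = p" using face_functionsD[OF y(1)] by blast+
      next
        fix G assume "G \<in> \<Delta>" "set_mset a \<subseteq> G"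
        then show "x (G, a) = relative_coboundary (set_mset a) (\<lambda>G. y (G, a)) G"
          by (simp add: y(2) differential_def)
      qed
      then show "\<pi> x a = 0 a" by (simp add: \<pi>_def)
    qed
  qed
  have im: "\<pi> ` functions_on (top_monomials i) = functions_on (face_monomials i)" for i
  proof (intro equalityI subsetI)
    fix f assume "f \<in> \<pi> ` functions_on (top_monomials i)"
    then obtain x where x: "x \<in> functions_on (top_monomials i)" "f = \<pi> x" by blast
    have "a \<in> face_monomials i" if "f a \<noteq> 0" for a
    proof -
      have "set_mset a \<in> \<Delta>" using that by (auto simp: x(2) \<pi>_def split: if_splits)
      moreover have "f a = (if size a = i then \<pi> x a else 0)"
        using fun_cong[OF deg[of i x], of a] degree_part_id[OF x(1)] x(2) by simp
      ultimately show ?thesis using that by (auto simp: face_monomials_def split: if_splits)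
    qed
    then show "f \<in> functions_on (face_monomials i)" unfolding functions_on_def by blast
  next
    fix f :: "'a multiset \<Rightarrow> 'f" assume f: "f \<in> functions_on (face_monomials i)"
    have "\<forall>\<sigma>. \<exists>G. \<sigma> \<in> \<Delta> \<longrightarrow> z \<sigma> G \<noteq> 0" using z2 by blast
    from choice[OF this] obtain g where g: "\<forall>\<sigma>. \<sigma> \<in> \<Delta> \<longrightarrow> z \<sigma> (g \<sigma>) \<noteq> 0" ..
    \<comment> \<open>A preimage of \<open>f\<close> puts the whole value at \<open>a\<close> on one
      facet where the fundamental cycle is nonzero.\<close>
    define x where "x = (\<lambda>(G, a). if a \<in> face_monomials i \<and> G = g (set_mset a) then f a / z (set_mset a) G else 0)"
    have "x \<in> functions_on (top_monomials i)"
      unfolding functions_on_def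
    proof (rule CollectI, intro allI impI)
      fix j assume j: "x j \<noteq> 0"
      obtain G a where [simp]: "j = (G, a)" by (cases j)
      have a: "a \<in> face_monomials i" "G = g (set_mset a)" using j by (auto simp: x_def split: if_splits)
      then have "set_mset a \<in> \<Delta>" by (simp add: face_monomials_def)
      then have "G \<in> \<Delta> \<and> set_mset a \<subseteq> G \<and> card G = n" using g a(2) by (intro z1) auto
      then show "j \<in> top_monomials i" using a(1) by (simp add: top_monomials_def face_monomials_def)
    qed
    moreover have "\<pi> x = f"
    proof
      fix a
      show "\<pi> x a = f a"
      proof (cases "a \<in> face_monomials i")
        case True
        then have a: "set_mset a \<in> \<Delta>" by (simp add: face_monomials_def)
        have nz: "z (set_mset a) (g (set_mset a)) \<noteq> 0" using g a by blast
        have "\<pi> x a = (\<Sum>G\<in>\<Delta>. if G = g (set_mset a) then f a else 0)"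
          using a True nz unfolding \<pi>_def x_def by (auto intro!: sum.cong)
        also have "\<dots> = f a" using z1[OF a nz] down_closedD(1)[OF complex] by simp
        finally show ?thesis .
      next
        case False
        then have "f a = 0" using f by (auto simp: functions_on_def)
        then show ?thesis using False by (simp add: \<pi>_def x_def)
      qed
    qed
    ultimately show "f \<in> \<pi> ` functions_on (top_monomials i)" by blast
  qed
  show ?thesis using lin ker im deg by (intro exI[of _ \<pi>]) blast
qed

text \<open>\<open>u m i\<close> is the dimension, in degree i, of the common kernel of the first m
  operators on the cokernel. The next operator lowers degree by one and maps this kernel onto itself
  by \<open>solvable_cokernel\<close>, so rank and nullity give the recurrence, which says that
  generating functions are multiplied by 1 - X.\<close>

lemma hilbert_function:
  assumes n: "n = Suc p"
  shows "\<exists>u :: nat \<Rightarrow> nat \<Rightarrow> nat. (\<forall>i. u 0 i = card (face_monomials i)) \<and>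
    (\<forall>m<n. u (Suc m) 0 = u m 0 \<and> (\<forall>i. u m (Suc i) = u (Suc m) (Suc i) + u m i))"
proof -
  obtain \<pi> :: "('a set \<times> 'a multiset \<Rightarrow> 'f) \<Rightarrow> 'a multiset \<Rightarrow> 'f" where
    lin: "Vector_Spaces.linear fscale fscale \<pi>"
    and ker: "\<And>x. x \<in> face_functions n \<Longrightarrow> \<pi> x = 0 \<longleftrightarrow> x \<in> differential ` face_functions p"
    and im: "\<And>i. \<pi> ` functions_on (top_monomials i) = functions_on (face_monomials i)"
    and deg: "\<And>x i. \<pi> (degree_part i x) = (\<lambda>a. if size a = i then \<pi> x a else 0)"
    using top_functional[OF n] by (elim exE conjE) (rule that, blast+)
  \<comment> \<open>\<open>Y m i\<close> collects the representatives in degree \<open>i\<close>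
    whose classes are killed by the first \<open>m\<close> operators; its image under \<pi> is the
    kernel on the cokernel.\<close>
  define Y where "Y = (\<lambda>m i. {x \<in> functions_on (top_monomials i). \<forall>s<m. \<pi> (parameter s x) = 0})"
  define u where "u = (\<lambda>m i. fs.dim (\<pi> ` Y m i))"
  have X: "x \<in> face_functions n" if "x \<in> functions_on (top_monomials i)" for x i
    using functions_on_top_monomials that by blast
  have par_ker: "\<pi> (parameter s x) = 0" if x: "x \<in> face_functions n" "\<pi> x = 0" for s x
  proof -
    obtain y where y: "y \<in> face_functions p" "x = differential y" using ker[OF x(1)] x(2) by blast
    have "parameter s x = differential (parameter s y)" using y by (simp add: d_th)
    then have "parameter s x \<in> differential ` face_functions p" using th_X[OF y(1)] by blast
    then show ?thesis using ker[OF th_X[OF x(1)]] by blast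
  qed
  have lin_par: "Vector_Spaces.linear fscale fscale (\<lambda>x. \<pi> (parameter s x))" for s
    using Vector_Spaces.linear_compose[OF linear_parameter lin, of s] by (simp add: o_def)
  have subY: "fs.subspace (Y m i)" for m i
  proof -
    have "Y m i = functions_on (top_monomials i) \<inter> (\<Inter>s\<in>{..<m}. {x. \<pi> (parameter s x) = 0})"
      by (auto simp: Y_def)
    moreover have "fs.subspace (\<Inter>s\<in>{..<m}. {x. \<pi> (parameter s x) = 0})"
      by (rule fs.subspace_Inter) (auto intro: fs2.linear_subspace_kernel[OF lin_par])
    ultimately show ?thesis using fs.subspace_inter[OF subspace_functions_on] by simp
  qed
  have par_deg: "parameter s x = degree_part i (parameter s x)"
    if "x \<in> functions_on (top_monomials (Suc i))" for s x i
    using parameter_degree_part[of s i x] degree_part_id[OF that] by simp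
  have Yn: "Y m i \<subseteq> functions_on (top_monomials i)" for m i by (auto simp: Y_def)
  \<comment> \<open>The kernel of \<pi> lies in every \<open>Y m i\<close>, so its dimension is the
    same for all \<open>m\<close> and cancels when the recurrence is derived.\<close>
  have kernel_dim: "fs.dim (Y m i) = u m i + fs.dim {x \<in> functions_on (top_monomials i). \<pi> x = 0}" for m i
  proof -
    have "{x \<in> Y m i. \<pi> x = 0} = {x \<in> functions_on (top_monomials i). \<pi> x = 0}"
      using par_ker X by (auto simp: Y_def)
    then show ?thesis
      using rank_nullity_functions[OF lin subY Yn finite_top_monomials, of m i] by (simp add: u_def)
  qed
  have image: "(\<lambda>x. \<pi> (parameter m x)) ` Y m (Suc i) = \<pi> ` Y m i" if m: "m < n" for m i
  proof (intro equalityI subsetI)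
    fix f assume "f \<in> (\<lambda>x. \<pi> (parameter m x)) ` Y m (Suc i)"
    then obtain x where x: "x \<in> Y m (Suc i)" "f = \<pi> (parameter m x)" by blast
    have xX: "x \<in> functions_on (top_monomials (Suc i))" using x(1) by (simp add: Y_def)
    have "parameter m x \<in> functions_on (top_monomials i)"
      by (subst par_deg[OF xX]) (rule degree_part_functions[OF th_X[OF X[OF xX]]])
    moreover have "\<pi> (parameter s (parameter m x)) = 0" if "s < m" for s
    proof -
      have "\<pi> (parameter s x) = 0" using x(1) that by (simp add: Y_def)
      then have "\<pi> (parameter m (parameter s x)) = 0" using th_X[OF X[OF xX]] par_ker by blast
      then show ?thesis by (subst th_th)
    qed
    ultimately show "f \<in> \<pi> ` Y m i" using x(2) by (auto simp: Y_def)
  next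
    fix f assume "f \<in> \<pi> ` Y m i"
    then obtain y where y: "y \<in> functions_on (top_monomials i)" "\<And>s. s < m \<Longrightarrow> \<pi> (parameter s y) = 0" "f = \<pi> y"
      by (auto simp: Y_def)
    have yX: "y \<in> face_functions (Suc p)" using X[OF y(1)] n by simp
    have "parameter s y \<in> differential ` face_functions p" if "s < m" for s
      using y(2)[OF that] ker[OF th_X[OF X[OF y(1)]], of s] by simp
    from solvable_cokernel[OF yX n, of m] this m n obtain x where
      x: "x \<in> face_functions n" "\<forall>s<m. parameter s x = 0" "y - parameter m x \<in> differential ` face_functions p"
      by auto
    \<comment> \<open>The solution found need not be homogeneous; since \<pi> and the operators
      respect degrees, its part of degree \<open>Suc i\<close> is again a solution.\<close>
    define x' where "x' = degree_part (Suc i) x"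
    have "y - parameter m x \<in> face_functions n"
      using X[OF y(1)] th_X[OF x(1)] X_diff by blast
    then have "\<pi> (y - parameter m x) = 0" using x(3) ker by blast
    then have eq: "\<pi> (parameter m x) = \<pi> y" by (simp add: fs2.linear_diff[OF lin])
    have "x' \<in> functions_on (top_monomials (Suc i))"
      unfolding x'_def by (rule degree_part_functions[OF x(1)])
    moreover have "\<pi> (parameter s x') = 0" if "s < m" for s
    proof -
      have "parameter s x' = degree_part i (parameter s x)"
        unfolding x'_def by (rule parameter_degree_part)
      also have "\<dots> = 0" using x(2) that by (simp add: degree_part_def fun_eq_iff)
      finally show ?thesis by (simp add: fs2.linear_0[OF lin])
    qed
    ultimately have "x' \<in> Y m (Suc i)" by (simp add: Y_def)
    moreover have "\<pi> (parameter m x') = f"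
    proof -
      have "\<pi> (parameter m x') = \<pi> (degree_part i (parameter m x))"
        unfolding x'_def by (simp add: parameter_degree_part)
      also have "\<dots> = \<pi> (degree_part i y)" unfolding deg eq ..
      also have "\<dots> = f" using degree_part_id[OF y(1)] y(3) by simp
      finally show ?thesis .
    qed
    ultimately show "f \<in> (\<lambda>x. \<pi> (parameter m x)) ` Y m (Suc i)" by blast
  qed
  have "u m (Suc i) = u (Suc m) (Suc i) + u m i" if m: "m < n" for m i
  proof -
    have "{x \<in> Y m (Suc i). \<pi> (parameter m x) = 0} = Y (Suc m) (Suc i)"
      by (auto simp: Y_def less_Suc_eq)
    then have "fs.dim (Y m (Suc i)) = u m i + fs.dim (Y (Suc m) (Suc i))"
      using rank_nullity_functions[OF lin_par subY Yn finite_top_monomials, of m "Suc i" m] image[OF m]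
      by (simp add: u_def)
    then show ?thesis using kernel_dim[of m "Suc i"] kernel_dim[of "Suc m" "Suc i"] by simp
  qed
  moreover have "u (Suc m) 0 = u m 0" for m
  proof -
    have "\<pi> (parameter s x) = 0" if "x \<in> functions_on (top_monomials 0)" for s x
      using parameter_degree_zero[of s x] degree_part_id[OF that] fs2.linear_0[OF lin] by simp
    then have "Y (Suc m) 0 = Y m 0" by (auto simp: Y_def)
    then show ?thesis by (simp add: u_def)
  qed
  moreover have "u 0 i = card (face_monomials i)" for i
    using im dim_functions_on[OF finite_face_monomials] by (simp add: u_def Y_def)
  ultimately show ?thesis by (intro exI[of _ u]) blast
qed

end

section \<open>The h-polynomial, its Hilbert series and its nonnegativity\<close>

definition h_poly :: "nat \<Rightarrow> 'a set set \<Rightarrow> int poly" where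
  "h_poly n \<Delta> = (\<Sum>F\<in>\<Delta>. [:0, 1:] ^ card F * [:1, - 1:] ^ (n - card F))"

lemma finite_multisets_with_support: "finite F \<Longrightarrow> finite {a. set_mset a = F \<and> size a = i}"
  by (rule finite_subset[OF _ finite_multisets_of_size[of F i]]) (auto simp: multisets_of_size_def)

lemma card_multisets_with_support:
  assumes "finite F" "v \<notin> F"
  shows "card {a. set_mset a = insert v F \<and> size a = Suc i} =
    card {a. set_mset a = insert v F \<and> size a = i} + card {a. set_mset a = F \<and> size a = i}"
proof -
  have "{a. set_mset a = insert v F \<and> size a = Suc i} =
    add_mset v ` ({a. set_mset a = insert v F \<and> size a = i} \<union> {a. set_mset a = F \<and> size a = i})"
  proof (intro equalityI subsetI)
    fix a assume a: "a \<in> {a. set_mset a = insert v F \<and> size a = Suc i}"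
    then have "v \<in># a" by auto
    from multi_member_split[OF this] obtain b where b: "a = add_mset v b" ..
    have "insert v (set_mset b) = insert v F" "size b = i" using a b by auto
    then have "set_mset b = insert v F \<or> set_mset b = F"
      using assms(2) by (cases "v \<in># b") (auto simp: insert_absorb)
    then show "a \<in> add_mset v ` ({a. set_mset a = insert v F \<and> size a = i} \<union> {a. set_mset a = F \<and> size a = i})"
      using b \<open>size b = i\<close> by simp
  next
    fix a assume "a \<in> add_mset v ` ({a. set_mset a = insert v F \<and> size a = i} \<union> {a. set_mset a = F \<and> size a = i})"
    then obtain b where "a = add_mset v b" "set_mset b = insert v F \<or> set_mset b = F" "size b = i" by blast
    then show "a \<in> {a. set_mset a = insert v F \<and> size a = Suc i}" by auto
  qed
  then have "card {a. set_mset a = insert v F \<and> size a = Suc i} =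
      card ({a. set_mset a = insert v F \<and> size a = i} \<union> {a. set_mset a = F \<and> size a = i})"
    by (simp add: card_image inj_on_def)
  also have "\<dots> = card {a. set_mset a = insert v F \<and> size a = i} + card {a. set_mset a = F \<and> size a = i}"
    using assms by (intro card_Un_disjoint finite_multisets_with_support) auto
  finally show ?thesis .
qed

text \<open>Monomials with support exactly F have the generating function (X / (1 - X))^|F|. Adding
  a vertex v to F multiplies it by X / (1 - X), because removing one copy of v leaves either
  support.\<close>

lemma fps_multisets_with_support:
  assumes "finite F"
  shows "(1 - fps_X) ^ card F * Abs_fps (\<lambda>i. int (card {a. set_mset a = F \<and> size a = i})) = fps_X ^ card F"
  using assms
proof (induction F rule: finite_induct)
  case empty
  have "{a :: 'a multiset. set_mset a = {} \<and> size a = i} = (if i = 0 then {{#}} else {})" for i by auto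
  then show ?case by (simp add: fps_eq_iff)
next
  case (insert v F)
  let ?N = "\<lambda>F. Abs_fps (\<lambda>i. int (card {a :: 'a multiset. set_mset a = F \<and> size a = i}))"
  have "(1 - fps_X) * ?N (insert v F) = fps_X * ?N F"
  proof (rule fps_ext)
    fix i
    show "fps_nth ((1 - fps_X) * ?N (insert v F)) i = fps_nth (fps_X * ?N F) i"
    proof (cases i)
      case 0
      have "{a. set_mset a = insert v F \<and> size a = 0} = {}" by auto
      then show ?thesis using 0 by (simp add: left_diff_distrib)
    next
      case (Suc j)
      then show ?thesis using card_multisets_with_support[OF insert(1,2), of j] by (simp add: left_diff_distrib)
    qed
  qed
  then have "(1 - fps_X) ^ card (insert v F) * ?N (insert v F) = fps_X * ((1 - fps_X) ^ card F * ?N F)"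
    using insert(1,2) by (simp add: ac_simps)
  then show ?case using insert by simp
qed

lemma h_poly_hilbert_series:
  assumes "finite \<Delta>" "\<And>F. F \<in> \<Delta> \<Longrightarrow> finite F \<and> card F \<le> n"
  shows "(1 - fps_X) ^ n * Abs_fps (\<lambda>i. int (card {a. set_mset a \<in> \<Delta> \<and> size a = i})) = fps_of_poly (h_poly n \<Delta>)"
proof -
  let ?N = "\<lambda>F. Abs_fps (\<lambda>i. int (card {a :: 'a multiset. set_mset a = F \<and> size a = i}))"
  have "Abs_fps (\<lambda>i. int (card {a. set_mset a \<in> \<Delta> \<and> size a = i})) = (\<Sum>F\<in>\<Delta>. ?N F)"
  proof (rule fps_ext)
    fix i
    have "{a. set_mset a \<in> \<Delta> \<and> size a = i} = (\<Union>F\<in>\<Delta>. {a. set_mset a = F \<and> size a = i})" by auto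
    also have "card \<dots> = (\<Sum>F\<in>\<Delta>. card {a. set_mset a = F \<and> size a = i})"
      using assms by (intro card_UN_disjoint) (auto intro: finite_multisets_with_support)
    finally show "fps_nth (Abs_fps (\<lambda>i. int (card {a. set_mset a \<in> \<Delta> \<and> size a = i}))) i = fps_nth (\<Sum>F\<in>\<Delta>. ?N F) i"
      by (simp add: fps_sum_nth)
  qed
  then have "(1 - fps_X) ^ n * Abs_fps (\<lambda>i. int (card {a. set_mset a \<in> \<Delta> \<and> size a = i})) =
      (\<Sum>F\<in>\<Delta>. (1 - fps_X) ^ n * ?N F)" by (simp add: sum_distrib_left)
  also have "\<dots> = (\<Sum>F\<in>\<Delta>. (1 - fps_X) ^ (n - card F) * ((1 - fps_X) ^ card F * ?N F))"
    using assms(2) by (intro sum.cong refl) (simp add: mult.assoc[symmetric] power_add[symmetric])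
  also have "\<dots> = (\<Sum>F\<in>\<Delta>. (1 - fps_X) ^ (n - card F) * fps_X ^ card F)"
    using assms(2) by (intro sum.cong refl) (simp add: fps_multisets_with_support)
  also have "\<dots> = fps_of_poly (h_poly n \<Delta>)"
  proof -
    have "fps_of_poly [:1, - 1:] = (1 - fps_X :: int fps)"
      by (rule fps_ext) (simp add: coeff_pCons fps_X_def split: nat.split)
    then show ?thesis
      unfolding h_poly_def fps_of_poly_sum fps_of_poly_mult fps_of_poly_power
      by (intro sum.cong refl) (simp only: mult.commute fps_of_poly_fps_X)
  qed
  finally show ?thesis .
qed

context sphere_like_complex_parameters
begin

text \<open>The n steps of the recurrence multiply the Hilbert series of the face ring by (1 - X)^n.
  The result is the h-polynomial, and its coefficients are the dimensions
  \<open>u n i\<close>.\<close>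

lemma h_poly_nonneg: "coeff (h_poly n \<Delta>) i \<ge> 0"
proof (cases n)
  case 0
  then show ?thesis using card_le by (simp add: h_poly_def of_nat_poly coeff_pCons split: nat.split)
next
  case (Suc p)
  obtain u :: "nat \<Rightarrow> nat \<Rightarrow> nat" where u: "\<And>i. u 0 i = card (face_monomials i)"
    "\<And>m. m < n \<Longrightarrow> u (Suc m) 0 = u m 0" "\<And>m i. m < n \<Longrightarrow> u m (Suc i) = u (Suc m) (Suc i) + u m i"
    using hilbert_function[OF Suc] by blast
  have "Abs_fps (\<lambda>i. int (u m i)) = (1 - fps_X) ^ m * Abs_fps (\<lambda>i. int (u 0 i))" if "m \<le> n" for m
    using that
  proof (induction m)
    case (Suc m)
    have "Abs_fps (\<lambda>i. int (u (Suc m) i)) = (1 - fps_X) * Abs_fps (\<lambda>i. int (u m i))"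
    proof (rule fps_ext)
      fix i
      show "fps_nth (Abs_fps (\<lambda>i. int (u (Suc m) i))) i = fps_nth ((1 - fps_X) * Abs_fps (\<lambda>i. int (u m i))) i"
        using u(2,3)[of m] Suc.prems by (cases i) (simp_all add: left_diff_distrib)
    qed
    then show ?case using Suc by (simp add: mult.assoc)
  qed simp
  from this[of n] have "Abs_fps (\<lambda>i. int (u n i)) = fps_of_poly (h_poly n \<Delta>)"
    using h_poly_hilbert_series[of \<Delta> n] down_closedD(1,2)[OF complex] card_le
    by (simp add: u(1) face_monomials_def)
  then have "coeff (h_poly n \<Delta>) i = int (u n i)"
    by (metis fps_nth_Abs_fps fps_of_poly_nth)
  then show ?thesis by simp
qed

end

section \<open>Euler characteristics and the symmetry of the h-polynomial\<close>

context sphere_like_complex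
begin

text \<open>Euler-Poincare: the alternating sums of the chain groups and of the homology agree, and
  the homology is a single line in the top degree. The index \<open>k\<close> is the cardinality of
  faces, so it corresponds to homological degree k - 1.\<close>

lemma euler_link:
  assumes \<sigma>: "\<sigma> \<in> \<Delta>"
  shows "(\<Sum>H\<in>link \<Delta> \<sigma>. (- 1) ^ card H) = ((- 1) ^ (n - card \<sigma>) :: int)"
proof -
  let ?L = "link \<Delta> \<sigma>" and ?d = "int n - 1 - int (card \<sigma>)"
  define C where "C = (\<lambda>k. chain_group ?L (int k - 1) :: ('a set \<Rightarrow> 'f) set)"
  define Z where "Z = (\<lambda>k. int (fs.dim (cycles ?L (int k - 1) :: ('a set \<Rightarrow> 'f) set)))"
  define B where "B = (\<lambda>k. int (fs.dim (boundaries ?L (int k - 1) :: ('a set \<Rightarrow> 'f) set)))"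
  define c where "c = (\<lambda>k. int (card {H \<in> ?L. card H = k}))"
  have L: "down_closed ?L" using complex by (rule down_closed_link)
  have C_fun: "C k = functions_on {H \<in> ?L. card H = k}" for k
    by (auto simp: C_def chain_group_def functions_on_def face_dim_def)
  have fin: "finite {H \<in> ?L. card H = k}" for k using down_closedD(1)[OF L] by simp
  have card_L: "card H \<le> n - card \<sigma>" if "H \<in> ?L" for H
    using card_star[OF \<sigma> that] card_le[of "\<sigma> \<union> H"] mem_link[OF \<sigma>, of H] that by simp
  have dimC: "int (fs.dim (C k)) = c k" for k
    unfolding C_fun c_def using dim_functions_on[OF fin] by simp
  have rn: "fs.dim (C k) = fs.dim (boundary ?L ` C k) + fs.dim {x \<in> C k. boundary ?L x = 0}" for k
    by (rule rank_nullity_functions[OF linear_boundary _ _ fin[of k]]) (simp_all add: C_fun subspace_functions_on)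
  have cyc: "{x \<in> C k. boundary ?L x = 0} = cycles ?L (int k - 1)" for k
    by (auto simp: C_def cycles_def zero_fun_def)
  have c0: "c 0 = Z 0"
  proof -
    have "boundary ?L x = 0" if "x \<in> C 0" for x
    proof
      fix G
      have "x (insert v G) = 0" for v
      proof (rule ccontr)
        assume "x (insert v G) \<noteq> 0"
        then have "insert v G \<in> ?L" "card (insert v G) = 0" using that by (auto simp: C_fun functions_on_def)
        then show False using down_closedD(2)[OF L] by (metis card_0_eq insert_not_empty)
      qed
      then show "boundary ?L x G = 0 G" by (simp add: boundary_def)
    qed
    then have "{x \<in> C 0. boundary ?L x = 0} = C 0" by auto
    then show ?thesis using cyc[of 0] dimC[of 0] by (simp add: Z_def)
  qed
  have cS: "c (Suc k) = B k + Z (Suc k)" for k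
  proof -
    have "boundary ?L ` C (Suc k) = boundaries ?L (int k - 1)"
      by (simp add: boundaries_def C_def)
    then show ?thesis using rn[of "Suc k"] cyc[of "Suc k"] dimC[of "Suc k"] by (simp add: B_def Z_def)
  qed
  have ZB: "Z k = B k" if "int k - 1 \<noteq> ?d" for k
    using has_homology_of_sphereD(1)[OF link_homology[OF \<sigma>] that] by (simp add: Z_def B_def)
  define D where "D = n - card \<sigma>"
  have D: "int D - 1 = ?d" using card_le[OF \<sigma>] by (simp add: D_def)
  have empty: "C (Suc D) = {0}"
    using card_L by (auto simp: C_fun functions_on_def D_def fun_eq_iff) (metis Suc_n_not_le_n)
  then have "boundaries ?L (int D - 1) = {0 :: 'a set \<Rightarrow> 'f}"
    using fs2.linear_0[OF linear_boundary] by (simp add: boundaries_def C_def)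
  moreover have "fs.dim {0 :: 'a set \<Rightarrow> 'f} = 0"
  proof -
    have "fs.dim ({} :: ('a set \<Rightarrow> 'f) set) = 0"
      using fs.dim_eq_card_independent[OF fs.independent_empty] by simp
    then show ?thesis using fs.dim_span[of "{} :: ('a set \<Rightarrow> 'f) set"] by simp
  qed
  ultimately have BD: "B D = 0" by (simp add: B_def)
  have ZD: "Z D = 1"
  proof -
    obtain z :: "'a set \<Rightarrow> 'f" where z: "z \<in> cycles ?L ?d" "\<exists>H. z H \<noteq> 0"
      "\<And>c. c \<in> cycles ?L ?d \<Longrightarrow> \<exists>r. c = (\<lambda>F. r * z F)"
      using fundamental_cycle[OF \<sigma>] by blast
    have "z \<noteq> 0" using z(2) by auto
    then have "fs.independent {z}" by simp
    moreover have "cycles ?L ?d \<subseteq> fs.span {z}"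
    proof
      fix c :: "'a set \<Rightarrow> 'f" assume "c \<in> cycles ?L ?d"
      then obtain r where "c = fscale r z" using z(3) by (auto simp: fscale_def)
      then show "c \<in> fs.span {z}" by (simp add: fs.span_base fs.span_scale)
    qed
    ultimately have "fs.dim (cycles ?L ?d :: ('a set \<Rightarrow> 'f) set) = 1"
      using fs.basis_card_eq_dim[of "{z}" "cycles ?L ?d"] z(1) by simp
    then show ?thesis by (simp add: Z_def D)
  qed
  \<comment> \<open>Each boundary group occurs once in its own degree and once in the degree above
    with opposite sign; only the last one is left over.\<close>
  have tele: "(\<Sum>k\<le>m. (- 1) ^ k * c k) = (\<Sum>k\<le>m. (- 1) ^ k * (Z k - B k)) + (- 1) ^ m * B m" for m
    by (induction m) (simp_all add: c0 cS algebra_simps)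
  have "(\<Sum>H\<in>?L. (- 1) ^ card H) = (\<Sum>k\<le>D. (- 1) ^ k * c k)"
  proof -
    have "(\<Sum>k\<le>D. (- 1) ^ k * c k) = (\<Sum>k\<le>D. \<Sum>H\<in>{H \<in> ?L. card H = k}. (- 1) ^ card H)"
      by (simp add: c_def mult.commute)
    also have "\<dots> = (\<Sum>H\<in>?L. (- 1) ^ card H)"
      using down_closedD(1)[OF L] card_L by (intro sum.group) (auto simp: D_def)
    finally show ?thesis by simp
  qed
  also have "\<dots> = (\<Sum>k\<le>D. if k = D then (- 1) ^ k else 0)"
  proof -
    have "(- 1) ^ k * (Z k - B k) = (if k = D then (- 1) ^ k else 0)" for k
      using ZB[of k] ZD BD D by auto
    then show ?thesis unfolding tele BD by simp
  qed
  finally show ?thesis by (simp add: D_def)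
qed

lemma euler_star:
  assumes \<sigma>: "\<sigma> \<in> \<Delta>"
  shows "(\<Sum>G\<in>{G \<in> \<Delta>. \<sigma> \<subseteq> G}. (- 1) ^ (n - card G)) = (1 :: int)"
proof -
  have "(\<Sum>G\<in>{G \<in> \<Delta>. \<sigma> \<subseteq> G}. (- 1) ^ (n - card G)) = (\<Sum>H\<in>link \<Delta> \<sigma>. (- 1) ^ (n - card \<sigma>) * (- 1) ^ card H :: int)"
  proof (rule sum.reindex_bij_witness[of _ "\<lambda>H. \<sigma> \<union> H" "\<lambda>G. G - \<sigma>"])
    fix G assume G: "G \<in> {G \<in> \<Delta>. \<sigma> \<subseteq> G}"
    then show L: "G - \<sigma> \<in> link \<Delta> \<sigma>" by (auto simp: mem_link[OF \<sigma>] Un_absorb1)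
    have "card G = card \<sigma> + card (G - \<sigma>)" using card_star[OF \<sigma> L] G by (simp add: Un_absorb1)
    moreover have "card G \<le> n" using card_le G by auto
    ultimately have "n - card \<sigma> = (n - card G) + card (G - \<sigma>)" by simp
    then show "(- 1) ^ (n - card \<sigma>) * (- 1) ^ card (G - \<sigma>) = ((- 1) ^ (n - card G) :: int)"
      by (simp add: power_add mult.assoc flip: power_mult_distrib)
  qed (auto simp: mem_link[OF \<sigma>])
  also have "\<dots> = (- 1) ^ (n - card \<sigma>) * (- 1) ^ (n - card \<sigma>)"
    by (simp add: euler_link[OF \<sigma>] flip: sum_distrib_left)
  also have "\<dots> = 1" by (simp flip: power_mult_distrib)
  finally show ?thesis .
qed

lemma power_eq_sum_subsets:
  fixes x :: "'b::comm_ring_1"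
  assumes "finite F"
  shows "x ^ card F = (\<Sum>E\<in>Pow F. (x - 1) ^ (card F - card E))"
proof -
  have "x ^ card F = (\<Prod>v\<in>F. 1 + (x - 1))" by simp
  also have "\<dots> = (\<Sum>E\<in>Pow F. (\<Prod>v\<in>E. 1) * (\<Prod>v\<in>F - E. x - 1))" using assms by (rule prod_add)
  also have "\<dots> = (\<Sum>E\<in>Pow F. (x - 1) ^ (card F - card E))"
    using assms by (intro sum.cong refl) (auto simp: card_Diff_subset finite_subset)
  finally show ?thesis .
qed

text \<open>Expand each x^|F| over the subsets E of F in powers of x - 1 and exchange the sums. The
  inner sum over the faces containing E is 1 by \<open>euler_star\<close>.\<close>

lemma h_poly_dual: "h_poly n \<Delta> = (\<Sum>E\<in>\<Delta>. [:- 1, 1:] ^ (n - card E))"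
proof -
  note fin = down_closedD[OF complex]
  have x1: "[:0, 1:] - 1 = ([:- 1, 1:] :: int poly)" by (simp add: one_pCons)
  have "h_poly n \<Delta> = (\<Sum>F\<in>\<Delta>. \<Sum>E\<in>Pow F. (- 1) ^ (n - card F) * [:- 1, 1:] ^ (n - card E))"
    unfolding h_poly_def
  proof (intro sum.cong refl)
    fix F assume F: "F \<in> \<Delta>"
    have neg: "[:1, - 1:] ^ k = (- 1) ^ k * ([:- 1, 1:] ^ k :: int poly)" for k
      by (simp flip: power_mult_distrib)
    have "[:0, 1:] ^ card F * [:1, - 1:] ^ (n - card F) =
        (\<Sum>E\<in>Pow F. [:- 1, 1:] ^ (card F - card E) * [:1, - 1 :: int:] ^ (n - card F))"
      using power_eq_sum_subsets[OF fin(2)[OF F], of "[:0, 1::int:]"] by (simp add: x1 sum_distrib_right)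
    also have "\<dots> = (\<Sum>E\<in>Pow F. (- 1) ^ (n - card F) * [:- 1, 1:] ^ (n - card E))"
    proof (intro sum.cong refl)
      fix E assume "E \<in> Pow F"
      then have "card E \<le> card F" using fin(2)[OF F] by (auto intro: card_mono)
      then have "n - card E = (card F - card E) + (n - card F)" using card_le[OF F] by simp
      then show "[:- 1, 1:] ^ (card F - card E) * [:1, - 1 :: int:] ^ (n - card F) =
          (- 1) ^ (n - card F) * [:- 1, 1:] ^ (n - card E)"
        by (simp add: neg power_add ac_simps)
    qed
    finally show "[:0, 1:] ^ card F * [:1, - 1:] ^ (n - card F) =
        (\<Sum>E\<in>Pow F. (- 1) ^ (n - card F) * [:- 1, 1::int:] ^ (n - card E))" .
  qed
  also have "\<dots> = (\<Sum>F\<in>\<Delta>. \<Sum>E\<in>\<Delta>. if E \<subseteq> F then (- 1) ^ (n - card F) * [:- 1, 1:] ^ (n - card E) else 0)"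
    using fin(1,3) by (intro sum.cong refl sum.mono_neutral_cong_left) auto
  also have "\<dots> = (\<Sum>E\<in>\<Delta>. \<Sum>F\<in>\<Delta>. if E \<subseteq> F then (- 1) ^ (n - card F) * [:- 1, 1:] ^ (n - card E) else 0)"
    by (rule sum.swap)
  also have "\<dots> = (\<Sum>E\<in>\<Delta>. [:- 1, 1:] ^ (n - card E))"
  proof (intro sum.cong refl)
    fix E assume E: "E \<in> \<Delta>"
    have "(\<Sum>F\<in>\<Delta>. if E \<subseteq> F then (- 1) ^ (n - card F) * [:- 1, 1:] ^ (n - card E) else 0) =
        (\<Sum>F\<in>{F \<in> \<Delta>. E \<subseteq> F}. (- 1) ^ (n - card F) * [:- 1, 1 :: int:] ^ (n - card E))"
      using fin(1) by (simp add: sum.inter_filter)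
    also have "\<dots> = of_int (\<Sum>F\<in>{F \<in> \<Delta>. E \<subseteq> F}. (- 1) ^ (n - card F)) * [:- 1, 1:] ^ (n - card E)"
      by (simp add: sum_distrib_right del: of_int_eq_iff)
    also have "\<dots> = [:- 1, 1:] ^ (n - card E)" unfolding euler_star[OF E] by simp
    finally show "(\<Sum>F\<in>\<Delta>. if E \<subseteq> F then (- 1) ^ (n - card F) * [:- 1, 1:] ^ (n - card E) else 0) =
        ([:- 1, 1 :: int:] ^ (n - card E))" .
  qed
  finally show ?thesis .
qed

text \<open>Reversing the coefficients in degree n turns the summand of F in the definition, x^|F|
  (1 - x)^(n-|F|), into (x - 1)^(n-|F|), its summand in \<open>h_poly_dual\<close>.\<close>

lemma h_poly_symmetric:
  assumes "i \<le> n"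
  shows "coeff (h_poly n \<Delta>) (n - i) = coeff (h_poly n \<Delta>) i"
proof -
  have "coeff ([:0, 1:] ^ card F * [:1, - 1:] ^ (n - card F)) (n - i) = coeff ([:- 1, 1 :: int:] ^ (n - card F)) i"
    if F: "F \<in> \<Delta>" for F
  proof -
    have r: "reflect_poly [:- 1, 1 :: int:] = [:1, - 1:]" by (simp add: reflect_poly_pCons)
    define k where "k = n - card F"
    have k: "k + card F = n" using card_le[OF F] by (simp add: k_def)
    have deg: "degree ([:- 1, 1 :: int:] ^ k) = k" by (simp add: degree_power_eq)
    have mon: "[:0, 1 :: int:] ^ c = monom 1 c" for c by (simp add: monom_altdef)
    have refl: "[:1, - 1 :: int:] ^ k = reflect_poly ([:- 1, 1:] ^ k)" by (simp add: reflect_poly_power r)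
    have "coeff ([:0, 1:] ^ card F * [:1, - 1 :: int:] ^ k) (n - i) =
      (if n - i < card F then 0 else coeff (reflect_poly ([:- 1, 1:] ^ k)) (n - i - card F))"
      unfolding mon refl coeff_monom_mult by simp
    then show ?thesis
      using assms k deg coeff_eq_0[of "[:- 1, 1 :: int:] ^ k" i] unfolding coeff_reflect_poly k_def[symmetric]
      by auto
  qed
  then show ?thesis by (subst h_poly_dual) (simp add: h_poly_def coeff_sum)
qed

end

section \<open>The h-vector of a Gorenstein* complex\<close>

lemma simplicial_complex_down_closed: "simplicial_complex \<Delta> \<Longrightarrow> down_closed \<Delta>"
  by (simp add: simplicial_complex_def down_closed_def)

lemma complex_dim_card:
  assumes "simplicial_complex \<Delta>" "complex_dim \<Delta> = int n - 1"
  shows "F \<in> \<Delta> \<Longrightarrow> card F \<le> n" "\<exists>F\<in>\<Delta>. card F = n"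
proof -
  have fin: "finite (face_dim ` \<Delta>)" "face_dim ` \<Delta> \<noteq> {}"
    using assms(1) by (auto simp: simplicial_complex_def)
  show "card F \<le> n" if "F \<in> \<Delta>"
  proof -
    have "face_dim F \<le> complex_dim \<Delta>"
      unfolding complex_dim_def using fin that by (intro Max_ge) auto
    then show ?thesis using assms(2) by (simp add: face_dim_def)
  qed
  have "complex_dim \<Delta> \<in> face_dim ` \<Delta>" unfolding complex_dim_def using fin by (rule Max_in)
  then show "\<exists>F\<in>\<Delta>. card F = n" using assms(2) by (auto simp: face_dim_def)
qed

text \<open>The fraction field of a polynomial ring is an infinite field of coefficients, so it has generic parameters.\<close>

lemma gorenstein_star_sphere_like:
  fixes \<Delta> :: "'a::linorder set set"
  assumes "simplicial_complex \<Delta>" "complex_dim \<Delta> = int n - 1" "gorenstein_star TYPE('r::idom) \<Delta>"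
  shows "\<exists>t. sphere_like_complex_parameters \<Delta> n (t :: 'a \<Rightarrow> 'r poly fract)"
proof -
  have dc: "down_closed \<Delta>" using assms(1) by (rule simplicial_complex_down_closed)
  obtain f :: "'a \<Rightarrow> nat" where f: "inj_on f (\<Union>\<Delta>)"
    using finite_imp_inj_to_nat_seg[OF down_closedD(4)[OF dc]] by blast
  have "has_homology_of_sphere TYPE('r poly fract) (link \<Delta> \<sigma>) (int n - 1 - int (card \<sigma>))" if "\<sigma> \<in> \<Delta>" for \<sigma>
  proof -
    have "has_homology_of_sphere TYPE('r) (link \<Delta> \<sigma>) (complex_dim \<Delta> - 1 - face_dim \<sigma>)"
      using assms(3) that by (simp add: gorenstein_star_def)
    moreover have "complex_dim \<Delta> - 1 - face_dim \<sigma> = int n - 1 - int (card \<sigma>)"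
      using assms(2) by (simp add: face_dim_def)
    moreover have "finite (link \<Delta> \<sigma>)" using down_closed_link[OF dc] by (rule down_closedD(1))
    ultimately show ?thesis
      using has_homology_of_sphere_fract[OF has_homology_of_sphere_poly] by simp
  qed
  moreover have "inj_on (\<lambda>v. to_fract (monom 1 (f v)) :: 'r poly fract) (\<Union>\<Delta>)"
    using f by (auto simp: inj_on_def monom_eq_iff')
  ultimately have "sphere_like_complex_parameters \<Delta> n (\<lambda>v. to_fract (monom 1 (f v)) :: 'r poly fract)"
    using dc complex_dim_card(1)[OF assms(1,2)]
    by (simp add: sphere_like_complex_parameters_def sphere_like_complex_def sphere_like_complex_parameters_axioms_def)
  then show ?thesis by blast
qed

lemma gorenstein_star_h_poly:
  fixes \<Delta> :: "'a::linorder set set"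
  assumes "simplicial_complex \<Delta>" "complex_dim \<Delta> = int n - 1" "gorenstein_star TYPE('r::idom) \<Delta>"
  shows "coeff (h_poly n \<Delta>) i \<ge> 0" "i \<le> n \<Longrightarrow> coeff (h_poly n \<Delta>) (n - i) = coeff (h_poly n \<Delta>) i"
proof -
  obtain t where "sphere_like_complex_parameters \<Delta> n (t :: 'a \<Rightarrow> 'r poly fract)"
    using gorenstein_star_sphere_like[OF assms] by blast
  then interpret sphere_like_complex_parameters \<Delta> n "TYPE('r poly fract)" t .
  show "coeff (h_poly n \<Delta>) i \<ge> 0" by (rule h_poly_nonneg)
  show "i \<le> n \<Longrightarrow> coeff (h_poly n \<Delta>) (n - i) = coeff (h_poly n \<Delta>) i" by (rule h_poly_symmetric)
qed

lemma h_poly_coeff_0: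
  assumes "simplicial_complex \<Delta>"
  shows "coeff (h_poly n \<Delta>) 0 = 1"
proof -
  have "coeff ([:0, 1:] ^ card F * [:1, - 1 :: int:] ^ (n - card F)) 0 = (if F = {} then 1 else 0)" if "F \<in> \<Delta>" for F
  proof -
    have "finite F" using that assms by (simp add: simplicial_complex_def)
    then show ?thesis by (simp add: coeff_mult_0 coeff_0_power card_eq_0_iff power_0_left)
  qed
  then have "coeff (h_poly n \<Delta>) 0 = (\<Sum>F\<in>\<Delta>. if F = {} then 1 else 0)"
    by (simp add: h_poly_def coeff_sum)
  then show ?thesis using assms by (simp add: simplicial_complex_def)
qed

section \<open>The flag polynomial as a linear function of the h-vector\<close>

definition partial_sums :: "(nat \<Rightarrow> 'b::comm_monoid_add) \<Rightarrow> nat \<Rightarrow> 'b" where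
  "partial_sums h i = (\<Sum>l\<le>i. h l)"

lemma partial_sums_0 [simp]: "partial_sums h 0 = h 0"
  by (simp add: partial_sums_def)

lemma partial_sums_Suc [simp]: "partial_sums h (Suc i) = partial_sums h i + h (Suc i)"
  by (simp add: partial_sums_def)

text \<open>
  The flag polynomial of a simplicial complex of dimension \<open>m - 1\<close> with \<open>h\<close>-vector \<open>h\<close>: the partial sums
  of \<open>h\<close> are the \<open>h\<close>-vector of the codimension one skeleton, and the boundary of a simplex has \<open>h\<close>-vector
  \<open>(1, \<dots>, 1)\<close>.
\<close>

fun h_flag_poly :: "nat \<Rightarrow> (nat \<Rightarrow> int) \<Rightarrow> int_mpoly" where
  "h_flag_poly 0 h = of_int (h 0)"
| "h_flag_poly (Suc m) h = h_flag_poly m (partial_sums h) * (var (Suc m) - 1) +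
     of_int (partial_sums h (Suc m)) * h_flag_poly m (\<lambda>_. 1)"

lemma partial_sums_cong: "(\<And>i. i \<le> m \<Longrightarrow> a i = b i) \<Longrightarrow> i \<le> m \<Longrightarrow> partial_sums a i = partial_sums b i"
  by (simp add: partial_sums_def)

lemma h_flag_poly_cong: "(\<And>i. i \<le> m \<Longrightarrow> a i = b i) \<Longrightarrow> h_flag_poly m a = h_flag_poly m b"
proof (induction m arbitrary: a b)
  case (Suc m)
  have "h_flag_poly m (partial_sums a) = h_flag_poly m (partial_sums b)"
    using Suc.prems by (intro Suc.IH) (rule partial_sums_cong[of "Suc m"], auto)
  moreover have "partial_sums a (Suc m) = partial_sums b (Suc m)"
    using Suc.prems by (intro partial_sums_cong[of "Suc m"]) auto
  ultimately show ?case by (simp only: h_flag_poly.simps)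
qed simp

lemma partial_sums_add: "partial_sums (\<lambda>i. a i + b i) i = partial_sums a i + partial_sums b i"
  by (simp add: partial_sums_def sum.distrib)

lemma partial_sums_scale: "partial_sums (\<lambda>i. c * a i) i = c * partial_sums a i"
  for c :: "'b::comm_semiring_0"
  by (simp add: partial_sums_def sum_distrib_left)

lemma h_flag_poly_add: "h_flag_poly m (\<lambda>i. a i + b i) = h_flag_poly m a + h_flag_poly m b"
proof (induction m arbitrary: a b)
  case (Suc m)
  have "partial_sums (\<lambda>i. a i + b i) = (\<lambda>i. partial_sums a i + partial_sums b i)"
    by (rule ext) (rule partial_sums_add)
  then show ?case by (simp add: Suc.IH algebra_simps)
qed simp

lemma h_flag_poly_scale: "h_flag_poly m (\<lambda>i. c * a i) = of_int c * h_flag_poly m a"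
proof (induction m arbitrary: a)
  case (Suc m)
  have "partial_sums (\<lambda>i. c * a i) = (\<lambda>i. c * partial_sums a i)"
    by (rule ext) (rule partial_sums_scale)
  then show ?case by (simp add: Suc.IH algebra_simps)
qed simp

lemma h_flag_poly_zero: "h_flag_poly m (\<lambda>_. 0) = 0"
  using h_flag_poly_scale[of m 0 "\<lambda>_. 0"] by simp

lemma h_flag_poly_sum:
  "finite A \<Longrightarrow> h_flag_poly m (\<lambda>i. \<Sum>l\<in>A. a l i) = (\<Sum>l\<in>A. h_flag_poly m (a l))"
  by (induction A rule: finite_induct) (simp_all add: h_flag_poly_zero h_flag_poly_add)

section \<open>The transition numbers\<close>

text \<open>Row \<open>l\<close> plays the role of an h-vector of length n - 2, used for the link of
  a vertex that belongs to the entry \<open>h l\<close>. It is the closed form of the coefficient of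
  \<open>h l\<close> in \<open>sum_transition\<close>. The rows are symmetric under i \<mapsto> n -
  2 - i, so their own correction terms vanish.\<close>

definition transition :: "nat \<Rightarrow> nat \<Rightarrow> nat \<Rightarrow> nat" where
  "transition n l i = min (min (Suc i) (n - 1 - i)) (min l (n - l))"

lemma transition_symmetric:
  assumes "i + 2 \<le> n"
  shows "transition n l (n - 2 - i) = transition n l i"
proof -
  have "Suc (n - 2 - i) = n - 1 - i" "n - 1 - (n - 2 - i) = Suc i" using assms by auto
  then show ?thesis by (simp add: transition_def min.commute)
qed

text \<open>The summand is 1 if j < l \<le> n - 1 - j, it is -1 if n - 1 - j < l \<le> j, and 0
  otherwise. So the sums climb in unit steps, may stay constant, and descend symmetrically.\<close>

lemma transition_count:
  assumes "l \<le> n" "i + 2 \<le> n"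
  shows "(\<Sum>j\<le>i. (if l \<le> n - 1 - j then 1 else 0) - (if l \<le> j then 1 else 0)) = int (transition n l i)"
  using assms(2)
proof (induction i)
  case 0
  then show ?case using assms(1) unfolding transition_def by (cases "l = 0"; cases "l \<le> n - 1"; simp)
next
  case (Suc i)
  then have "(\<Sum>j\<le>Suc i. (if l \<le> n - 1 - j then 1 else 0) - (if l \<le> j then 1 else 0)) =
    int (transition n l i) + ((if l \<le> n - 1 - Suc i then 1 else 0) - (if l \<le> Suc i then 1 else 0))"
    by simp
  also have "\<dots> = int (transition n l (Suc i))"
    using Suc.prems assms(1) unfolding transition_def
    by (cases "l \<le> Suc i"; cases "l \<le> n - 1 - Suc i"; simp; linarith)
  finally show ?case .
qed

text \<open>The right side is the correction term belonging to the partial sums of \<open>h\<close>.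
  Collecting it by the entries of \<open>h\<close> shows that it is a combination of the rows with
  coefficients \<open>h l\<close>, nonnegative when \<open>h\<close> is; this is what allows a count
  of faces.\<close>

lemma sum_transition:
  assumes "i \<le> m"
  shows "(\<Sum>l\<in>{1..Suc m}. h l * int (transition (m + 2) l i)) =
     (\<Sum>j\<le>i. partial_sums h (m + 1 - j) - partial_sums h j)"
proof -
  have ps: "partial_sums h k = (\<Sum>l\<le>m + 2. if l \<le> k then h l else 0)" if "k \<le> m + 2" for k
    unfolding partial_sums_def using that by (intro sum.mono_neutral_cong_left) auto
  have "(\<Sum>j\<le>i. partial_sums h (m + 1 - j) - partial_sums h j) =
      (\<Sum>j\<le>i. \<Sum>l\<le>m + 2. h l * ((if l \<le> m + 2 - 1 - j then 1 else 0) - (if l \<le> j then 1 else 0)))"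
  proof (intro sum.cong refl)
    fix j assume "j \<in> {..i}"
    then have b: "m + 1 - j \<le> m + 2" "j \<le> m + 2" using assms by auto
    show "partial_sums h (m + 1 - j) - partial_sums h j =
      (\<Sum>l\<le>m + 2. h l * ((if l \<le> m + 2 - 1 - j then 1 else 0) - (if l \<le> j then 1 else 0)))"
      unfolding ps[OF b(1)] ps[OF b(2)] sum_subtractf[symmetric] by (intro sum.cong refl) simp
  qed
  also have "\<dots> = (\<Sum>l\<le>m + 2. h l * (\<Sum>j\<le>i. (if l \<le> m + 2 - 1 - j then 1 else 0) - (if l \<le> j then 1 else 0)))"
    unfolding sum_distrib_left by (rule sum.swap)
  also have "\<dots> = (\<Sum>l\<le>m + 2. h l * int (transition (m + 2) l i))"
    using assms by (intro sum.cong refl) (subst transition_count, auto)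
  also have "\<dots> = (\<Sum>l\<in>{1..Suc m}. h l * int (transition (m + 2) l i))"
  proof (rule sum.mono_neutral_right)
    show "\<forall>l\<in>{..m + 2} - {1..Suc m}. h l * int (transition (m + 2) l i) = 0"
    proof
      fix l assume "l \<in> {..m + 2} - {1..Suc m}"
      then have "l = 0 \<or> l = m + 2" by auto
      then show "h l * int (transition (m + 2) l i) = 0" by (auto simp: transition_def)
    qed
  qed auto
  finally show ?thesis by simp
qed

lemma sum_reversed:
  fixes h :: "nat \<Rightarrow> int"
  shows "i < n \<Longrightarrow> (\<Sum>j\<le>i. h (n - j)) + partial_sums h (n - 1 - i) = partial_sums h n"
proof (induction i)
  case 0
  then show ?case by (cases n) auto
next
  case (Suc i)
  have "n - 1 - i = Suc (n - 1 - Suc i)" "n - Suc i = n - 1 - i" using Suc.prems by auto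
  then have "partial_sums h (n - 1 - i) = partial_sums h (n - 1 - Suc i) + h (n - Suc i)"
    by (metis partial_sums_Suc)
  then show ?case using Suc by simp
qed

section \<open>The coloured simplicial complex behind the cd-index\<close>

text \<open>A vertex is a triple (colour, l, a), with \<open>a\<close> numbering \<open>h l\<close>
  copies. Faces without the last colour m+1 form the complex of the partial sums of
  \<open>h\<close>, and the link of a vertex (m+1, l, a) is the complex of row \<open>l\<close> of
  the transition numbers. A colour p stands for a letter d in positions p and p+1; accordingly the
  link skips the colour m.\<close>

fun lattice_faces :: "nat \<Rightarrow> (nat \<Rightarrow> nat) \<Rightarrow> (nat \<times> nat \<times> nat) set set" where
  "lattice_faces 0 h = {{}}"
| "lattice_faces (Suc 0) h = {{}}"
| "lattice_faces (Suc (Suc m)) h = lattice_faces (Suc m) (partial_sums h) \<union>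
     (\<Union>l\<in>{1..Suc m}. \<Union>a\<in>{..<h l}. insert (Suc m, l, a) ` lattice_faces m (transition (m + 2) l))"

lemma lattice_faces_colors:
  "F \<in> lattice_faces n h \<Longrightarrow> x \<in> F \<Longrightarrow> 1 \<le> fst x \<and> Suc (fst x) \<le> n"
proof (induction n h arbitrary: F x rule: lattice_faces.induct)
  case (3 m h)
  from "3.prems"(1) consider "F \<in> lattice_faces (Suc m) (partial_sums h)"
    | l a F' where "l \<in> {1..Suc m}" "a < h l" "F = insert (Suc m, l, a) F'" "F' \<in> lattice_faces m (transition (m + 2) l)"
    by auto
  then show ?case
  proof cases
    case 1
    then show ?thesis using "3.IH"(1)[OF 1 "3.prems"(2)] by simp
  next
    case 2
    have "a \<in> {..<h l}" using 2(2) by simp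
    note IH = "3.IH"(2)[OF 2(1) this 2(4), of x]
    show ?thesis
    proof (cases "x = (Suc m, l, a)")
      case False
      then show ?thesis using IH "3.prems"(2) 2(3) by simp
    qed simp
  qed
qed auto

lemma finite_lattice_faces: "finite (lattice_faces n h)"
  by (induction n h rule: lattice_faces.induct) auto

lemma finite_lattice_face: "F \<in> lattice_faces n h \<Longrightarrow> finite F"
  by (induction n h arbitrary: F rule: lattice_faces.induct) auto

lemma lattice_faces_inj_fst: "F \<in> lattice_faces n h \<Longrightarrow> inj_on fst F"
proof (induction n h arbitrary: F rule: lattice_faces.induct)
  case (3 m h)
  from "3.prems"(1) consider "F \<in> lattice_faces (Suc m) (partial_sums h)"
    | l a F' where "l \<in> {1..Suc m}" "a < h l" "F = insert (Suc m, l, a) F'" "F' \<in> lattice_faces m (transition (m + 2) l)"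
    by auto
  then show ?case
  proof cases
    case 1
    then show ?thesis by (rule "3.IH"(1))
  next
    case 2
    have "a \<in> {..<h l}" using 2(2) by simp
    then have "inj_on fst F'" by (rule "3.IH"(2)[OF 2(1) _ 2(4)])
    moreover have "Suc m \<notin> fst ` F'"
    proof
      assume "Suc m \<in> fst ` F'"
      then obtain x where "x \<in> F'" "fst x = Suc m" by auto
      then show False using lattice_faces_colors[OF 2(4), of x] by simp
    qed
    ultimately show ?thesis unfolding 2(3) by (auto simp: inj_on_insert)
  qed
qed auto

lemma lattice_faces_Suc: "lattice_faces n (partial_sums h) \<subseteq> lattice_faces (Suc n) h"
  by (cases n) auto

lemma lattice_faces_mono:
  "(\<And>l. l \<le> n \<Longrightarrow> h l \<le> h' l) \<Longrightarrow> lattice_faces n h \<subseteq> lattice_faces n h'"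
proof (induction n h arbitrary: h' rule: lattice_faces.induct)
  case (3 m h)
  have "partial_sums h l \<le> partial_sums h' l" if "l \<le> Suc m" for l
    unfolding partial_sums_def using 3(3) that by (intro sum_mono) auto
  then have "lattice_faces (Suc m) (partial_sums h) \<subseteq> lattice_faces (Suc m) (partial_sums h')"
    by (intro 3(1)) auto
  moreover have "h l \<le> h' l" if "l \<in> {1..Suc m}" for l using 3(3) that by auto
  ultimately show ?case
    unfolding lattice_faces.simps(3) by (intro Un_mono UN_mono subset_refl) auto
qed auto

text \<open>
  If \<open>h 0 \<ge> 1\<close>, then the double partial sums of \<open>h\<close> are at least \<open>i + 1\<close>, and hence dominate every row
  of transition numbers. This places the link of a vertex of the last colour inside the complex.
\<close>

lemma lattice_faces_transition:
  assumes "h 0 \<ge> 1"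
  shows "lattice_faces m (transition (m + 2) l) \<subseteq> lattice_faces (Suc m) (partial_sums h)"
proof -
  have 1: "partial_sums h i \<ge> 1" for i using assms by (induction i) auto
  have "partial_sums (partial_sums h) i \<ge> Suc i" for i
  proof (induction i)
    case (Suc i)
    then show ?case using 1[of "Suc i"] by simp
  qed (use assms in simp)
  moreover have "transition (m + 2) l i \<le> Suc i" for i by (simp add: transition_def)
  ultimately have "lattice_faces m (transition (m + 2) l) \<subseteq> lattice_faces m (partial_sums (partial_sums h))"
    by (intro lattice_faces_mono) (rule le_trans)
  then show ?thesis using lattice_faces_Suc[of m "partial_sums h"] by blast
qed

lemma transition_at_0: "l \<in> {1..Suc m} \<Longrightarrow> transition (m + 2) l 0 = 1"
  by (simp add: transition_def) linarith

lemma empty_lattice_faces: "{} \<in> lattice_faces n h"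
  by (induction n h rule: lattice_faces.induct) simp_all

text \<open>The case that needs an argument is the removal of the vertex of the last colour: what
  remains lies in its link, and \<open>lattice_faces_transition\<close> places the link among the
  faces without that colour.\<close>

lemma lattice_faces_down_closed:
  "F \<in> lattice_faces n h \<Longrightarrow> h 0 \<ge> 1 \<Longrightarrow> G \<subseteq> F \<Longrightarrow> G \<in> lattice_faces n h"
proof (induction n h arbitrary: F G rule: lattice_faces.induct)
  case (3 m h)
  from "3.prems"(1) consider "F \<in> lattice_faces (Suc m) (partial_sums h)"
    | l a F' where "l \<in> {1..Suc m}" "a < h l" "F = insert (Suc m, l, a) F'" "F' \<in> lattice_faces m (transition (m + 2) l)"
    by auto
  then show ?case
  proof cases
    case 1
    have "1 \<le> partial_sums h 0" using "3.prems"(2) by simp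
    from "3.IH"(1)[OF 1 this "3.prems"(3)] show ?thesis by (simp only: lattice_faces.simps) (rule UnI1)
  next
    case 2
    define G' where "G' = G - {(Suc m, l, a)}"
    have a: "a \<in> {..<h l}" using 2(2) by simp
    have "G' \<subseteq> F'" using "3.prems"(3) 2(3) by (auto simp: G'_def)
    then have G': "G' \<in> lattice_faces m (transition (m + 2) l)"
      using transition_at_0[OF 2(1)] by (intro "3.IH"(2)[OF 2(1) a 2(4)]) simp_all
    show ?thesis
    proof (cases "(Suc m, l, a) \<in> G")
      case True
      then have "G = insert (Suc m, l, a) G'" by (auto simp: G'_def)
      then have "G \<in> insert (Suc m, l, a) ` lattice_faces m (transition (m + 2) l)" using G' by blast
      then have "G \<in> (\<Union>l\<in>{1..Suc m}. \<Union>a\<in>{..<h l}. insert (Suc m, l, a) ` lattice_faces m (transition (m + 2) l))"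
        using 2(1) a by blast
      then show ?thesis by (simp only: lattice_faces.simps) (rule UnI2)
    next
      case False
      then have "G \<in> lattice_faces m (transition (m + 2) l)" using G' by (simp add: G'_def)
      then have "G \<in> lattice_faces (Suc m) (partial_sums h)"
        using lattice_faces_transition[of h m l] "3.prems"(2) by blast
      then show ?thesis by (simp only: lattice_faces.simps) (rule UnI1)
    qed
  qed
qed auto

section \<open>The cd-polynomial of the coloured complex\<close>

text \<open>For a set of colours without consecutive elements, each colour p puts d in positions p
  and p+1, and all other positions receive c. The word is built from its right end to follow the
  recursion of \<open>lattice_faces\<close>.\<close>

fun color_word :: "nat \<Rightarrow> nat set \<Rightarrow> cd_monomial" where
  "color_word 0 V = []"
| "color_word (Suc 0) V = [C_letter]"
| "color_word (Suc (Suc m)) V =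
     (if Suc m \<in> V then color_word m V @ [D_letter] else color_word (Suc m) V @ [C_letter])"

lemma color_word_cong: "(\<And>p. p < n \<Longrightarrow> p \<in> V \<longleftrightarrow> p \<in> V') \<Longrightarrow> color_word n V = color_word n V'"
  by (induction n V rule: color_word.induct) auto

lemma cd_degree_append: "cd_degree (u @ w) = cd_degree u + cd_degree w"
  by (induction u rule: cd_degree.induct) auto

lemma cd_degree_color_word: "cd_degree (color_word n V) = n"
  by (induction n V rule: color_word.induct) (auto simp: cd_degree_append)

lemma cd_monomial_eval_append:
  "cd_monomial_eval i (u @ w) = cd_monomial_eval i u * cd_monomial_eval (i + cd_degree u) w"
  by (induction u arbitrary: i rule: cd_degree.induct) (auto simp: mult.assoc add.assoc)

definition lattice_cd_sum :: "nat \<Rightarrow> (nat \<Rightarrow> nat) \<Rightarrow> int_mpoly" where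
  "lattice_cd_sum n h = (\<Sum>F\<in>lattice_faces n h. cd_monomial_eval 1 (color_word n (fst ` F)))"

text \<open>A face has at most one vertex of the last colour m+1. Without one its word ends in c at
  position m+2; with one it ends in d at positions m+1 and m+2, and the rest of the face runs
  through a link.\<close>

lemma lattice_cd_sum_rec:
  "lattice_cd_sum (Suc (Suc m)) h = lattice_cd_sum (Suc m) (partial_sums h) * (var (m + 2) + 1) +
     (\<Sum>l\<in>{1..Suc m}. of_nat (h l) * lattice_cd_sum m (transition (m + 2) l)) * (var (m + 1) + var (m + 2))"
proof -
  let ?E = "\<lambda>n F. cd_monomial_eval 1 (color_word n (fst ` F))"
  let ?T = "\<lambda>l. lattice_faces m (transition (m + 2) l)"
  let ?I = "\<lambda>l a. insert (Suc m, l, a) ` ?T l"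
  have new: "x \<notin> F" if "F \<in> ?T l" "fst x = Suc m" for F l x
    using lattice_faces_colors[OF that(1), of x] that(2) by auto
  have old: "Suc m \<notin> fst ` F" if "F \<in> lattice_faces (Suc m) g" for F g
    using lattice_faces_colors[OF that] by fastforce
  have disj: "lattice_faces (Suc m) (partial_sums h) \<inter> (\<Union>l\<in>{1..Suc m}. \<Union>a\<in>{..<h l}. ?I l a) = {}"
    using old by fastforce
  have e1: "?E (Suc (Suc m)) F = ?E (Suc m) F * (var (m + 2) + 1)" if "F \<in> lattice_faces (Suc m) g" for F g
    using old[OF that] by (simp add: cd_monomial_eval_append cd_degree_color_word)
  have e2: "?E (Suc (Suc m)) (insert (Suc m, l, a) F) = ?E m F * (var (m + 1) + var (m + 2))" for l a F
  proof -
    have "color_word m (fst ` insert (Suc m, l, a) F) = color_word m (fst ` F)"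
      by (rule color_word_cong) auto
    then show ?thesis by (simp add: cd_monomial_eval_append cd_degree_color_word)
  qed
  have inj: "inj_on (insert (Suc m, l, a)) (?T l)" for l a
  proof (rule inj_onI)
    fix F G assume F: "F \<in> ?T l" "G \<in> ?T l" "insert (Suc m, l, a) F = insert (Suc m, l, a) G"
    then show "F = G" using new[OF F(1), of "(Suc m, l, a)"] new[OF F(2), of "(Suc m, l, a)"]
      by (simp add: insert_ident)
  qed
  have uniq: "l = l' \<and> a = a'" if X: "X \<in> ?I l a" "X \<in> ?I l' a'" for X l a l' a'
  proof -
    obtain F where F: "X = insert (Suc m, l, a) F" "F \<in> ?T l" using X(1) by blast
    obtain F' where F': "X = insert (Suc m, l', a') F'" "F' \<in> ?T l'" using X(2) by blast
    have "(Suc m, l, a) \<in> insert (Suc m, l', a') F'" using F F' by auto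
    then show ?thesis using new[OF F'(2), of "(Suc m, l, a)"] by auto
  qed
  have "(\<Sum>X\<in>(\<Union>l\<in>{1..Suc m}. \<Union>a\<in>{..<h l}. ?I l a). ?E (Suc (Suc m)) X) =
      (\<Sum>l\<in>{1..Suc m}. \<Sum>X\<in>(\<Union>a\<in>{..<h l}. ?I l a). ?E (Suc (Suc m)) X)"
    using uniq finite_lattice_faces by (intro sum.UNION_disjoint) (auto simp del: image_iff, blast+)
  also have "\<dots> = (\<Sum>l\<in>{1..Suc m}. \<Sum>a\<in>{..<h l}. \<Sum>X\<in>?I l a. ?E (Suc (Suc m)) X)"
    using uniq finite_lattice_faces by (intro sum.cong refl sum.UNION_disjoint) (auto simp del: image_iff, blast+)
  also have "\<dots> = (\<Sum>l\<in>{1..Suc m}. \<Sum>a\<in>{..<h l}. lattice_cd_sum m (transition (m + 2) l) * (var (m + 1) + var (m + 2)))"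
    unfolding sum.reindex[OF inj] o_def e2 by (simp add: lattice_cd_sum_def sum_distrib_right)
  also have "\<dots> = (\<Sum>l\<in>{1..Suc m}. of_nat (h l) * lattice_cd_sum m (transition (m + 2) l)) * (var (m + 1) + var (m + 2))"
    unfolding sum_distrib_right by (simp add: mult.assoc)
  finally have 2: "(\<Sum>X\<in>(\<Union>l\<in>{1..Suc m}. \<Union>a\<in>{..<h l}. ?I l a). ?E (Suc (Suc m)) X) =
     (\<Sum>l\<in>{1..Suc m}. of_nat (h l) * lattice_cd_sum m (transition (m + 2) l)) * (var (m + 1) + var (m + 2))" .
  have 1: "(\<Sum>X\<in>lattice_faces (Suc m) (partial_sums h). ?E (Suc (Suc m)) X) =
      lattice_cd_sum (Suc m) (partial_sums h) * (var (m + 2) + 1)"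
    unfolding lattice_cd_sum_def sum_distrib_right by (intro sum.cong refl e1)
  have "lattice_cd_sum (Suc (Suc m)) h = (\<Sum>X\<in>lattice_faces (Suc m) (partial_sums h). ?E (Suc (Suc m)) X) +
    (\<Sum>X\<in>(\<Union>l\<in>{1..Suc m}. \<Union>a\<in>{..<h l}. ?I l a). ?E (Suc (Suc m)) X)"
    unfolding lattice_cd_sum_def lattice_faces.simps(3)
    using disj finite_lattice_faces by (intro sum.union_disjoint) auto
  then show ?thesis unfolding 1 2 .
qed

text \<open>Put A = F_(m+1)(c), D = F_m(d) and let H be c_(m+2) times F_(m+1)(1, ..., 1), where F is
  \<open>h_flag_poly\<close>, c the partial sums and d the correction for c. Induction gives A - D
  for the sum over the faces without last colour and, rows being symmetric, D for the weighted sum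
  over the links. The claim becomes the polynomial identity \<open>alg\<close>.\<close>

lemma lattice_cd_sum_eq_step:
  assumes h0: "h 0 = 1"
    and IH: "\<And>m' h. m' < Suc (Suc m) \<Longrightarrow> h 0 = 1 \<Longrightarrow> lattice_cd_sum m' h = h_flag_poly m' (\<lambda>i. int (h i)) -
     (if m' = 0 then 0 else h_flag_poly (m' - 1) (\<lambda>i. \<Sum>j\<le>i. int (h (m' - j)) - int (h j)))"
  shows "lattice_cd_sum (Suc (Suc m)) h = h_flag_poly (Suc (Suc m)) (\<lambda>i. int (h i)) -
     h_flag_poly (Suc m) (\<lambda>i. \<Sum>j\<le>i. int (h (m + 2 - j)) - int (h j))"
proof -
  define k where "k = (\<lambda>i. int (h i))"
  define c where "c = partial_sums k"
  define d where "d = (\<lambda>i. \<Sum>l\<in>{1..Suc m}. k l * int (transition (m + 2) l i))"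
  have c: "int (partial_sums h i) = c i" for i by (simp add: c_def k_def partial_sums_def)
  have d_eq: "d i = (\<Sum>j\<le>i. c (m + 1 - j) - c j)" if "i \<le> m" for i
    unfolding d_def c_def using that by (rule sum_transition)
  have S1: "lattice_cd_sum (Suc m) (partial_sums h) = h_flag_poly (Suc m) c - h_flag_poly m d"
  proof -
    have "h_flag_poly m (\<lambda>i. \<Sum>j\<le>i. c (Suc m - j) - c j) = h_flag_poly m d"
      by (rule h_flag_poly_cong) (simp add: d_eq)
    then show ?thesis using IH[of "Suc m" "partial_sums h"] h0 by (simp add: c)
  qed
  have S2: "lattice_cd_sum m (transition (m + 2) l) = h_flag_poly m (\<lambda>i. int (transition (m + 2) l i))"
    if l: "l \<in> {1..Suc m}" for l
  proof -
    let ?T = "\<lambda>i. int (transition (m + 2) l i)"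
    have "h_flag_poly (m - 1) (\<lambda>i. \<Sum>j\<le>i. ?T (m - j) - ?T j) = h_flag_poly (m - 1) (\<lambda>_. 0)" if "m \<noteq> 0"
    proof (rule h_flag_poly_cong)
      fix i assume "i \<le> m - 1"
      then show "(\<Sum>j\<le>i. ?T (m - j) - ?T j) = 0"
        using transition_symmetric[of _ "m + 2" l] that by (intro sum.neutral) auto
    qed
    then show ?thesis
      using IH[of m "transition (m + 2) l"] transition_at_0[OF l] by (cases "m = 0") (auto simp: h_flag_poly_zero)
  qed
  \<comment> \<open>The sequence of differences has partial sums \<open>d\<close> and total 0, so
    only the first summand of the recursion of \<open>h_flag_poly\<close> survives.\<close>
  have E1: "h_flag_poly (Suc m) (\<lambda>i. c (m + 1 - i) - c i) = h_flag_poly m d * (var (Suc m) - 1)"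
  proof -
    have "h_flag_poly m (partial_sums (\<lambda>i. c (m + 1 - i) - c i)) = h_flag_poly m d"
      by (rule h_flag_poly_cong) (simp add: d_eq partial_sums_def)
    moreover have "partial_sums (\<lambda>i. c (m + 1 - i) - c i) (Suc m) = 0"
    proof -
      have "(\<Sum>i\<le>Suc m. c (Suc m - i)) = (\<Sum>i\<le>Suc m. c i)"
        by (rule sum.reindex_bij_witness[of _ "\<lambda>i. Suc m - i" "\<lambda>i. Suc m - i"]) auto
      then show ?thesis by (simp add: partial_sums_def sum_subtractf del: sum.atMost_Suc)
    qed
    ultimately show ?thesis by (simp del: partial_sums_Suc)
  qed
  \<comment> \<open>For every index the total of \<open>k\<close> equals the correction for
    \<open>k\<close> plus twice \<open>c i\<close> plus the difference in \<open>E1\<close>, by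
    \<open>sum_reversed\<close>; linearity of \<open>h_flag_poly\<close> does the rest.\<close>
  have E2: "h_flag_poly (Suc m) (\<lambda>i. \<Sum>j\<le>i. k (m + 2 - j) - k j) =
     of_int (partial_sums k (m + 2)) * h_flag_poly (Suc m) (\<lambda>_. 1) - 2 * h_flag_poly (Suc m) c
       - h_flag_poly (Suc m) (\<lambda>i. c (m + 1 - i) - c i)"
  proof -
    have "h_flag_poly (Suc m) (\<lambda>i. partial_sums k (m + 2) * 1) =
      h_flag_poly (Suc m) (\<lambda>i. (\<Sum>j\<le>i. k (m + 2 - j) - k j) + (2 * c i + (c (m + 1 - i) - c i)))"
    proof (rule h_flag_poly_cong)
      fix i assume "i \<le> Suc m"
      then show "partial_sums k (m + 2) * 1 = (\<Sum>j\<le>i. k (m + 2 - j) - k j) + (2 * c i + (c (m + 1 - i) - c i))"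
        using sum_reversed[of i "m + 2" k] by (simp add: sum_subtractf c_def partial_sums_def)
    qed
    then show ?thesis
      unfolding h_flag_poly_scale h_flag_poly_add by (simp del: h_flag_poly.simps)
  qed
  have E3: "h_flag_poly (Suc (Suc m)) k =
      h_flag_poly (Suc m) c * (var (m + 2) - 1) + of_int (partial_sums k (m + 2)) * h_flag_poly (Suc m) (\<lambda>_. 1)"
    unfolding c_def by simp
  have E4: "(\<Sum>l\<in>{1..Suc m}. of_nat (h l) * lattice_cd_sum m (transition (m + 2) l)) = h_flag_poly m d"
  proof -
    have "h_flag_poly m d = (\<Sum>l\<in>{1..Suc m}. h_flag_poly m (\<lambda>i. k l * int (transition (m + 2) l i)))"
      unfolding d_def by (rule h_flag_poly_sum) simp
    also have "\<dots> = (\<Sum>l\<in>{1..Suc m}. of_nat (h l) * lattice_cd_sum m (transition (m + 2) l))"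
    proof (intro sum.cong refl)
      fix l assume l: "l \<in> {1..Suc m}"
      show "h_flag_poly m (\<lambda>i. k l * int (transition (m + 2) l i)) = of_nat (h l) * lattice_cd_sum m (transition (m + 2) l)"
        unfolding S2[OF l] h_flag_poly_scale by (simp add: k_def)
    qed
    finally show ?thesis by simp
  qed
  have alg: "(A - D) * (t2 + 1) + D * (t1 + t2) = (A * (t2 - 1) + H) - (H - 2 * A - D * (t1 - 1))"
    for A D t1 t2 H :: int_mpoly
    by (simp add: algebra_simps)
  have "lattice_cd_sum (Suc (Suc m)) h =
      h_flag_poly (Suc (Suc m)) k - h_flag_poly (Suc m) (\<lambda>i. \<Sum>j\<le>i. k (m + 2 - j) - k j)"
    unfolding lattice_cd_sum_rec S1 E4 E3 E2 E1 by (simp only: alg Suc_eq_plus1)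
  then show ?thesis by (simp only: k_def)
qed

text \<open>Formulated for every \<open>h\<close> with \<open>h 0 = 1\<close> and not just for
  symmetric ones, because the induction passes to partial sums, which are in general not symmetric.
  The subtracted term measures the asymmetry of \<open>h\<close>.\<close>

lemma lattice_cd_sum_eq:
  assumes "h 0 = 1"
  shows "lattice_cd_sum n h = h_flag_poly n (\<lambda>i. int (h i)) -
     (if n = 0 then 0 else h_flag_poly (n - 1) (\<lambda>i. \<Sum>j\<le>i. int (h (n - j)) - int (h j)))"
  using assms
proof (induction n arbitrary: h rule: less_induct)
  case (less n)
  consider "n = 0" | "n = 1" | m where "n = Suc (Suc m)" by (metis One_nat_def not0_implies_Suc)
  then show ?case
  proof cases
    case 1
    then show ?thesis using less.prems by (simp add: lattice_cd_sum_def)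
  next
    case 2
    then show ?thesis using less.prems by (simp add: lattice_cd_sum_def algebra_simps)
  next
    case 3
    have "lattice_cd_sum (Suc (Suc m)) h = h_flag_poly (Suc (Suc m)) (\<lambda>i. int (h i)) -
        h_flag_poly (Suc m) (\<lambda>i. \<Sum>j\<le>i. int (h (m + 2 - j)) - int (h j))"
      using less 3 by (intro lattice_cd_sum_eq_step) auto
    then show ?thesis unfolding 3 by (simp del: h_flag_poly.simps)
  qed
qed

section \<open>Chains of faces and the flag numbers of the face poset\<close>

definition set_chains :: "'a set set \<Rightarrow> nat set \<Rightarrow> 'a set set set" where
  "set_chains \<Delta> S = {C. C \<subseteq> \<Delta> \<and> (\<forall>F\<in>C. \<forall>G\<in>C. F \<subseteq> G \<or> G \<subseteq> F) \<and> card ` C = S}"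

lemma finite_set_chains: "finite \<Delta> \<Longrightarrow> finite (set_chains \<Delta> S)"
  by (rule finite_subset[of _ "Pow \<Delta>"]) (auto simp: set_chains_def)

definition chain_poly :: "nat \<Rightarrow> 'a set set \<Rightarrow> int_mpoly" where
  "chain_poly m \<Delta> = (\<Sum>S\<in>Pow {1..m}. of_nat (card (set_chains \<Delta> S)) * (\<Prod>i\<in>{1..m} - S. var i - 1))"

text \<open>A chain with sizes at most m+1 that attains m+1 has exactly one face F of that size. It
  contains all the others, so the remaining chain lies in the simplex on F.\<close>

lemma set_chains_top:
  assumes \<Delta>: "down_closed \<Delta>" and S: "S \<subseteq> {1..m}"
  shows "card (set_chains \<Delta> (insert (Suc m) S)) = (\<Sum>F\<in>{F \<in> \<Delta>. card F = Suc m}. card (set_chains (Pow F) S))"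
proof -
  note fin = down_closedD[OF \<Delta>]
  let ?A = "{F \<in> \<Delta>. card F = Suc m}"
  have small: "card G \<le> m" if "D \<in> set_chains (Pow F) S" "G \<in> D" for D F and G :: "'a set"
  proof -
    have "card G \<in> S" using that by (auto simp: set_chains_def)
    then show ?thesis using S by auto
  qed
  have "set_chains \<Delta> (insert (Suc m) S) = (\<Union>F\<in>?A. insert F ` set_chains (Pow F) S)"
  proof (intro equalityI subsetI)
    fix C assume "C \<in> set_chains \<Delta> (insert (Suc m) S)"
    then have C: "C \<subseteq> \<Delta>" "\<And>F G. F \<in> C \<Longrightarrow> G \<in> C \<Longrightarrow> F \<subseteq> G \<or> G \<subseteq> F" "card ` C = insert (Suc m) S"
      by (auto simp: set_chains_def)
    then have "Suc m \<in> card ` C" by simp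
    then obtain F where F: "F \<in> C" "card F = Suc m" by auto
    have eq: "G = F" if "G \<in> C" "card G = Suc m" for G
    proof -
      have "finite G" "finite F" using that F C(1) fin(2) by blast+
      moreover have "card G = card F" using that(2) F(2) by simp
      ultimately show ?thesis
        using C(2)[OF that(1) F(1)] by (elim disjE) (rule card_subset_eq, assumption+, rule card_subset_eq[symmetric], simp_all)
    qed
    have le: "card G \<le> Suc m" if "G \<in> C" for G
    proof -
      have "card G \<in> insert (Suc m) S" unfolding C(3)[symmetric] using that by (rule imageI)
      then show ?thesis using S by auto
    qed
    have sub: "G \<subseteq> F" if "G \<in> C" for G
    proof (rule ccontr)
      assume "\<not> G \<subseteq> F"
      then have "F \<subset> G" using C(2)[OF that F(1)] by auto
      moreover have "finite G" using that C(1) fin(2) by blast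
      ultimately have "card F < card G" by (rule psubset_card_mono[rotated])
      then show False using le[OF that] F(2) by simp
    qed
    have "C - {F} \<in> set_chains (Pow F) S"
      unfolding set_chains_def
    proof (intro CollectI conjI ballI)
      show "C - {F} \<subseteq> Pow F" using sub by blast
      show "card ` (C - {F}) = S"
      proof (intro equalityI subsetI)
        fix k assume "k \<in> card ` (C - {F})"
        then obtain G where G: "G \<in> C" "G \<noteq> F" "k = card G" by auto
        then have "k \<noteq> Suc m" using eq[OF G(1)] by auto
        moreover have "k \<in> insert (Suc m) S" unfolding C(3)[symmetric] G(3) using G(1) by (rule imageI)
        ultimately show "k \<in> S" by simp
      next
        fix k assume k: "k \<in> S"
        then have "k \<in> card ` C" using C(3) by simp
        then obtain G where "G \<in> C" "card G = k" by auto
        moreover have "k \<noteq> Suc m" using k S by auto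
        ultimately show "k \<in> card ` (C - {F})" using F(2) by auto
      qed
    next
      fix G H assume "G \<in> C - {F}" "H \<in> C - {F}"
      then show "G \<subseteq> H \<or> H \<subseteq> G" using C(2) by blast
    qed
    then have "insert F (C - {F}) \<in> insert F ` set_chains (Pow F) S" by (rule imageI)
    then have "C \<in> insert F ` set_chains (Pow F) S" using F(1) by (simp only: insert_Diff)
    moreover have "F \<in> ?A" using F C(1) by (simp only: mem_Collect_eq) blast
    ultimately show "C \<in> (\<Union>F\<in>?A. insert F ` set_chains (Pow F) S)" by (simp only: UN_iff) (rule bexI)
  next
    fix C assume "C \<in> (\<Union>F\<in>?A. insert F ` set_chains (Pow F) S)"
    then obtain F D where F: "F \<in> \<Delta>" "card F = Suc m" "C = insert F D" "D \<in> set_chains (Pow F) S" by blast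
    then have D: "D \<subseteq> Pow F" "\<forall>G\<in>D. \<forall>H\<in>D. G \<subseteq> H \<or> H \<subseteq> G" "card ` D = S" by (auto simp: set_chains_def)
    have "D \<subseteq> \<Delta>" using D(1) fin(3)[OF F(1)] by blast
    moreover have "\<forall>G\<in>insert F D. \<forall>H\<in>insert F D. G \<subseteq> H \<or> H \<subseteq> G" using D(1,2) by blast
    moreover have "card ` insert F D = insert (Suc m) S" using D(3) F(2) by simp
    ultimately show "C \<in> set_chains \<Delta> (insert (Suc m) S)"
      using F(1) by (simp add: F(3) set_chains_def)
  qed
  moreover have "card (\<Union>F\<in>?A. insert F ` set_chains (Pow F) S) = (\<Sum>F\<in>?A. card (insert F ` set_chains (Pow F) S))"
  proof (rule card_UN_disjoint)
    show "finite ?A" using fin(1) by simp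
    show "\<forall>F\<in>?A. finite (insert F ` set_chains (Pow F) S)" using fin(2) finite_set_chains by blast
    show "\<forall>F\<in>?A. \<forall>G\<in>?A. F \<noteq> G \<longrightarrow> insert F ` set_chains (Pow F) S \<inter> insert G ` set_chains (Pow G) S = {}"
    proof (intro ballI impI equals0I)
      fix F G C assume FG: "F \<in> ?A" "G \<in> ?A" "F \<noteq> G" "C \<in> insert F ` set_chains (Pow F) S \<inter> insert G ` set_chains (Pow G) S"
      then obtain D where D: "C = insert G D" "D \<in> set_chains (Pow G) S" by blast
      have "F \<in> C" using FG(4) by blast
      then have "F \<in> D" using D(1) FG(3) by simp
      then show False using small[OF D(2)] FG(1) by force
    qed
  qed
  moreover have "card (insert F ` set_chains (Pow F) S) = card (set_chains (Pow F) S)" if F: "F \<in> ?A" for F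
  proof (rule card_image, rule inj_onI)
    fix D E assume D: "D \<in> set_chains (Pow F) S" "E \<in> set_chains (Pow F) S" "insert F D = insert F E"
    have "F \<notin> D" "F \<notin> E" using small[OF D(1), of F] small[OF D(2), of F] F by auto
    then show "D = E" using D(3) by (simp add: insert_ident)
  qed
  ultimately show ?thesis by simp
qed

lemma chain_poly_Suc:
  assumes \<Delta>: "down_closed \<Delta>"
  shows "chain_poly (Suc m) \<Delta> = chain_poly m \<Delta> * (var (Suc m) - 1) +
    (\<Sum>F\<in>{F \<in> \<Delta>. card F = Suc m}. chain_poly m (Pow F))"
proof -
  let ?P = "\<lambda>A. \<Prod>i\<in>A. var i - 1"
  let ?c = "\<lambda>\<Delta> S. of_nat (card (set_chains \<Delta> S)) :: int_mpoly"
  have ins: "{1..Suc m} = insert (Suc m) {1..m}" by auto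
  have inj: "inj_on (insert (Suc m)) (Pow {1..m})"
  proof (rule inj_onI)
    fix S T assume "S \<in> Pow {1..m}" "T \<in> Pow {1..m}" "insert (Suc m) S = insert (Suc m) T"
    moreover have "Suc m \<notin> S" "Suc m \<notin> T" using calculation by auto
    ultimately show "S = T" by (simp add: insert_ident)
  qed
  have "chain_poly (Suc m) \<Delta> = (\<Sum>S\<in>Pow {1..m}. ?c \<Delta> S * ?P ({1..Suc m} - S)) +
      (\<Sum>S\<in>insert (Suc m) ` Pow {1..m}. ?c \<Delta> S * ?P ({1..Suc m} - S))"
    unfolding chain_poly_def ins Pow_insert by (intro sum.union_disjoint) auto
  also have "(\<Sum>S\<in>Pow {1..m}. ?c \<Delta> S * ?P ({1..Suc m} - S)) = chain_poly m \<Delta> * (var (Suc m) - 1)"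
    unfolding chain_poly_def sum_distrib_right
  proof (intro sum.cong refl)
    fix S assume S: "S \<in> Pow {1..m}"
    then have "{1..Suc m} - S = insert (Suc m) ({1..m} - S)" by auto
    then show "?c \<Delta> S * ?P ({1..Suc m} - S) = ?c \<Delta> S * ?P ({1..m} - S) * (var (Suc m) - 1)"
      by (simp add: mult.commute mult.left_commute)
  qed
  also have "(\<Sum>S\<in>insert (Suc m) ` Pow {1..m}. ?c \<Delta> S * ?P ({1..Suc m} - S)) =
      (\<Sum>S\<in>Pow {1..m}. \<Sum>F\<in>{F \<in> \<Delta>. card F = Suc m}. ?c (Pow F) S * ?P ({1..m} - S))"
    unfolding sum.reindex[OF inj] o_def
  proof (intro sum.cong refl)
    fix S assume S: "S \<in> Pow {1..m}"
    have "{1..Suc m} - insert (Suc m) S = {1..m} - S" by auto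
    then show "?c \<Delta> (insert (Suc m) S) * ?P ({1..Suc m} - insert (Suc m) S) =
       (\<Sum>F\<in>{F \<in> \<Delta>. card F = Suc m}. ?c (Pow F) S * ?P ({1..m} - S))"
      using S by (simp add: set_chains_top[OF \<Delta>] sum_distrib_right)
  qed
  also have "\<dots> = (\<Sum>F\<in>{F \<in> \<Delta>. card F = Suc m}. chain_poly m (Pow F))"
    unfolding chain_poly_def by (rule sum.swap)
  finally show ?thesis .
qed

definition skeleton_h_poly :: "nat \<Rightarrow> 'a set set \<Rightarrow> int poly" where
  "skeleton_h_poly m \<Delta> = h_poly m {F \<in> \<Delta>. card F \<le> m}"

lemma h_poly_Suc:
  assumes "\<And>F. F \<in> \<Delta> \<Longrightarrow> card F \<le> m"
  shows "h_poly (Suc m) \<Delta> = [:1, - 1:] * h_poly m \<Delta>"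
  unfolding h_poly_def sum_distrib_left
proof (intro sum.cong refl)
  fix F assume "F \<in> \<Delta>"
  then have "Suc m - card F = Suc (m - card F)" using assms by (simp add: Suc_diff_le)
  then show "[:0, 1:] ^ card F * [:1, - 1:] ^ (Suc m - card F) = [:1, - 1 :: int:] * ([:0, 1:] ^ card F * [:1, - 1:] ^ (m - card F))"
    by (simp only: power_Suc mult.left_commute)
qed

lemma skeleton_h_poly_Suc:
  assumes "finite \<Delta>"
  shows "skeleton_h_poly (Suc m) \<Delta> = [:1, - 1:] * skeleton_h_poly m \<Delta> +
    monom (int (card {F \<in> \<Delta>. card F = Suc m})) (Suc m)"
proof -
  have "{F \<in> \<Delta>. card F \<le> Suc m} = {F \<in> \<Delta>. card F \<le> m} \<union> {F \<in> \<Delta>. card F = Suc m}" by auto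
  then have "skeleton_h_poly (Suc m) \<Delta> = h_poly (Suc m) {F \<in> \<Delta>. card F \<le> m} + h_poly (Suc m) {F \<in> \<Delta>. card F = Suc m}"
    unfolding skeleton_h_poly_def h_poly_def using assms by (simp only:) (intro sum.union_disjoint, auto)
  moreover have "h_poly (Suc m) {F \<in> \<Delta>. card F = Suc m} = monom (int (card {F \<in> \<Delta>. card F = Suc m})) (Suc m)"
  proof -
    have "h_poly (Suc m) {F \<in> \<Delta>. card F = Suc m} = (\<Sum>F\<in>{F \<in> \<Delta>. card F = Suc m}. monom 1 (Suc m))"
      unfolding h_poly_def by (intro sum.cong refl) (simp add: monom_altdef)
    then show ?thesis by (simp add: of_nat_poly smult_monom)
  qed
  ultimately show ?thesis using h_poly_Suc[of "{F \<in> \<Delta>. card F \<le> m}" m] by (simp add: skeleton_h_poly_def)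
qed

lemma coeff_mult_one_minus_x:
  "coeff ([:1, - 1 :: int:] * p) 0 = coeff p 0"
  "coeff ([:1, - 1 :: int:] * p) (Suc i) = coeff p (Suc i) - coeff p i"
  by (simp_all add: mult_pCons_left)

lemma degree_skeleton_h_poly: "m < i \<Longrightarrow> coeff (skeleton_h_poly m \<Delta>) i = 0"
proof -
  assume i: "m < i"
  have "coeff ([:0, 1:] ^ card F * [:1, - 1 :: int:] ^ (m - card F)) i = 0" if "card F \<le> m" for F :: "'a set"
  proof (rule coeff_eq_0)
    have "degree ([:0, 1:] ^ card F * [:1, - 1 :: int:] ^ (m - card F)) \<le>
      degree ([:0, 1 :: int:] ^ card F) + degree ([:1, - 1 :: int:] ^ (m - card F))"
      by (rule degree_mult_le)
    also have "\<dots> \<le> card F + (m - card F)"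
      by (intro add_mono) (use degree_power_le[of "[:0, 1 :: int:]" "card F"] degree_power_le[of "[:1, - 1 :: int:]" "m - card F"] in auto)
    finally show "degree ([:0, 1:] ^ card F * [:1, - 1 :: int:] ^ (m - card F)) < i" using that i by simp
  qed
  then show ?thesis by (simp add: skeleton_h_poly_def h_poly_def coeff_sum)
qed

text \<open>Up to the term of the faces of size m+1, the h-polynomial of a complex is 1 - x times
  that of its codimension one skeleton; dividing by 1 - x means taking partial sums. The last
  partial sum then counts the faces of size m+1.\<close>

lemma partial_sums_skeleton_h_poly:
  assumes "finite \<Delta>"
  shows "i \<le> m \<Longrightarrow> partial_sums (coeff (skeleton_h_poly (Suc m) \<Delta>)) i = coeff (skeleton_h_poly m \<Delta>) i"
    and "partial_sums (coeff (skeleton_h_poly (Suc m) \<Delta>)) (Suc m) = int (card {F \<in> \<Delta>. card F = Suc m})"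
proof -
  have *: "partial_sums (coeff (skeleton_h_poly (Suc m) \<Delta>)) i = coeff (skeleton_h_poly m \<Delta>) i" if "i \<le> m" for i
    using that by (induction i) (simp_all add: skeleton_h_poly_Suc[OF assms] coeff_mult_one_minus_x del: mult_pCons_left)
  then show "i \<le> m \<Longrightarrow> partial_sums (coeff (skeleton_h_poly (Suc m) \<Delta>)) i = coeff (skeleton_h_poly m \<Delta>) i" .
  show "partial_sums (coeff (skeleton_h_poly (Suc m) \<Delta>)) (Suc m) = int (card {F \<in> \<Delta>. card F = Suc m})"
    using *[of m] degree_skeleton_h_poly[of m "Suc m" \<Delta>]
    by (simp add: skeleton_h_poly_Suc[OF assms] coeff_mult_one_minus_x del: mult_pCons_left)
qed

text \<open>The h-polynomial of a full simplex is (x + (1 - x))^(m+1) = 1 by expanding the product,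
  and the partial sums of (1, 0, 0, ...) are all 1.\<close>

lemma skeleton_h_poly_simplex:
  assumes F: "finite F" "card F = Suc m" and i: "i \<le> m"
  shows "coeff (skeleton_h_poly m (Pow F)) i = 1"
proof -
  have "(\<Sum>E\<in>Pow F. [:0, 1:] ^ card E * [:1, - 1 :: int:] ^ (Suc m - card E)) =
      (\<Sum>E\<in>Pow F. (\<Prod>v\<in>E. [:0, 1:]) * (\<Prod>v\<in>F - E. [:1, - 1:]))"
    using F by (intro sum.cong refl) (auto simp: card_Diff_subset finite_subset)
  also have "\<dots> = (\<Prod>v\<in>F. [:0, 1:] + [:1, - 1:])" using F(1) by (rule prod_add[symmetric])
  also have "[:0, 1:] + [:1, - 1:] = (1 :: int poly)" by (simp add: one_pCons)
  finally have "h_poly (Suc m) (Pow F) = 1" unfolding h_poly_def by simp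
  moreover have "skeleton_h_poly (Suc m) (Pow F) = h_poly (Suc m) (Pow F)"
  proof -
    have "{E \<in> Pow F. card E \<le> Suc m} = Pow F" using F by (auto intro: card_mono[of F, unfolded F(2)])
    then show ?thesis by (simp add: skeleton_h_poly_def)
  qed
  ultimately have "partial_sums (coeff (1 :: int poly)) i = coeff (skeleton_h_poly m (Pow F)) i"
    using partial_sums_skeleton_h_poly(1)[of "Pow F" i m] F(1) i by simp
  moreover have "partial_sums (coeff (1 :: int poly)) i = 1" by (induction i) auto
  ultimately show ?thesis by simp
qed

lemma down_closed_Pow: "finite F \<Longrightarrow> down_closed (Pow F)"
  by (auto simp: down_closed_def finite_subset)

text \<open>The induction runs over all complexes simultaneously: the recursion refers to \<Delta>
  with one size fewer and to the simplices on its faces of size m+1, whose proper skeletons have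
  h-vector (1, ..., 1).\<close>

lemma chain_poly_eq:
  assumes "down_closed \<Delta>" "{} \<in> \<Delta>"
  shows "chain_poly m \<Delta> = h_flag_poly m (coeff (skeleton_h_poly m \<Delta>))"
  using assms
proof (induction m arbitrary: \<Delta>)
  case 0
  have "set_chains \<Delta> {} = {{}}" by (auto simp: set_chains_def)
  moreover have "{F \<in> \<Delta>. card F \<le> 0} = {{}}" using 0 down_closedD(2)[OF 0(1)] by auto
  ultimately show ?case by (simp add: chain_poly_def skeleton_h_poly_def h_poly_def)
next
  case (Suc m)
  note fin = down_closedD(1,2)[OF Suc.prems(1)]
  have "chain_poly m (Pow F) = h_flag_poly m (\<lambda>_. 1)" if F: "F \<in> {F \<in> \<Delta>. card F = Suc m}" for F
  proof -
    have "chain_poly m (Pow F) = h_flag_poly m (coeff (skeleton_h_poly m (Pow F)))"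
      using F fin(2) by (intro Suc.IH down_closed_Pow) auto
    also have "\<dots> = h_flag_poly m (\<lambda>_. 1)"
      using F fin(2) by (intro h_flag_poly_cong skeleton_h_poly_simplex) auto
    finally show ?thesis .
  qed
  moreover have "h_flag_poly m (partial_sums (coeff (skeleton_h_poly (Suc m) \<Delta>))) = chain_poly m \<Delta>"
    unfolding Suc.IH[OF Suc.prems] by (intro h_flag_poly_cong partial_sums_skeleton_h_poly(1)[OF fin(1)])
  ultimately show ?case
    unfolding chain_poly_Suc[OF Suc.prems(1)] h_flag_poly.simps partial_sums_skeleton_h_poly(2)[OF fin(1)]
    by simp
qed

lemma full_set_chain:
  assumes "finite F"
  shows "\<exists>D. (\<forall>G\<in>D. G \<subset> F) \<and> (\<forall>G\<in>D. \<forall>H\<in>D. G \<subseteq> H \<or> H \<subseteq> G) \<and> finite D \<and> card D = card F"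
  using assms
proof (induction F rule: finite_induct)
  case empty
  show ?case by (rule exI[of _ "{}"]) simp
next
  case (insert v F)
  then obtain D where D: "\<forall>G\<in>D. G \<subset> F" "\<forall>G\<in>D. \<forall>H\<in>D. G \<subseteq> H \<or> H \<subseteq> G" "finite D" "card D = card F" by blast
  have "F \<notin> D" using D(1) by auto
  then have "card (insert F D) = card (insert v F)" using D insert by simp
  moreover have "\<forall>G\<in>insert F D. G \<subset> insert v F" using D(1) insert(2) by auto
  moreover have "\<forall>G\<in>insert F D. \<forall>H\<in>insert F D. G \<subseteq> H \<or> H \<subseteq> G" using D(1,2) by auto
  ultimately show ?case using D(3) by (intro exI[of _ "insert F D"]) simp
qed

lemma face_poset_simps:
  "(Some F, Some G) \<in> face_poset \<Delta> \<longleftrightarrow> F \<in> \<Delta> \<and> G \<in> \<Delta> \<and> F \<subseteq> G"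
  "(None, Some G) \<notin> face_poset \<Delta>"
  "(x, None) \<in> face_poset \<Delta> \<longleftrightarrow> x = None \<or> x \<in> Some ` \<Delta>"
  by (auto simp: face_poset_def)

lemma Some_chain:
  assumes "D \<subseteq> \<Delta>" "\<forall>G\<in>D. \<forall>H\<in>D. G \<subseteq> H \<or> H \<subseteq> G"
  shows "Some ` D \<in> Chains (face_poset \<Delta>)"
  unfolding Chains_def using assms by (auto simp: face_poset_simps)

lemma poset_rank_face:
  assumes \<Delta>: "down_closed \<Delta>" and F: "F \<in> \<Delta>"
  shows "poset_rank (face_poset \<Delta>) (Some F) = card F"
proof -
  let ?r = "face_poset \<Delta>"
  have under: "underS ?r (Some F) = Some ` {G. G \<subset> F}"
  proof (intro equalityI subsetI)
    fix x assume "x \<in> underS ?r (Some F)"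
    then have x: "x \<noteq> Some F" "(x, Some F) \<in> ?r" by (auto simp: underS_def)
    then obtain G where "x = Some G" using face_poset_simps(2) by (cases x) auto
    then show "x \<in> Some ` {G. G \<subset> F}" using x by (auto simp: face_poset_simps)
  next
    fix x assume "x \<in> Some ` {G. G \<subset> F}"
    then show "x \<in> underS ?r (Some F)" using F down_closedD(3)[OF \<Delta> F] by (auto simp: underS_def face_poset_simps)
  qed
  have finF: "finite F" using down_closedD(2)[OF \<Delta> F] .
  have fin: "finite {G. G \<subset> F}" using finF by (rule finite_subset[rotated, OF finite_Pow_iff[THEN iffD2]]) auto
  let ?A = "card ` {C \<in> Chains ?r. C \<subseteq> underS ?r (Some F)}"
  have finA: "finite ?A"
    unfolding under by (rule finite_imageI, rule finite_subset[of _ "Pow (Some ` {G. G \<subset> F})"]) (use fin in auto)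
  have "card F \<in> ?A"
  proof -
    obtain D where D: "\<forall>G\<in>D. G \<subset> F" "\<forall>G\<in>D. \<forall>H\<in>D. G \<subseteq> H \<or> H \<subseteq> G" "finite D" "card D = card F"
      using full_set_chain[OF finF] by blast
    have "D \<subseteq> \<Delta>" using D(1) down_closedD(3)[OF \<Delta> F] by blast
    then have "Some ` D \<in> Chains ?r" using D(2) by (rule Some_chain)
    moreover have "Some ` D \<subseteq> underS ?r (Some F)" using D(1) under by auto
    moreover have "card (Some ` D) = card F" using D(4) by (simp add: card_image)
    ultimately show ?thesis by (metis (mono_tags, lifting) image_eqI mem_Collect_eq)
  qed
  moreover have "k \<le> card F" if "k \<in> ?A" for k
  proof -
    from that obtain C where C: "C \<in> Chains ?r" "C \<subseteq> Some ` {G. G \<subset> F}" "k = card C" using under by auto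
    obtain D where D: "C = Some ` D" "D \<subseteq> {G. G \<subset> F}" using C(2) by (meson subset_imageE)
    have "inj_on card D"
    proof (rule inj_onI)
      fix G H assume GH: "G \<in> D" "H \<in> D" "card G = card H"
      have "(Some G, Some H) \<in> ?r \<or> (Some H, Some G) \<in> ?r" using C(1) D(1) GH(1,2) by (auto simp: Chains_def)
      then have "G \<subseteq> H \<or> H \<subseteq> G" by (auto simp: face_poset_simps)
      moreover have "finite G" "finite H" using GH(1,2) D(2) finF by (auto intro: finite_subset)
      ultimately show "G = H" using GH(3) card_subset_eq by metis
    qed
    moreover have "card ` D \<subseteq> {..<card F}" using D(2) finF psubset_card_mono by blast
    ultimately have "card D \<le> card F" using card_inj_on_le[of card D "{..<card F}"] by simp
    then show ?thesis using C(3) D(1) by (simp add: card_image)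
  qed
  ultimately show ?thesis unfolding poset_rank_def using finA by (intro Max_eqI) auto
qed

text \<open>The rank of the adjoined top exceeds the size of every face, so with a face of size n
  present, no chain with type inside {1..n} contains it.\<close>

lemma poset_rank_top:
  assumes \<Delta>: "down_closed \<Delta>" and F: "F \<in> \<Delta>"
  shows "card F < poset_rank (face_poset \<Delta>) None"
proof -
  let ?r = "face_poset \<Delta>"
  have under: "underS ?r None = Some ` \<Delta>" by (auto simp: underS_def face_poset_simps)
  let ?A = "card ` {C \<in> Chains ?r. C \<subseteq> underS ?r None}"
  have finA: "finite ?A"
    unfolding under by (rule finite_imageI, rule finite_subset[of _ "Pow (Some ` \<Delta>)"]) (use down_closedD(1)[OF \<Delta>] in auto)
  obtain D where D: "\<forall>G\<in>D. G \<subset> F" "\<forall>G\<in>D. \<forall>H\<in>D. G \<subseteq> H \<or> H \<subseteq> G" "finite D" "card D = card F"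
    using full_set_chain[OF down_closedD(2)[OF \<Delta> F]] by blast
  have sub: "insert F D \<subseteq> \<Delta>" using F D(1) down_closedD(3)[OF \<Delta> F] by blast
  moreover have "\<forall>G\<in>insert F D. \<forall>H\<in>insert F D. G \<subseteq> H \<or> H \<subseteq> G" using D(1,2) by auto
  ultimately have "Some ` insert F D \<in> Chains ?r" by (rule Some_chain)
  moreover have "Some ` insert F D \<subseteq> underS ?r None" using under sub by auto
  moreover have "card (Some ` insert F D) = Suc (card F)"
  proof -
    have "F \<notin> D" using D(1) by auto
    then show ?thesis using D(3,4) by (subst card_image) auto
  qed
  ultimately have "Suc (card F) \<in> ?A" by (metis (mono_tags, lifting) image_eqI mem_Collect_eq)
  then have "Suc (card F) \<le> Max ?A" using finA by (rule Max_ge[rotated])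
  then show ?thesis by (simp add: poset_rank_def)
qed

lemma flag_number_face_poset:
  assumes \<Delta>: "down_closed \<Delta>" and F: "F \<in> \<Delta>" "card F = n" and S: "S \<subseteq> {1..n}"
  shows "flag_number (face_poset \<Delta>) S = card (set_chains \<Delta> S)"
proof -
  let ?r = "face_poset \<Delta>"
  have rank: "poset_rank ?r ` Some ` D = card ` D" if "D \<subseteq> \<Delta>" for D
    using that poset_rank_face[OF \<Delta>] by (force simp: image_image)
  have "{C \<in> Chains ?r. poset_rank ?r ` C = S} = (`) Some ` set_chains \<Delta> S"
  proof (intro equalityI subsetI)
    fix C assume "C \<in> {C \<in> Chains ?r. poset_rank ?r ` C = S}"
    then have C: "C \<in> Chains ?r" "poset_rank ?r ` C = S" by auto
    have "None \<notin> C"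
    proof
      assume "None \<in> C"
      then have "poset_rank ?r None \<in> {1..n}" using C(2) S by blast
      then show False using poset_rank_top[OF \<Delta> F(1)] F(2) by simp
    qed
    have "x \<in> Some ` \<Delta>" if x: "x \<in> C" for x
    proof -
      have "(x, x) \<in> ?r" using C(1) x by (auto simp: Chains_def)
      moreover obtain G where "x = Some G" using x \<open>None \<notin> C\<close> by (cases x) auto
      ultimately show ?thesis by (auto simp: face_poset_simps)
    qed
    then obtain D where D: "C = Some ` D" "D \<subseteq> \<Delta>" by (meson subsetI subset_imageE)
    have "G \<subseteq> H \<or> H \<subseteq> G" if "G \<in> D" "H \<in> D" for G H
    proof -
      have "(Some G, Some H) \<in> ?r \<or> (Some H, Some G) \<in> ?r" using C(1) D(1) that by (auto simp: Chains_def)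
      then show ?thesis by (auto simp: face_poset_simps)
    qed
    moreover have "card ` D = S" using rank[OF D(2)] C(2) D(1) by simp
    ultimately have "D \<in> set_chains \<Delta> S" using D(2) by (simp add: set_chains_def)
    then show "C \<in> (`) Some ` set_chains \<Delta> S" using D(1) by blast
  next
    fix C assume "C \<in> (`) Some ` set_chains \<Delta> S"
    then obtain D where D: "C = Some ` D" "D \<subseteq> \<Delta>" "\<forall>G\<in>D. \<forall>H\<in>D. G \<subseteq> H \<or> H \<subseteq> G" "card ` D = S"
      by (auto simp: set_chains_def)
    show "C \<in> {C \<in> Chains ?r. poset_rank ?r ` C = S}"
      using Some_chain[OF D(2,3)] rank[OF D(2)] D(1,4) by simp
  qed
  moreover have "inj_on ((`) Some) (set_chains \<Delta> S)" by (auto intro!: inj_onI)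
  ultimately show ?thesis by (simp add: flag_number_def card_image)
qed

lemma flag_poly_face_poset:
  assumes "simplicial_complex \<Delta>" "complex_dim \<Delta> = int n - 1"
  shows "flag_poly n (face_poset \<Delta>) = h_flag_poly n (coeff (h_poly n \<Delta>))"
proof -
  have dc: "down_closed \<Delta>" "{} \<in> \<Delta>"
    using assms(1) simplicial_complex_down_closed by (auto simp: simplicial_complex_def)
  obtain F where F: "F \<in> \<Delta>" "card F = n" using complex_dim_card(2)[OF assms] by blast
  have "flag_poly n (face_poset \<Delta>) = chain_poly n \<Delta>"
    unfolding flag_poly_def chain_poly_def
    by (intro sum.cong refl) (simp add: flag_number_face_poset[OF dc(1) F])
  moreover have "{F \<in> \<Delta>. card F \<le> n} = \<Delta>" using complex_dim_card(1)[OF assms] by auto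
  ultimately show ?thesis using chain_poly_eq[OF dc, of n] by (simp add: skeleton_h_poly_def)
qed

section \<open>Uniqueness of the cd-polynomial and its coefficients\<close>

definition free_of :: "nat \<Rightarrow> int_mpoly \<Rightarrow> bool" where
  "free_of j p \<longleftrightarrow> (\<forall>m\<in>Poly_Mapping.keys p. Poly_Mapping.lookup m j = 0)"

lemma free_of_add: "free_of j p \<Longrightarrow> free_of j q \<Longrightarrow> free_of j (p + q)"
  unfolding free_of_def using Poly_Mapping.keys_add[of p q] by blast

lemma free_of_mult: "free_of j p \<Longrightarrow> free_of j q \<Longrightarrow> free_of j (p * q)"
  unfolding free_of_def using keys_mult[of p q] by (fastforce simp: lookup_add)

lemma free_of_0 [simp]: "free_of j 0"
  by (simp add: free_of_def)

lemma free_of_1 [simp]: "free_of j 1"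
  by (simp add: free_of_def)

lemma free_of_sum: "(\<And>w. w \<in> A \<Longrightarrow> free_of j (f w)) \<Longrightarrow> free_of j (\<Sum>w\<in>A. f w)"
  by (induction A rule: infinite_finite_induct) (auto intro: free_of_add)

lemma free_of_var: "j \<noteq> i \<Longrightarrow> free_of j (var i)"
  by (simp add: free_of_def var_def lookup_single)

lemma free_of_of_int: "free_of j (of_int c)"
proof -
  have "free_of j (of_nat k)" for k by (induction k) (auto intro: free_of_add)
  moreover have "free_of j p \<Longrightarrow> free_of j (- p)" for p by (simp add: free_of_def)
  ultimately show ?thesis by (cases c rule: int_diff_cases) (simp, metis add_uminus_conv_diff free_of_add)
qed

lemma free_of_cd_monomial_eval: "j < i \<Longrightarrow> free_of j (cd_monomial_eval i w)"
proof (induction i w rule: cd_monomial_eval.induct)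
  case (2 i w)
  have "free_of j (var i + 1)" using 2(2) by (intro free_of_add free_of_var free_of_1) simp
  moreover have "free_of j (cd_monomial_eval (i + 1) w)" using 2 by simp
  ultimately show ?case unfolding cd_monomial_eval.simps by (rule free_of_mult)
next
  case (3 i w)
  have "free_of j (var i + var (i + 1))" using 3(2) by (intro free_of_add free_of_var) simp_all
  moreover have "free_of j (cd_monomial_eval (i + 2) w)" using 3 by simp
  ultimately show ?case unfolding cd_monomial_eval.simps by (rule free_of_mult)
qed simp

lemma var_nonzero: "var i \<noteq> 0"
  by (simp add: var_def)

lemma free_of_separate:
  assumes p: "free_of i p" and q: "free_of i q" and eq: "var i * p + q = 0"
  shows "p = 0" "q = 0"
proof -
  have "Poly_Mapping.lookup m i = 1" if "m \<in> Poly_Mapping.keys (var i * p)" for m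
  proof -
    from that keys_mult[of "var i" p] obtain b where
      "m = Poly_Mapping.single i 1 + b" "b \<in> Poly_Mapping.keys p"
      by (auto simp: var_def)
    then show ?thesis using p by (simp add: free_of_def lookup_add)
  qed
  moreover have "var i * p = - q" using eq by (simp add: eq_neg_iff_add_eq_0)
  then have "Poly_Mapping.keys (var i * p) = Poly_Mapping.keys q" by simp
  ultimately have "Poly_Mapping.keys (var i * p) = {}" using q unfolding free_of_def by force
  then have "var i * p = 0" by simp
  then show "p = 0" using var_nonzero[of i] by simp
  then show "q = 0" using eq by simp
qed

lemma cd_monomials_rec:
  "cd_monomials 0 = {[]}" "cd_monomials (Suc 0) = {[C_letter]}"
  "cd_monomials (Suc (Suc n)) = Cons C_letter ` cd_monomials (Suc n) \<union> Cons D_letter ` cd_monomials n"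
proof -
  have 0: "cd_degree w = 0 \<longleftrightarrow> w = []" for w by (cases w rule: cd_degree.cases) auto
  show "cd_monomials 0 = {[]}" by (simp add: cd_monomials_def 0)
  show "cd_monomials (Suc 0) = {[C_letter]}"
  proof -
    have "cd_degree w = Suc 0 \<longleftrightarrow> w = [C_letter]" for w by (cases w rule: cd_degree.cases) (auto simp: 0)
    then show ?thesis by (simp add: cd_monomials_def)
  qed
  show "cd_monomials (Suc (Suc n)) = Cons C_letter ` cd_monomials (Suc n) \<union> Cons D_letter ` cd_monomials n"
  proof (intro equalityI subsetI)
    fix w assume "w \<in> cd_monomials (Suc (Suc n))"
    then show "w \<in> Cons C_letter ` cd_monomials (Suc n) \<union> Cons D_letter ` cd_monomials n"
      by (cases w rule: cd_degree.cases) (auto simp: cd_monomials_def)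
  qed (auto simp: cd_monomials_def)
qed

lemma finite_cd_monomials: "finite (cd_monomials n)"
  by (induction n rule: induct_nat_012) (simp_all add: cd_monomials_rec)

text \<open>Sort by the first letter: the relation reads (t_i + 1) A + (t_i + t_(i+1)) B = 0, where
  A is free of t_i and B is free of t_i and t_(i+1). Comparing coefficients of t_i gives A + B = 0
  and A + t_(i+1) B = 0. Hence t_(i+1) B = B, which forces B = 0 and then A = 0.\<close>

lemma cd_monomials_independent:
  assumes "(\<Sum>w\<in>cd_monomials n. of_int (a w) * cd_monomial_eval i w) = 0" "w \<in> cd_monomials n"
  shows "a w = 0"
  using assms
proof (induction n arbitrary: a i w rule: induct_nat_012)
  case 0
  then show ?case by (simp add: cd_monomials_rec)
next
  case 1
  have "var i * of_int (a w) + of_int (a w) = 0" using 1 by (simp add: cd_monomials_rec algebra_simps)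
  then have "(of_int (a w) :: int_mpoly) = 0"
    by (rule free_of_separate(2)[OF free_of_of_int free_of_of_int])
  then show ?case by simp
next
  case (ge2 n)
  define A where "A = (\<Sum>w\<in>cd_monomials (Suc n). of_int (a (C_letter # w)) * cd_monomial_eval (i + 1) w)"
  define B where "B = (\<Sum>w\<in>cd_monomials n. of_int (a (D_letter # w)) * cd_monomial_eval (i + 2) w)"
  have "0 = (\<Sum>w\<in>Cons C_letter ` cd_monomials (Suc n). of_int (a w) * cd_monomial_eval i w) +
      (\<Sum>w\<in>Cons D_letter ` cd_monomials n. of_int (a w) * cd_monomial_eval i w)"
    using ge2.prems(1) unfolding cd_monomials_rec(3)
    by (subst (asm) sum.union_disjoint) (auto simp: finite_cd_monomials)
  also have "\<dots> = (var i + 1) * A + (var i + var (i + 1)) * B"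
    by (simp add: A_def B_def sum.reindex sum_distrib_left mult.left_commute del: add_2_eq_Suc')
  finally have eq: "var i * (A + B) + (A + var (i + 1) * B) = 0" by (simp add: algebra_simps)
  have freeA: "free_of i A" unfolding A_def
    by (intro free_of_sum free_of_mult free_of_of_int free_of_cd_monomial_eval) simp
  have freeB: "free_of j B" if "j < i + 2" for j unfolding B_def
    using that by (intro free_of_sum free_of_mult free_of_of_int free_of_cd_monomial_eval)
  have "free_of i (A + B)" "free_of i (A + var (i + 1) * B)"
    using freeA freeB[of i] by (auto intro!: free_of_add free_of_mult free_of_var)
  from free_of_separate[OF this eq] have AB: "A + B = 0" "A + var (i + 1) * B = 0" .
  then have "var (i + 1) * B + - B = 0" by (simp add: add_eq_0_iff)
  moreover have "free_of (i + 1) (- B)" using freeB[of "i + 1"] by (simp add: free_of_def)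
  ultimately have B0: "B = 0" using free_of_separate(1)[of "i + 1" B "- B"] freeB[of "i + 1"] by simp
  then have A0: "A = 0" using AB(1) by simp
  have "a (C_letter # u) = 0" if "u \<in> cd_monomials (Suc n)" for u
    using A0 that unfolding A_def by (rule ge2.IH(2))
  moreover have "a (D_letter # u) = 0" if "u \<in> cd_monomials n" for u
    using B0 that unfolding B_def by (rule ge2.IH(1))
  ultimately show ?case using ge2.prems(2) unfolding cd_monomials_rec(3) by blast
qed

lemma lookup_multidegree_from: "j < i \<Longrightarrow> Poly_Mapping.lookup (multidegree_from i w) j = 0"
  by (induction i w rule: multidegree_from.induct) (auto simp: lookup_add lookup_single)

lemma inj_multidegree_from: "inj_on (multidegree_from i) (cd_monomials n)"
proof (induction n arbitrary: i rule: induct_nat_012)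
  case (ge2 n)
  show ?case
  proof (rule inj_onI)
    fix u w assume uw: "u \<in> cd_monomials (Suc (Suc n))" "w \<in> cd_monomials (Suc (Suc n))"
      and eq: "multidegree_from i u = multidegree_from i w"
    have C: "Poly_Mapping.lookup (multidegree_from i (C_letter # v)) i = 0" for v
      by (simp add: lookup_multidegree_from)
    have D: "Poly_Mapping.lookup (multidegree_from i (D_letter # v)) i = 1" for v
      by (simp add: lookup_add lookup_multidegree_from)
    from uw(1) consider u' where "u = C_letter # u'" "u' \<in> cd_monomials (Suc n)"
      | u' where "u = D_letter # u'" "u' \<in> cd_monomials n" unfolding cd_monomials_rec(3) by blast
    then show "u = w"
    proof cases
      case 1
      obtain w' where "w = C_letter # w'" "w' \<in> cd_monomials (Suc n)"
        using uw(2) eq C[of u'] D 1(1) unfolding cd_monomials_rec(3) by fastforce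
      then show ?thesis using 1 eq inj_onD[OF ge2(2)[of "i + 1"], of u' w'] by simp
    next
      case 2
      obtain w' where "w = D_letter # w'" "w' \<in> cd_monomials n"
        using uw(2) eq D[of u'] C 2(1) unfolding cd_monomials_rec(3) by fastforce
      then show ?thesis using 2 eq inj_onD[OF ge2(1)[of "i + 2"], of u' w'] by simp
    qed
  qed
qed (simp_all add: cd_monomials_rec)

lemma cd_eval_sum:
  assumes "Poly_Mapping.keys \<Phi> \<subseteq> cd_monomials n"
  shows "cd_eval \<Phi> = (\<Sum>w\<in>cd_monomials n. of_int (Poly_Mapping.lookup \<Phi> w) * cd_monomial_eval 1 w)"
  unfolding cd_eval_def using assms finite_cd_monomials
  by (intro sum.mono_neutral_left) (auto simp: in_keys_iff)

text \<open>Independence of the cd-monomials makes the definite description in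
  \<open>cd_index\<close> well defined, so any polynomial with the right value is the
  cd-index.\<close>

lemma cd_index_eqI:
  assumes \<Phi>: "Poly_Mapping.keys \<Phi> \<subseteq> cd_monomials n" "cd_eval \<Phi> = flag_poly n r"
  shows "cd_index n r = \<Phi>"
  unfolding cd_index_def
proof (rule the_equality)
  show "Poly_Mapping.keys \<Phi> \<subseteq> cd_monomials n \<and> cd_eval \<Phi> = flag_poly n r" using \<Phi> by simp
  fix \<Psi> assume \<Psi>: "Poly_Mapping.keys \<Psi> \<subseteq> cd_monomials n \<and> cd_eval \<Psi> = flag_poly n r"
  have "(\<Sum>w\<in>cd_monomials n. of_int (Poly_Mapping.lookup \<Psi> w - Poly_Mapping.lookup \<Phi> w) * cd_monomial_eval 1 w) = 0"
    using cd_eval_sum[OF \<Phi>(1)] cd_eval_sum[of \<Psi> n] \<Phi>(2) \<Psi> by (simp add: left_diff_distrib sum_subtractf)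
  then have "Poly_Mapping.lookup \<Psi> w = Poly_Mapping.lookup \<Phi> w" if "w \<in> cd_monomials n" for w
    using cd_monomials_independent[of "\<lambda>w. Poly_Mapping.lookup \<Psi> w - Poly_Mapping.lookup \<Phi> w" 1 n w] that by simp
  moreover have "Poly_Mapping.lookup \<Psi> w = Poly_Mapping.lookup \<Phi> w" if "w \<notin> cd_monomials n" for w
    using \<Phi>(1) \<Psi> that by (metis in_keys_iff subsetD)
  ultimately show "\<Psi> = \<Phi>" by (intro poly_mapping_eqI) blast
qed

definition face_multidegree :: "(nat \<times> 'b) set \<Rightarrow> (nat \<Rightarrow>\<^sub>0 int)" where
  "face_multidegree F = (\<Sum>x\<in>F. Poly_Mapping.single (fst x) 1)"

lemma multidegree_from_append:
  "multidegree_from i (u @ w) = multidegree_from i u + multidegree_from (i + cd_degree u) w"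
  by (induction i u rule: multidegree_from.induct) (auto simp: add.assoc)

lemma multidegree_color_word:
  "F \<in> lattice_faces n h \<Longrightarrow> multidegree (color_word n (fst ` F)) = face_multidegree F"
  unfolding multidegree_def
proof (induction n h arbitrary: F rule: lattice_faces.induct)
  case (3 m h)
  from "3.prems" consider "F \<in> lattice_faces (Suc m) (partial_sums h)"
    | l a F' where "l \<in> {1..Suc m}" "a < h l" "F = insert (Suc m, l, a) F'" "F' \<in> lattice_faces m (transition (m + 2) l)"
    by auto
  then show ?case
  proof cases
    case 1
    have "Suc m \<notin> fst ` F"
    proof
      assume "Suc m \<in> fst ` F"
      then obtain x where "x \<in> F" "fst x = Suc m" by auto
      then show False using lattice_faces_colors[OF 1, of x] by simp
    qed
    then show ?thesis using "3.IH"(1)[OF 1] by (simp add: multidegree_from_append)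
  next
    case 2
    have "a \<in> {..<h l}" using 2(2) by simp
    note IH = "3.IH"(2)[OF 2(1) this 2(4)]
    have "(Suc m, l, a) \<notin> F'" using lattice_faces_colors[OF 2(4), of "(Suc m, l, a)"] by auto
    moreover have "color_word m (fst ` insert (Suc m, l, a) F') = color_word m (fst ` F')"
      by (rule color_word_cong) auto
    ultimately show ?thesis unfolding 2(3) using IH finite_lattice_face[OF 2(4)]
      by (simp add: multidegree_from_append cd_degree_color_word face_multidegree_def)
  qed
qed (simp_all add: face_multidegree_def)

text \<open>The sum of the words of all faces evaluates to the flag polynomial, so it is the
  cd-index. Words of degree n are determined by their multidegree, and the multidegree of the word
  of a face is the sum of the unit vectors of its colours.\<close>

lemma cd_coeff_lattice:
  assumes "flag_poly n r = lattice_cd_sum n h"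
  shows "cd_coeff n r v = int (card {F \<in> lattice_faces n h. face_multidegree F = v})"
proof -
  let ?w = "\<lambda>F :: (nat \<times> nat \<times> nat) set. color_word n (fst ` F)"
  define \<Phi> :: cd_poly where "\<Phi> = (\<Sum>F\<in>lattice_faces n h. Poly_Mapping.single (?w F) 1)"
  have look: "Poly_Mapping.lookup \<Phi> w = int (card {F \<in> lattice_faces n h. ?w F = w})" for w
  proof -
    have "Poly_Mapping.lookup \<Phi> w = (\<Sum>F\<in>lattice_faces n h. if ?w F = w then 1 else 0)"
      unfolding \<Phi>_def lookup_sum by (intro sum.cong) (auto simp: lookup_single when_def)
    also have "\<dots> = (\<Sum>F\<in>{F \<in> lattice_faces n h. ?w F = w}. 1)"
      by (rule sum.inter_filter[symmetric]) (rule finite_lattice_faces)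
    finally show ?thesis by simp
  qed
  have w: "?w F \<in> cd_monomials n" for F by (simp add: cd_monomials_def cd_degree_color_word)
  have keys: "Poly_Mapping.keys \<Phi> \<subseteq> cd_monomials n"
  proof
    fix u assume "u \<in> Poly_Mapping.keys \<Phi>"
    then have "card {F \<in> lattice_faces n h. ?w F = u} \<noteq> 0" using look[of u] by (simp add: in_keys_iff)
    then have "{F \<in> lattice_faces n h. ?w F = u} \<noteq> {}" by force
    then obtain F where "?w F = u" by blast
    then show "u \<in> cd_monomials n" using w by blast
  qed
  have "cd_eval \<Phi> = (\<Sum>w\<in>cd_monomials n. \<Sum>F\<in>{F \<in> lattice_faces n h. ?w F = w}. cd_monomial_eval 1 (?w F))"
    unfolding cd_eval_sum[OF keys] look by (intro sum.cong refl) simp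
  also have "\<dots> = lattice_cd_sum n h"
    unfolding lattice_cd_sum_def using w by (intro sum.group finite_lattice_faces finite_cd_monomials) blast
  finally have index: "cd_index n r = \<Phi>" using keys assms by (intro cd_index_eqI) simp_all
  have inj: "inj_on multidegree (cd_monomials n)"
    unfolding multidegree_def by (rule inj_multidegree_from)
  show ?thesis
  proof (cases "v \<in> multidegree ` cd_monomials n")
    case True
    then obtain u where u: "u \<in> cd_monomials n" "v = multidegree u" by blast
    have "{F \<in> lattice_faces n h. face_multidegree F = v} = {F \<in> lattice_faces n h. ?w F = u}"
      unfolding u(2) by (intro Collect_cong conj_cong refl)
        (simp add: multidegree_color_word[symmetric] inj_on_eq_iff[OF inj w u(1)])
    moreover have "inv_into (cd_monomials n) multidegree v = u" using u inj by simp
    ultimately show ?thesis using True index look[of u] by (simp add: cd_coeff_def)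
  next
    case False
    then have "{F \<in> lattice_faces n h. face_multidegree F = v} = {}"
      using multidegree_color_word[of _ n h, symmetric] w by auto
    then show ?thesis using False by (simp only: cd_coeff_def if_False card.empty of_nat_0)
  qed
qed

section \<open>The face ring of a coloured complex modulo the squares of its variables\<close>

locale face_algebra = field K for K (structure) +
  fixes \<Gamma> :: "(nat \<times> 'v) set set" and e :: "(nat \<times> 'v) set \<Rightarrow> nat" and n :: nat
  assumes finite_faces: "finite \<Gamma>"
    and empty_face: "{} \<in> \<Gamma>"
    and finite_face: "F \<in> \<Gamma> \<Longrightarrow> finite F"
    and face_subset: "F \<in> \<Gamma> \<Longrightarrow> G \<subseteq> F \<Longrightarrow> G \<in> \<Gamma>"
    and face_color: "F \<in> \<Gamma> \<Longrightarrow> x \<in> F \<Longrightarrow> fst x \<in> {1..n}"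
    and inj: "inj_on e \<Gamma>"
begin

definition encode :: "((nat \<times> 'v) set \<Rightarrow> 'a) \<Rightarrow> nat \<Rightarrow> 'a" where
  "encode f = (\<lambda>i. if i \<in> e ` \<Gamma> then f (inv_into \<Gamma> e i) else \<zero>)"

text \<open>An element is a combination of squarefree monomials, one for each face. The product of
  the monomials of G and H is that of G \<union> H if they are disjoint with union in \<Gamma>, and
  zero otherwise; the convolution therefore runs over the splittings of F into a subset and its
  complement.\<close>

definition A :: "('a, nat \<Rightarrow> 'a) module" where
  "A = \<lparr>carrier = encode ` (\<Gamma> \<rightarrow> carrier K),
        monoid.mult = (\<lambda>x y. encode (\<lambda>F. \<Oplus>G\<in>Pow F. x (e G) \<otimes> y (e (F - G)))),
        monoid.one = encode (\<lambda>F. if F = {} then \<one> else \<zero>),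
        ring.zero = encode (\<lambda>_. \<zero>),
        ring.add = (\<lambda>x y. encode (\<lambda>F. x (e F) \<oplus> y (e F))),
        module.smult = (\<lambda>a x. encode (\<lambda>F. a \<otimes> x (e F)))\<rparr>"

definition \<delta> :: "(nat \<times> 'v) set \<Rightarrow> nat \<Rightarrow> 'a" where
  "\<delta> F = encode (\<lambda>G. if G = F then \<one> else \<zero>)"

definition component :: "(nat \<Rightarrow>\<^sub>0 int) \<Rightarrow> (nat \<Rightarrow> 'a) set" where
  "component v = {x \<in> carrier A. \<forall>F\<in>\<Gamma>. x (e F) \<noteq> \<zero> \<longrightarrow> face_multidegree F = v}"

lemma encode_eval [simp]: "F \<in> \<Gamma> \<Longrightarrow> encode f (e F) = f F"
  using inj by (simp add: encode_def)

lemma encode_closed: "(\<And>F. F \<in> \<Gamma> \<Longrightarrow> f F \<in> carrier K) \<Longrightarrow> encode f \<in> carrier A"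
  by (simp add: A_def)

lemma eval_closed [simp]: "x \<in> carrier A \<Longrightarrow> F \<in> \<Gamma> \<Longrightarrow> x (e F) \<in> carrier K"
  by (auto simp: A_def)

lemma A_eqI:
  assumes "x \<in> carrier A" "y \<in> carrier A" "\<And>F. F \<in> \<Gamma> \<Longrightarrow> x (e F) = y (e F)"
  shows "x = y"
proof -
  have "x i = y i" for i
    using assms by (cases "i \<in> e ` \<Gamma>") (auto simp: A_def encode_def)
  then show ?thesis by blast
qed

lemma eval_zero [simp]: "F \<in> \<Gamma> \<Longrightarrow> \<zero>\<^bsub>A\<^esub> (e F) = \<zero>"
  by (simp add: A_def)

lemma eval_one [simp]: "F \<in> \<Gamma> \<Longrightarrow> \<one>\<^bsub>A\<^esub> (e F) = (if F = {} then \<one> else \<zero>)"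
  by (simp add: A_def)

lemma eval_add [simp]: "F \<in> \<Gamma> \<Longrightarrow> (x \<oplus>\<^bsub>A\<^esub> y) (e F) = x (e F) \<oplus> y (e F)"
  by (simp add: A_def)

lemma eval_smult [simp]: "F \<in> \<Gamma> \<Longrightarrow> (a \<odot>\<^bsub>A\<^esub> x) (e F) = a \<otimes> x (e F)"
  by (simp add: A_def)

lemma eval_mult: "F \<in> \<Gamma> \<Longrightarrow> (x \<otimes>\<^bsub>A\<^esub> y) (e F) = (\<Oplus>G\<in>Pow F. x (e G) \<otimes> y (e (F - G)))"
  by (simp add: A_def)

lemma eval_\<delta> [simp]: "F \<in> \<Gamma> \<Longrightarrow> \<delta> G (e F) = (if F = G then \<one> else \<zero>)"
  by (simp add: \<delta>_def)

lemma eval_Pow [simp]: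
  assumes "x \<in> carrier A" "F \<in> \<Gamma>" "G \<subseteq> F"
  shows "x (e G) \<in> carrier K" "x (e (F - G)) \<in> carrier K" "x (e (G - H)) \<in> carrier K"
    "x (e (F - G - H)) \<in> carrier K"
proof -
  have "G \<in> \<Gamma>" "F - G \<in> \<Gamma>" "G - H \<in> \<Gamma>" "F - G - H \<in> \<Gamma>"
    using assms by (auto intro: face_subset[OF assms(2)])
  then show "x (e G) \<in> carrier K" "x (e (F - G)) \<in> carrier K" "x (e (G - H)) \<in> carrier K"
    "x (e (F - G - H)) \<in> carrier K"
    using assms(1) by simp_all
qed

lemma finsum_single:
  assumes "finite S" "\<And>i. i \<in> S \<Longrightarrow> i \<noteq> k \<Longrightarrow> f i = \<zero>" "k \<in> S \<Longrightarrow> f k \<in> carrier K"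
  shows "finsum K f S = (if k \<in> S then f k else \<zero>)"
proof (cases "k \<in> S")
  case True
  have "finsum K f {k} = finsum K f S"
  proof (rule add.finprod_mono_neutral_cong_left)
    show "f \<in> S \<rightarrow> carrier K"
    proof
      fix i assume "i \<in> S"
      then show "f i \<in> carrier K" using assms by (cases "i = k") simp_all
    qed
  qed (use assms True in auto)
  then show ?thesis using True assms(3) by simp
next
  case False
  then show ?thesis using assms(2) by (auto intro!: add.finprod_one_eqI)
qed

lemma finite_Pow_face: "F \<in> \<Gamma> \<Longrightarrow> finite (Pow F)"
  by (simp add: finite_face)

lemma A_closed [simp]:
  "\<zero>\<^bsub>A\<^esub> \<in> carrier A" "\<one>\<^bsub>A\<^esub> \<in> carrier A" "\<delta> F \<in> carrier A"
  "x \<in> carrier A \<Longrightarrow> y \<in> carrier A \<Longrightarrow> x \<oplus>\<^bsub>A\<^esub> y \<in> carrier A"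
  "a \<in> carrier K \<Longrightarrow> x \<in> carrier A \<Longrightarrow> a \<odot>\<^bsub>A\<^esub> x \<in> carrier A"
proof -
  show "\<zero>\<^bsub>A\<^esub> \<in> carrier A" by (simp add: A_def)
  show "\<one>\<^bsub>A\<^esub> \<in> carrier A" by (simp add: A_def)
  show "\<delta> F \<in> carrier A" by (auto simp: \<delta>_def intro: encode_closed)
  show "x \<oplus>\<^bsub>A\<^esub> y \<in> carrier A" if "x \<in> carrier A" "y \<in> carrier A"
    using that encode_closed[of "\<lambda>F. x (e F) \<oplus> y (e F)"] by (simp add: A_def)
  show "a \<odot>\<^bsub>A\<^esub> x \<in> carrier A" if "a \<in> carrier K" "x \<in> carrier A"
    using that encode_closed[of "\<lambda>F. a \<otimes> x (e F)"] by (simp add: A_def)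
qed

lemma mult_closed [simp]:
  assumes "x \<in> carrier A" "y \<in> carrier A"
  shows "x \<otimes>\<^bsub>A\<^esub> y \<in> carrier A"
proof -
  have "encode (\<lambda>F. \<Oplus>G\<in>Pow F. x (e G) \<otimes> y (e (F - G))) \<in> carrier A"
    using assms by (intro encode_closed finsum_closed) simp
  then show ?thesis by (simp add: A_def)
qed

lemma abelian_group_A: "abelian_group A"
proof (rule abelian_groupI)
  fix x assume x: "x \<in> carrier A"
  have "(\<ominus> \<one>) \<odot>\<^bsub>A\<^esub> x \<oplus>\<^bsub>A\<^esub> x = \<zero>\<^bsub>A\<^esub>"
    using x by (intro A_eqI) (simp_all add: l_minus l_neg)
  then show "\<exists>y\<in>carrier A. y \<oplus>\<^bsub>A\<^esub> x = \<zero>\<^bsub>A\<^esub>" using x A_closed(5)[of "\<ominus> \<one>" x] by blast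
qed (auto intro!: A_eqI simp: a_ac)

lemma mult_comm:
  assumes "x \<in> carrier A" "y \<in> carrier A"
  shows "x \<otimes>\<^bsub>A\<^esub> y = y \<otimes>\<^bsub>A\<^esub> x"
proof (rule A_eqI)
  fix F assume F: "F \<in> \<Gamma>"
  have "(\<Oplus>G\<in>Pow F. x (e G) \<otimes> y (e (F - G))) = (\<Oplus>G\<in>Pow F. y (e G) \<otimes> x (e (F - G)))"
    by (rule finsum_reindex_bij_witness[where i = "\<lambda>G. F - G" and j = "\<lambda>G. F - G"])
      (use assms F in \<open>auto simp: double_diff m_comm\<close>)
  then show "(x \<otimes>\<^bsub>A\<^esub> y) (e F) = (y \<otimes>\<^bsub>A\<^esub> x) (e F)" using F by (simp add: eval_mult)
qed (use assms in simp_all)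

text \<open>Both sides are sums over ordered splittings of F into the three blocks H, G - H and F -
  G, taken in a different order of summation.\<close>

lemma mult_assoc:
  assumes "x \<in> carrier A" "y \<in> carrier A" "z \<in> carrier A"
  shows "x \<otimes>\<^bsub>A\<^esub> y \<otimes>\<^bsub>A\<^esub> z = x \<otimes>\<^bsub>A\<^esub> (y \<otimes>\<^bsub>A\<^esub> z)"
proof (rule A_eqI)
  fix F assume F: "F \<in> \<Gamma>"
  let ?t = "\<lambda>G H. x (e H) \<otimes> y (e (G - H)) \<otimes> z (e (F - G))"
  have closed: "?t G H \<in> carrier K" if "H \<subseteq> G" "G \<subseteq> F" for G H
    using that assms F face_subset[OF F, of H] by auto
  have "(x \<otimes>\<^bsub>A\<^esub> y \<otimes>\<^bsub>A\<^esub> z) (e F) = (\<Oplus>G\<in>Pow F. \<Oplus>H\<in>Pow F. if H \<subseteq> G then ?t G H else \<zero>)"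
    unfolding eval_mult[OF F]
  proof (rule finsum_cong')
    fix G assume G: "G \<in> Pow F"
    then have "G \<in> \<Gamma>" using face_subset[OF F] by simp
    then have "(x \<otimes>\<^bsub>A\<^esub> y) (e G) \<otimes> z (e (F - G)) = (\<Oplus>H\<in>Pow G. ?t G H)"
      using assms F G unfolding eval_mult[OF \<open>G \<in> \<Gamma>\<close>] by (intro finsum_ldistr finite_Pow_face) auto
    also have "\<dots> = (\<Oplus>H\<in>Pow F. if H \<subseteq> G then ?t G H else \<zero>)"
      using G closed finite_Pow_face[OF F] by (intro add.finprod_mono_neutral_cong_left) auto
    finally show "(x \<otimes>\<^bsub>A\<^esub> y) (e G) \<otimes> z (e (F - G)) = (\<Oplus>H\<in>Pow F. if H \<subseteq> G then ?t G H else \<zero>)" .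
  qed (use closed in \<open>auto intro!: finsum_closed\<close>)
  also have "\<dots> = (\<Oplus>H\<in>Pow F. \<Oplus>G\<in>Pow F. if H \<subseteq> G then ?t G H else \<zero>)"
    using closed by (intro finsum_finsum_swap finite_Pow_face[OF F]) auto
  also have "\<dots> = (x \<otimes>\<^bsub>A\<^esub> (y \<otimes>\<^bsub>A\<^esub> z)) (e F)"
    unfolding eval_mult[OF F]
  proof (rule finsum_cong')
    fix H assume H: "H \<in> Pow F"
    then have FH: "F - H \<in> \<Gamma>" using face_subset[OF F] by simp
    have "(\<Oplus>G\<in>Pow F. if H \<subseteq> G then ?t G H else \<zero>) = (\<Oplus>G\<in>{G. H \<subseteq> G \<and> G \<subseteq> F}. ?t G H)"
      using closed finite_Pow_face[OF F] by (intro add.finprod_mono_neutral_cong_right) auto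
    also have "\<dots> = (\<Oplus>G\<in>Pow (F - H). x (e H) \<otimes> (y (e G) \<otimes> z (e (F - H - G))))"
    proof (rule finsum_reindex_bij_witness[where i = "\<lambda>G. G \<union> H" and j = "\<lambda>G. G - H"])
      fix G assume G: "G \<in> {G. H \<subseteq> G \<and> G \<subseteq> F}"
      then have "F - H - (G - H) = F - G" by blast
      then show "x (e H) \<otimes> (y (e (G - H)) \<otimes> z (e (F - H - (G - H)))) = ?t G H"
        using G H assms F by (simp add: m_assoc)
    qed (use assms F FH H closed in auto)
    also have "\<dots> = x (e H) \<otimes> (y \<otimes>\<^bsub>A\<^esub> z) (e (F - H))"
      unfolding eval_mult[OF FH] using assms F FH H
      by (intro finsum_rdistr[symmetric] finite_Pow_face) auto
    finally show "(\<Oplus>G\<in>Pow F. if H \<subseteq> G then ?t G H else \<zero>) = x (e H) \<otimes> (y \<otimes>\<^bsub>A\<^esub> z) (e (F - H))" .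
  qed (use assms F in auto)
  finally show "(x \<otimes>\<^bsub>A\<^esub> y \<otimes>\<^bsub>A\<^esub> z) (e F) = (x \<otimes>\<^bsub>A\<^esub> (y \<otimes>\<^bsub>A\<^esub> z)) (e F)" .
qed (use assms in simp_all)

lemma mult_one_left:
  assumes "x \<in> carrier A"
  shows "\<one>\<^bsub>A\<^esub> \<otimes>\<^bsub>A\<^esub> x = x"
proof (rule A_eqI)
  fix F assume F: "F \<in> \<Gamma>"
  have "(\<one>\<^bsub>A\<^esub> \<otimes>\<^bsub>A\<^esub> x) (e F) = (if {} \<in> Pow F then \<one>\<^bsub>A\<^esub> (e {}) \<otimes> x (e (F - {})) else \<zero>)"
    unfolding eval_mult[OF F] using assms F face_subset[OF F] empty_face
    by (intro finsum_single finite_Pow_face) auto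
  then show "(\<one>\<^bsub>A\<^esub> \<otimes>\<^bsub>A\<^esub> x) (e F) = x (e F)" using assms F empty_face by simp
qed (use assms in simp_all)

lemma cring_A: "cring A"
proof (intro cringI abelian_group_A comm_monoidI)
  fix x y z assume xyz: "x \<in> carrier A" "y \<in> carrier A" "z \<in> carrier A"
  show "(x \<oplus>\<^bsub>A\<^esub> y) \<otimes>\<^bsub>A\<^esub> z = x \<otimes>\<^bsub>A\<^esub> z \<oplus>\<^bsub>A\<^esub> y \<otimes>\<^bsub>A\<^esub> z"
  proof (rule A_eqI)
    fix F assume F: "F \<in> \<Gamma>"
    have "(\<Oplus>G\<in>Pow F. (x \<oplus>\<^bsub>A\<^esub> y) (e G) \<otimes> z (e (F - G))) =
        (\<Oplus>G\<in>Pow F. x (e G) \<otimes> z (e (F - G)) \<oplus> y (e G) \<otimes> z (e (F - G)))"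
      using xyz F face_subset[OF F] by (intro finsum_cong') (auto simp: l_distr)
    also have "\<dots> = (\<Oplus>G\<in>Pow F. x (e G) \<otimes> z (e (F - G))) \<oplus> (\<Oplus>G\<in>Pow F. y (e G) \<otimes> z (e (F - G)))"
      using xyz F by (intro finsum_addf) auto
    finally show "((x \<oplus>\<^bsub>A\<^esub> y) \<otimes>\<^bsub>A\<^esub> z) (e F) = (x \<otimes>\<^bsub>A\<^esub> z \<oplus>\<^bsub>A\<^esub> y \<otimes>\<^bsub>A\<^esub> z) (e F)"
      using F by (simp add: eval_mult)
  qed (use xyz in simp_all)
qed (auto simp: mult_assoc mult_one_left intro: mult_comm)

lemma algebra_A: "algebra K A"
proof (rule algebraI)
  fix a x y assume axy: "a \<in> carrier K" "x \<in> carrier A" "y \<in> carrier A"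
  show "(a \<odot>\<^bsub>A\<^esub> x) \<otimes>\<^bsub>A\<^esub> y = a \<odot>\<^bsub>A\<^esub> (x \<otimes>\<^bsub>A\<^esub> y)"
  proof (rule A_eqI)
    fix F assume F: "F \<in> \<Gamma>"
    have "(\<Oplus>G\<in>Pow F. (a \<odot>\<^bsub>A\<^esub> x) (e G) \<otimes> y (e (F - G))) =
        (\<Oplus>G\<in>Pow F. a \<otimes> (x (e G) \<otimes> y (e (F - G))))"
      using axy F face_subset[OF F] by (intro finsum_cong') (auto simp: m_assoc)
    also have "\<dots> = a \<otimes> (\<Oplus>G\<in>Pow F. x (e G) \<otimes> y (e (F - G)))"
      using axy F by (intro finsum_rdistr[symmetric] finite_Pow_face) auto
    finally show "((a \<odot>\<^bsub>A\<^esub> x) \<otimes>\<^bsub>A\<^esub> y) (e F) = (a \<odot>\<^bsub>A\<^esub> (x \<otimes>\<^bsub>A\<^esub> y)) (e F)"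
      using F by (simp add: eval_mult)
  qed (use axy in simp_all)
qed (use cring_A is_cring in \<open>auto intro!: A_eqI simp: l_distr r_distr m_assoc\<close>)


sublocale A: algebra K A
  by (rule algebra_A)

lemma vectorspace_A: "vectorspace K A"
  by (intro vectorspace.intro A.module field_axioms)

lemma eval_finsum:
  assumes "f \<in> S \<rightarrow> carrier A" "F \<in> \<Gamma>"
  shows "finsum A f S (e F) = (\<Oplus>v\<in>S. f v (e F))"
  using assms
proof (induction S rule: infinite_finite_induct)
  case (insert v S)
  then have "finsum A f (insert v S) = f v \<oplus>\<^bsub>A\<^esub> finsum A f S"
    by (intro A.finsum_insert) auto
  moreover have "(\<Oplus>v\<in>insert v S. f v (e F)) = f v (e F) \<oplus> (\<Oplus>v\<in>S. f v (e F))"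
    using insert by (intro finsum_insert Pi_I eval_closed) auto
  ultimately show ?case using insert by auto
qed (simp_all add: A.finsum_infinite finsum_infinite)

lemma component_eq_zero:
  "x \<in> component v \<Longrightarrow> F \<in> \<Gamma> \<Longrightarrow> face_multidegree F \<noteq> v \<Longrightarrow> x (e F) = \<zero>"
  by (auto simp: component_def)

lemma component_subset: "component v \<subseteq> carrier A"
  by (auto simp: component_def)

lemma face_multidegree_Zn:
  assumes "F \<in> \<Gamma>"
  shows "face_multidegree F \<in> Zn n"
proof -
  have "Poly_Mapping.keys (face_multidegree F) \<subseteq> (\<Union>x\<in>F. Poly_Mapping.keys (Poly_Mapping.single (fst x) (1::int)))"
    unfolding face_multidegree_def by (rule keys_sum)
  also have "\<dots> \<subseteq> {1..n}" using face_color[OF assms] by auto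
  finally show ?thesis by (simp add: Zn_def)
qed

lemma face_multidegree_eq_0:
  assumes "finite F"
  shows "face_multidegree F = 0 \<longleftrightarrow> F = {}"
proof
  assume 0: "face_multidegree F = 0"
  show "F = {}"
  proof (rule ccontr)
    assume "F \<noteq> {}"
    then obtain x where x: "x \<in> F" by blast
    have "0 = (\<Sum>y\<in>F. Poly_Mapping.lookup (Poly_Mapping.single (fst y) (1::int)) (fst x))"
      using 0 by (metis face_multidegree_def lookup_sum lookup_zero)
    moreover have "\<dots> \<ge> Poly_Mapping.lookup (Poly_Mapping.single (fst x) (1::int)) (fst x)"
      using assms x by (intro member_le_sum) (auto simp: lookup_single when_def)
    ultimately show False by simp
  qed
qed (simp add: face_multidegree_def)

lemma face_multidegree_split:
  "finite F \<Longrightarrow> G \<subseteq> F \<Longrightarrow> face_multidegree G + face_multidegree (F - G) = face_multidegree F"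
  unfolding face_multidegree_def by (rule sum.subset_diff[of G F, symmetric, unfolded add.commute[of "sum _ (F - G)"]])

lemma component_submodule: "LinearCombinations.submodule K (component v) A"
proof
  show "x \<oplus>\<^bsub>A\<^esub> y \<in> component v" if "x \<in> component v" "y \<in> component v" for x y
    using that by (auto simp: component_def)
  show "a \<odot>\<^bsub>A\<^esub> x \<in> component v" if "a \<in> carrier K" "x \<in> component v" for a x
    using that by (auto simp: component_def)
qed (auto simp: component_def)

lemma component_subspace: "VectorSpace.subspace K (component v) A"
  by (intro VectorSpace.subspace.intro vectorspace_A component_submodule)

lemma component_mult:
  assumes x: "x \<in> component u" and y: "y \<in> component v"
  shows "x \<otimes>\<^bsub>A\<^esub> y \<in> component (u + v)"
proof -
  have xy: "x \<in> carrier A" "y \<in> carrier A" using x y component_subset by auto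
  have "(x \<otimes>\<^bsub>A\<^esub> y) (e F) = \<zero>" if F: "F \<in> \<Gamma>" and ne: "face_multidegree F \<noteq> u + v" for F
    unfolding eval_mult[OF F]
  proof (rule add.finprod_one_eqI)
    fix G assume "G \<in> Pow F"
    then have G: "G \<subseteq> F" "G \<in> \<Gamma>" "F - G \<in> \<Gamma>" using face_subset[OF F] by auto
    have "face_multidegree G \<noteq> u \<or> face_multidegree (F - G) \<noteq> v"
      using ne face_multidegree_split[OF finite_face[OF F] G(1)] by auto
    then have "x (e G) = \<zero> \<or> y (e (F - G)) = \<zero>"
      using component_eq_zero[OF x G(2)] component_eq_zero[OF y G(3)] by blast
    then show "x (e G) \<otimes> y (e (F - G)) = \<zero>" using xy G by auto
  qed
  then show ?thesis unfolding component_def using xy by auto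
qed

text \<open>At a face F only the component indexed by the multidegree of F can contribute. This
  value formula (\<open>eval\<close>) yields both existence and uniqueness.\<close>

lemma component_decomposition:
  assumes a: "a \<in> carrier A"
  shows "\<exists>!x. x \<in> (\<Pi>\<^sub>E v\<in>Zn n. component v) \<and> finite {v \<in> Zn n. x v \<noteq> \<zero>\<^bsub>A\<^esub>} \<and>
    a = (\<Oplus>\<^bsub>A\<^esub>v\<in>{v \<in> Zn n. x v \<noteq> \<zero>\<^bsub>A\<^esub>}. x v)"
proof -
  define x where "x = (\<lambda>v\<in>Zn n. encode (\<lambda>F. if face_multidegree F = v then a (e F) else \<zero>))"
  have eval: "(\<Oplus>\<^bsub>A\<^esub>v\<in>{v \<in> Zn n. y v \<noteq> \<zero>\<^bsub>A\<^esub>}. y v) (e F) = y (face_multidegree F) (e F)"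
    if y: "y \<in> (\<Pi>\<^sub>E v\<in>Zn n. component v)" and fin: "finite {v \<in> Zn n. y v \<noteq> \<zero>\<^bsub>A\<^esub>}" and F: "F \<in> \<Gamma>" for y F
  proof -
    let ?S = "{v \<in> Zn n. y v \<noteq> \<zero>\<^bsub>A\<^esub>}"
    have yv: "y v \<in> component v" if "v \<in> Zn n" for v using y that by auto
    have "(\<Oplus>\<^bsub>A\<^esub>v\<in>?S. y v) (e F) = (\<Oplus>v\<in>?S. y v (e F))"
      using yv component_subset F by (intro eval_finsum) blast+
    also have "\<dots> = (if face_multidegree F \<in> ?S then y (face_multidegree F) (e F) else \<zero>)"
    proof (rule finsum_single[OF fin])
      show "y v (e F) = \<zero>" if "v \<in> ?S" "v \<noteq> face_multidegree F" for v
        using component_eq_zero[OF yv F] that by auto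
      show "y (face_multidegree F) (e F) \<in> carrier K"
        by (rule eval_closed[OF subsetD[OF component_subset yv[OF face_multidegree_Zn[OF F]]] F])
    qed
    finally show ?thesis using F face_multidegree_Zn[OF F] by auto
  qed
  have x: "x \<in> (\<Pi>\<^sub>E v\<in>Zn n. component v)"
  proof (rule PiE_I)
    fix v assume "v \<in> Zn n"
    moreover have "encode (\<lambda>F. if face_multidegree F = v then a (e F) else \<zero>) \<in> carrier A"
      using a by (intro encode_closed) simp
    ultimately show "x v \<in> component v" by (simp add: x_def component_def)
  qed (simp add: x_def)
  have "{v \<in> Zn n. x v \<noteq> \<zero>\<^bsub>A\<^esub>} \<subseteq> face_multidegree ` \<Gamma>"
  proof
    fix v assume v: "v \<in> {v \<in> Zn n. x v \<noteq> \<zero>\<^bsub>A\<^esub>}"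
    show "v \<in> face_multidegree ` \<Gamma>"
    proof (rule ccontr)
      assume not: "v \<notin> face_multidegree ` \<Gamma>"
      have xv: "x v \<in> component v" using x v by auto
      have "x v = \<zero>\<^bsub>A\<^esub>"
      proof (rule A_eqI)
        fix F assume F: "F \<in> \<Gamma>"
        then have "face_multidegree F \<noteq> v" using not by blast
        then show "x v (e F) = \<zero>\<^bsub>A\<^esub> (e F)" using component_eq_zero[OF xv F] F by simp
      qed (use xv component_subset in auto)
      then show False using v by simp
    qed
  qed
  then have fin: "finite {v \<in> Zn n. x v \<noteq> \<zero>\<^bsub>A\<^esub>}" using finite_faces finite_surj by blast
  show ?thesis
  proof (rule ex1I[of _ x], intro conjI x fin)
    show "a = (\<Oplus>\<^bsub>A\<^esub>v\<in>{v \<in> Zn n. x v \<noteq> \<zero>\<^bsub>A\<^esub>}. x v)"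
    proof (rule A_eqI[OF a])
      have "x v \<in> carrier A" if "v \<in> Zn n" for v using x that component_subset by blast
      then show "(\<Oplus>\<^bsub>A\<^esub>v\<in>{v \<in> Zn n. x v \<noteq> \<zero>\<^bsub>A\<^esub>}. x v) \<in> carrier A"
        by (intro A.finsum_closed) auto
      show "a (e F) = (\<Oplus>\<^bsub>A\<^esub>v\<in>{v \<in> Zn n. x v \<noteq> \<zero>\<^bsub>A\<^esub>}. x v) (e F)" if "F \<in> \<Gamma>" for F
        unfolding eval[OF x fin that] using that face_multidegree_Zn[OF that] by (simp add: x_def)
    qed
  next
    fix y assume y: "y \<in> (\<Pi>\<^sub>E v\<in>Zn n. component v) \<and> finite {v \<in> Zn n. y v \<noteq> \<zero>\<^bsub>A\<^esub>} \<and>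
      a = (\<Oplus>\<^bsub>A\<^esub>v\<in>{v \<in> Zn n. y v \<noteq> \<zero>\<^bsub>A\<^esub>}. y v)"
    show "y = x"
    proof (rule PiE_ext)
      fix v assume v: "v \<in> Zn n"
      have xy: "x v \<in> component v" "y v \<in> component v" using x y v by auto
      show "y v = x v"
      proof (rule A_eqI)
        fix F assume F: "F \<in> \<Gamma>"
        show "y v (e F) = x v (e F)"
        proof (cases "face_multidegree F = v")
          case True
          then have "y v (e F) = a (e F)" using eval[of y F] y F by auto
          then show ?thesis using True v F by (simp add: x_def)
        next
          case False
          then show ?thesis using component_eq_zero[OF xy(1) F] component_eq_zero[OF xy(2) F] by simp
        qed
      qed (use xy component_subset in auto)
    qed (use x y in auto)
  qed
qed

lemma \<delta>_component: "F \<in> \<Gamma> \<Longrightarrow> \<delta> F \<in> component (face_multidegree F)"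
  by (auto simp: component_def)

lemma \<delta>_empty: "\<delta> {} = \<one>\<^bsub>A\<^esub>"
  by (rule A_eqI) simp_all

lemma \<delta>_insert:
  assumes F: "insert x F \<in> \<Gamma>" "x \<notin> F"
  shows "\<delta> {x} \<otimes>\<^bsub>A\<^esub> \<delta> F = \<delta> (insert x F)"
proof (rule A_eqI)
  fix H assume H: "H \<in> \<Gamma>"
  have sub: "G \<in> \<Gamma>" "H - G \<in> \<Gamma>" if "G \<subseteq> H" for G using that face_subset[OF H] by auto
  have "(\<delta> {x} \<otimes>\<^bsub>A\<^esub> \<delta> F) (e H) = (if {x} \<in> Pow H then \<delta> {x} (e {x}) \<otimes> \<delta> F (e (H - {x})) else \<zero>)"
    unfolding eval_mult[OF H] using sub by (intro finsum_single finite_Pow_face[OF H]) auto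
  also have "\<dots> = \<delta> (insert x F) (e H)"
  proof (cases "x \<in> H")
    case True
    then have "H - {x} = F \<longleftrightarrow> H = insert x F" using F(2) by auto
    then show ?thesis using True sub[of "{x}"] H by simp
  next
    case False
    then show ?thesis using H by auto
  qed
  finally show "(\<delta> {x} \<otimes>\<^bsub>A\<^esub> \<delta> F) (e H) = \<delta> (insert x F) (e H)" .
qed simp_all

text \<open>The monomial of a face is the product of its vertices, each of degree a unit vector by
  \<open>face_color\<close>, and every element is a finite combination of such monomials.\<close>

lemma generated_A:
  "generate_ring A ((\<lambda>s. s \<odot>\<^bsub>A\<^esub> \<one>\<^bsub>A\<^esub>) ` carrier K \<union> (\<Union>i\<in>{1..n}. component (Poly_Mapping.single i 1))) = carrier A"
    (is "generate_ring A ?H = _")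
proof
  have "?H \<subseteq> carrier A" using component_subset by auto
  then show "generate_ring A ?H \<subseteq> carrier A" by (rule A.generate_ring_incl)
  have scalar: "s \<odot>\<^bsub>A\<^esub> \<one>\<^bsub>A\<^esub> \<in> generate_ring A ?H" if "s \<in> carrier K" for s
    using that by (intro generate_ring.incl) blast
  have \<delta>: "\<delta> F \<in> generate_ring A ?H" if "F \<in> \<Gamma>" for F
    using finite_face[OF that] that
  proof (induction F rule: finite_induct)
    case empty
    show ?case unfolding \<delta>_empty by (rule generate_ring.one)
  next
    case (insert x F)
    have "{x} \<in> \<Gamma>" "F \<in> \<Gamma>" using face_subset[OF insert.prems] by auto
    have "\<delta> {x} \<in> component (Poly_Mapping.single (fst x) 1)"
      using \<delta>_component[OF \<open>{x} \<in> \<Gamma>\<close>] by (simp add: face_multidegree_def)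
    moreover have "fst x \<in> {1..n}" by (rule face_color[OF insert.prems]) simp
    ultimately have "\<delta> {x} \<in> generate_ring A ?H" by (intro generate_ring.incl) blast
    then show ?case
      unfolding \<delta>_insert[OF insert.prems insert.hyps(2), symmetric]
      using insert.IH[OF \<open>F \<in> \<Gamma>\<close>] by (rule generate_ring.eng_mult)
  qed
  show "carrier A \<subseteq> generate_ring A ?H"
  proof
    fix a assume a: "a \<in> carrier A"
    have "encode (\<lambda>F. if F \<in> S then a (e F) else \<zero>) \<in> generate_ring A ?H" if "S \<subseteq> \<Gamma>" for S
      using finite_subset[OF that finite_faces] that
    proof (induction S rule: finite_induct)
      case empty
      have "encode (\<lambda>F. if F \<in> {} then a (e F) else \<zero>) = \<zero>\<^bsub>A\<^esub>"
        by (rule A_eqI) (auto intro: encode_closed)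
      then show ?case using A.zero_in_generate by simp
    next
      case (insert F S)
      then have F: "F \<in> \<Gamma>" by simp
      let ?f = "\<lambda>S. encode (\<lambda>F. if F \<in> S then a (e F) else \<zero>)"
      have closed: "?f S \<in> carrier A" for S using a by (intro encode_closed) simp
      have "?f (insert F S) = ?f S \<oplus>\<^bsub>A\<^esub> a (e F) \<odot>\<^bsub>A\<^esub> \<delta> F"
      proof (rule A_eqI[OF closed])
        show "?f S \<oplus>\<^bsub>A\<^esub> a (e F) \<odot>\<^bsub>A\<^esub> \<delta> F \<in> carrier A" using closed a F by simp
      qed (use a F insert.hyps(2) in auto)
      also have "a (e F) \<odot>\<^bsub>A\<^esub> \<delta> F = (a (e F) \<odot>\<^bsub>A\<^esub> \<one>\<^bsub>A\<^esub>) \<otimes>\<^bsub>A\<^esub> \<delta> F"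
        using a F by (simp add: A.smult_assoc2)
      finally show ?case
        using insert.IH insert.prems scalar[of "a (e F)"] \<delta>[OF F] a F
        by (auto intro: generate_ring.eng_add generate_ring.eng_mult)
    qed
    from this[OF subset_refl] have "encode (\<lambda>F. if F \<in> \<Gamma> then a (e F) else \<zero>) \<in> generate_ring A ?H" .
    moreover have "encode (\<lambda>F. if F \<in> \<Gamma> then a (e F) else \<zero>) = a"
      using a by (intro A_eqI) (auto intro: encode_closed)
    ultimately show "a \<in> generate_ring A ?H" by simp
  qed
qed

lemma degree_zero_A: "bij_betw (\<lambda>s. s \<odot>\<^bsub>A\<^esub> \<one>\<^bsub>A\<^esub>) (carrier K) (component 0)"
proof (rule bij_betwI[where g = "\<lambda>x. x (e {})"])
  have one: "\<one>\<^bsub>A\<^esub> \<in> component 0" using \<delta>_component[OF empty_face] by (simp add: \<delta>_empty face_multidegree_def)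
  show "(\<lambda>s. s \<odot>\<^bsub>A\<^esub> \<one>\<^bsub>A\<^esub>) \<in> carrier K \<rightarrow> component 0"
    using LinearCombinations.submodule.smult_closed[OF component_submodule _ one] by blast
  show "(\<lambda>x. x (e {})) \<in> component 0 \<rightarrow> carrier K" using eval_closed[OF subsetD[OF component_subset] empty_face] by blast
  show "(s \<odot>\<^bsub>A\<^esub> \<one>\<^bsub>A\<^esub>) (e {}) = s" if "s \<in> carrier K" for s using that empty_face by simp
  show "x (e {}) \<odot>\<^bsub>A\<^esub> \<one>\<^bsub>A\<^esub> = x" if x: "x \<in> component 0" for x
  proof (rule A_eqI)
    have xA: "x \<in> carrier A" using x component_subset by auto
    then show "x (e {}) \<odot>\<^bsub>A\<^esub> \<one>\<^bsub>A\<^esub> \<in> carrier A" "x \<in> carrier A" using empty_face by simp_all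
    fix F assume F: "F \<in> \<Gamma>"
    show "(x (e {}) \<odot>\<^bsub>A\<^esub> \<one>\<^bsub>A\<^esub>) (e F) = x (e F)"
    proof (cases "F = {}")
      case True
      then show ?thesis using xA empty_face by simp
    next
      case False
      then have "face_multidegree F \<noteq> 0" using face_multidegree_eq_0[OF finite_face[OF F]] by simp
      then show ?thesis using component_eq_zero[OF x F] xA empty_face F False by simp
    qed
  qed
qed

theorem standard_graded: "standard_Zn_graded_algebra K A n component"
  by (intro standard_Zn_graded_algebra.intro algebra_A field_axioms standard_Zn_graded_algebra_axioms.intro
      component_subspace component_decomposition component_mult degree_zero_A generated_A)

text \<open>The monomials of the faces of multidegree \<open>v\<close> form a basis; the coordinate
  of an element at such a monomial is its value there.\<close>

theorem component_dim:
  shows "vectorspace.fin_dim K (A\<lparr>carrier := component v\<rparr>)"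
    and "vectorspace.dim K (A\<lparr>carrier := component v\<rparr>) = card {F \<in> \<Gamma>. face_multidegree F = v}"
proof -
  interpret V: vectorspace K A by (rule vectorspace_A)
  interpret W: vectorspace K "A\<lparr>carrier := component v\<rparr>"
    by (rule V.subspace_is_vs[OF component_subspace])
  let ?G = "{F \<in> \<Gamma>. face_multidegree F = v}"
  define S where "S = \<delta> ` ?G"
  have fin: "finite S" using finite_faces by (simp add: S_def)
  have SW: "S \<subseteq> component v" unfolding S_def using \<delta>_component by auto
  then have SA: "S \<subseteq> carrier A" using component_subset by blast
  have inj\<delta>: "inj_on \<delta> \<Gamma>"
  proof (rule inj_onI)
    fix F G assume FG: "F \<in> \<Gamma>" "G \<in> \<Gamma>" "\<delta> F = \<delta> G"
    then have "\<delta> G (e F) = \<one>" by (metis eval_\<delta>)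
    then show "F = G" using FG(1) by (simp split: if_splits)
  qed
  have eval: "A.lincomb a S (e F) = (if face_multidegree F = v then a (\<delta> F) else \<zero>)"
    if a: "a \<in> S \<rightarrow> carrier K" and F: "F \<in> \<Gamma>" for a F
  proof -
    have "A.lincomb a S (e F) = (\<Oplus>w\<in>S. (a w \<odot>\<^bsub>A\<^esub> w) (e F))"
      unfolding A.lincomb_def using a SA F by (intro eval_finsum) auto
    also have "\<dots> = (if \<delta> F \<in> S then (a (\<delta> F) \<odot>\<^bsub>A\<^esub> \<delta> F) (e F) else \<zero>)"
    proof (rule finsum_single[OF fin])
      fix w assume w: "w \<in> S" "w \<noteq> \<delta> F"
      then obtain G where "w = \<delta> G" by (auto simp: S_def)
      then have "w (e F) = \<zero>" using w(2) F by auto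
      moreover have "a w \<in> carrier K" using a w(1) by blast
      ultimately show "(a w \<odot>\<^bsub>A\<^esub> w) (e F) = \<zero>" using F by simp
    next
      show "(a (\<delta> F) \<odot>\<^bsub>A\<^esub> \<delta> F) (e F) \<in> carrier K" if "\<delta> F \<in> S"
        using that a F by auto
    qed
    finally have "A.lincomb a S (e F) = (if \<delta> F \<in> S then (a (\<delta> F) \<odot>\<^bsub>A\<^esub> \<delta> F) (e F) else \<zero>)" .
    moreover have "\<delta> F \<in> S \<longleftrightarrow> face_multidegree F = v"
      unfolding S_def using inj_on_image_mem_iff[OF inj\<delta> F, of ?G] F by auto
    moreover have "a (\<delta> F) \<in> carrier K" if "face_multidegree F = v"
      using a that F by (auto simp: S_def)
    ultimately show ?thesis using F by simp
  qed
  have li: "A.lin_indpt S"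
  proof (rule A.finite_lin_indpt2[OF fin SA])
    fix a assume a: "a \<in> S \<rightarrow> carrier K" "A.lincomb a S = \<zero>\<^bsub>A\<^esub>"
    show "\<forall>w\<in>S. a w = \<zero>" using eval[OF a(1)] a(2) by (fastforce simp: S_def)
  qed
  have span: "A.span S = component v"
  proof
    show "A.span S \<subseteq> component v" using A.span_is_subset[OF SW component_submodule] .
    show "component v \<subseteq> A.span S"
    proof
      fix x assume x: "x \<in> component v"
      have xA: "x \<in> carrier A" using x component_subset by auto
      let ?a = "\<lambda>w. x (e (inv_into \<Gamma> \<delta> w))"
      have a: "?a \<in> S \<rightarrow> carrier K" using xA inj\<delta> by (auto simp: S_def)
      have "A.lincomb ?a S = x"
      proof (rule A_eqI)
        fix F assume F: "F \<in> \<Gamma>"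
        show "A.lincomb ?a S (e F) = x (e F)"
          using eval[OF a F] component_eq_zero[OF x F] inv_into_f_f[OF inj\<delta> F] by auto
      qed (use xA A.lincomb_closed[OF SA a] in simp_all)
      then show "x \<in> A.span S"
        unfolding A.finite_span[OF fin SA] using a by (intro CollectI exI[of _ ?a] conjI) simp_all
    qed
  qed
  note sub = A.span_li_not_depend[OF SW component_submodule]
  have basis: "W.basis S" unfolding W.basis_def using li span sub SW by simp
  show "W.fin_dim" unfolding W.fin_dim_def using basis fin W.basis_def by blast
  have "card S = card ?G" unfolding S_def by (rule card_image) (rule inj_on_subset[OF inj\<delta>], blast)
  then show "W.dim = card ?G" using W.dim_basis[OF fin basis] by simp
qed

end

theorem theorem1p3:
  fixes K :: "('k, 'm) ring_scheme" and \<Delta> :: "'a::linorder set set" and n :: nat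
  assumes "field K"
    and "simplicial_complex \<Delta>"
    and "complex_dim \<Delta> = int n - 1"
    and "gorenstein_star TYPE('r::idom) \<Delta>"
  shows "\<exists>(A :: ('k, nat \<Rightarrow> 'k) module) \<A>.
           standard_Zn_graded_algebra K A n \<A> \<and>
           (\<forall>v\<in>Zn n.
              vectorspace.fin_dim K (A\<lparr>carrier := \<A> v\<rparr>) \<and>
              cd_coeff n (face_poset \<Delta>) v = int (vectorspace.dim K (A\<lparr>carrier := \<A> v\<rparr>)))"
proof -
  define h where "h i = nat (coeff (h_poly n \<Delta>) i)" for i
  have nonneg: "coeff (h_poly n \<Delta>) i \<ge> 0" for i
    using gorenstein_star_h_poly(1)[OF assms(2-4)] .
  have h: "int (h i) = coeff (h_poly n \<Delta>) i" for i using nonneg by (simp add: h_def)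
  have h0: "h 0 = 1" using h_poly_coeff_0[OF assms(2), of n] by (simp add: h_def)
  have sym: "int (h (n - j)) = int (h j)" if "j \<le> n" for j
    using gorenstein_star_h_poly(2)[OF assms(2-4) that] by (simp add: h)
  \<comment> \<open>Symmetry of the h-vector makes every term of the correction vanish, so the face
    count of the coloured complex is exactly the flag polynomial.\<close>
  have "h_flag_poly (n - 1) (\<lambda>i. \<Sum>j\<le>i. int (h (n - j)) - int (h j)) = h_flag_poly (n - 1) (\<lambda>i. 0)" if "n \<noteq> 0"
    using that by (intro h_flag_poly_cong sum.neutral) (auto simp: sym)
  then have "lattice_cd_sum n h = h_flag_poly n (\<lambda>i. int (h i))"
    unfolding lattice_cd_sum_eq[where h = h and n = n, OF h0] by (simp add: h_flag_poly_zero)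
  then have flag: "flag_poly n (face_poset \<Delta>) = lattice_cd_sum n h"
    using flag_poly_face_poset[OF assms(2,3)] by (simp add: h)
  define \<Gamma> where "\<Gamma> = lattice_faces n h"
  have "finite \<Gamma>" unfolding \<Gamma>_def by (rule finite_lattice_faces)
  then obtain e :: "(nat \<times> nat \<times> nat) set \<Rightarrow> nat" where e: "inj_on e \<Gamma>"
    using finite_imp_inj_to_nat_seg by blast
  interpret field K by fact
  interpret face_algebra K \<Gamma> e n
  proof
    show "{} \<in> \<Gamma>" unfolding \<Gamma>_def by (rule empty_lattice_faces)
    show "F \<in> \<Gamma> \<Longrightarrow> x \<in> F \<Longrightarrow> fst x \<in> {1..n}" for F x
      unfolding \<Gamma>_def using lattice_faces_colors[of F n h x] by simp
    show "F \<in> \<Gamma> \<Longrightarrow> G \<subseteq> F \<Longrightarrow> G \<in> \<Gamma>" for F G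
      unfolding \<Gamma>_def using lattice_faces_down_closed[of F n h G] h0 by simp
  qed (use \<open>finite \<Gamma>\<close> e finite_lattice_face in \<open>auto simp: \<Gamma>_def\<close>)
  show ?thesis
    using standard_graded component_dim cd_coeff_lattice[OF flag] unfolding \<Gamma>_def[symmetric]
    by (intro exI[of _ A] exI[of _ component] conjI ballI) simp_all
qed


end
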